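(* Let $d\ge2$ and $f\in L^2(\mathbb{R}^d)$. Then the function $Q:(0,\infty)\to\mathbb{R}$, $$Q(t)=\frac{|\mathbb{S}^{d-1}|}{4(2\pi)^{d-1}}\|e^{t\Delta}f\|_{L^2(\mathbb{R}^d)}^4-\big\|(-\Delta)^{\frac{2-d}{4}}|e^{is\Delta}e^{t\Delta}f|^2\big\|_{L^2(\mathbb{R}\times\mathbb{R}^d)}^2,$$ is completely monotone (decreasing).
   Context: Fourier transform convention: $\widehat f(\xi)=\int_{\mathbb{R}^d}f(x)e^{-ix\cdot\xi}\,\mathrm{d}x$. For $t>0$, $\widehat{e^{t\Delta}f}(\xi)=e^{-t|\xi|^2}\widehat f(\xi)$. For $h$ on $\mathbb{R}^d$, $e^{is\Delta}h$ denotes the function $(s,x)\mapsto (e^{is\Delta}h)(x)$ with $\widehat{e^{is\Delta}h}(\xi)=e^{-is|\xi|^2}\widehat h(\xi)$. The operator $(-\Delta)^{\frac{2-d}{4}}$ acts on functions of $(s,x)$ in the spatial variable $x$ only, as the Fourier multiplier $|\zeta|^{\frac{2-d}{2}}$ (so $\|(-\Delta)^{\frac{2-d}{4}}F\|_{L^2}^2=(2\pi)^{-d-1}\int|\zeta|^{2-d}|\widetilde F(\tau,\zeta)|^2\,\mathrm{d}\zeta\,\mathrm{d}\tau$ with $\widetilde F$ the space-time Fourier transform). $|\mathbb{S}^{d-1}|$ is the surface area of the unit sphere in $\mathbb{R}^d$. A function $Q:(0,\infty)\to\mathbb{R}$ is completely monotone (decreasing) if it is infinitely differentiable and $(-1)^kQ^{(k)}(t)\ge0$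 for all $t>0$ and all positive integers $k$. *)

theory Defs
  imports "HOL-Analysis.Analysis"
begin

definition ft :: "(real^'n \<Rightarrow> complex) \<Rightarrow> real^'n \<Rightarrow> complex" where
  "ft h \<xi> = (LINT x|lebesgue. h x * exp (- \<i> * complex_of_real (x \<bullet> \<xi>)))"

definition is_L2 :: "(real^'n \<Rightarrow> complex) \<Rightarrow> bool" where
  "is_L2 h \<longleftrightarrow> h \<in> borel_measurable lebesgue \<and> integrable lebesgue (\<lambda>x. (cmod (h x))^2)"

definition is_L2_fourier :: "(real^'n \<Rightarrow> complex) \<Rightarrow> (real^'n \<Rightarrow> complex) \<Rightarrow> bool" where
  "is_L2_fourier f F \<longleftrightarrow> is_L2 F \<and>
     ((\<lambda>R. LINT \<xi>|lebesgue. (cmod (F \<xi> - ft (\<lambda>x. indicator (ball 0 R) x * f x) \<xi>))^2)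
        \<longlongrightarrow> 0) at_top"

definition L2_ft :: "(real^'n \<Rightarrow> complex) \<Rightarrow> real^'n \<Rightarrow> complex" where
  "L2_ft f = (SOME F. is_L2_fourier f F)"

text \<open>schrod_heat f t s x = (e^{is Delta} e^{t Delta} f)(x), defined through the Fourier
  multiplier e^{-is|xi|^2} e^{-t|xi|^2} and Fourier inversion (absolutely convergent for t > 0).
  For s = 0 this is (e^{t Delta} f)(x).\<close>
definition schrod_heat :: "(real^'n \<Rightarrow> complex) \<Rightarrow> real \<Rightarrow> real \<Rightarrow> real^'n \<Rightarrow> complex" where
  "schrod_heat f t s x =
     complex_of_real ((2 * pi) powr (- real CARD('n))) *
     (LINT \<xi>|lebesgue. exp (\<i> * complex_of_real (x \<bullet> \<xi>)) *
        exp (- (complex_of_real t + \<i> * complex_of_real s) * complex_of_real ((norm \<xi>)^2)) *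
        L2_ft f \<xi>)"

definition sphere_area :: "nat \<Rightarrow> real" where
  "sphere_area d = 2 * pi powr (real d / 2) / Gamma (real d / 2)"

text \<open>|| (-Delta)^{(2-d)/4} |u|^2 ||^2_{L^2(R x R^d)} with u = e^{is Delta} e^{t Delta} f, where the
  operator is the spatial Fourier multiplier |zeta|^{(2-d)/2}; computed slice-wise in s
  via spatial Plancherel (|u(s,.)|^2 is in L^1(R^d)), as an extended nonnegative real.\<close>
definition riesz_sq :: "(real^'n \<Rightarrow> complex) \<Rightarrow> real \<Rightarrow> ennreal" where
  "riesz_sq f t =
     (\<integral>\<^sup>+ s. (\<integral>\<^sup>+ \<zeta>. ennreal ((2 * pi) powr (- real CARD('n)) *
          norm \<zeta> powr (2 - real CARD('n)) *
          (cmod (ft (\<lambda>x. complex_of_real ((cmod (schrod_heat f t s x))^2)) \<zeta>))^2) \<partial>lebesgue) \<partial>lborel)"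

definition Qfun :: "(real^'n \<Rightarrow> complex) \<Rightarrow> real \<Rightarrow> real" where
  "Qfun f t =
     sphere_area CARD('n) / (4 * (2 * pi) ^ (CARD('n) - 1)) *
       (LINT x|lebesgue. (cmod (schrod_heat f t 0 x))^2)^2
     - enn2real (riesz_sq f t)"

definition completely_monotone :: "(real \<Rightarrow> real) \<Rightarrow> bool" where
  "completely_monotone Q \<longleftrightarrow>
     (\<forall>k. \<forall>t>0. ((deriv ^^ k) Q) differentiable (at t)) \<and>
     (\<forall>k\<ge>1. \<forall>t>0. (-1) ^ k * (deriv ^^ k) Q t \<ge> 0)"

end

theory Submission
  imports Defs "HOL-Probability.Characteristic_Functions"
begin

text \<open>
  Let \<open>g\<close> be the Fourier transform of \<open>f\<close>, let \<open>p (a, b) = g a * g b\<close>, and for \<open>v \<noteq> 0\<close> let \<open>R v\<close> be the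
  reflection of \<open>\<real>\<^sup>d \<times> \<real>\<^sup>d\<close> along \<open>(v, -v)\<close>. It is the elastic collision of the velocities \<open>a, b\<close>
  in direction \<open>v\<close>, and it preserves \<open>|z|\<^sup>2\<close>. Plancherel's theorem in space and time turns the
  second term of \<open>Q t\<close> into an average over the directions \<open>v\<close> of the integral over \<open>z\<close> of
  \<open>exp (- 2 t |z|\<^sup>2) * p z * cnj (p (R v z))\<close>; the exponent \<open>2 - d\<close> is the one for which the directions
  are uniformly distributed. The first term is the same average with \<open>|p z|\<^sup>2\<close> in place of
  \<open>p z * cnj (p (R v z))\<close>. Hence \<open>Q t\<close> is a positive multiple of the average of the integral of
  \<open>exp (- 2 t |z|\<^sup>2) * |p z - p (R v z)|\<^sup>2\<close>, a Laplace transform of a nonnegative density.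
\<close>

section \<open>Lebesgue measure: affine maps, isometries, continuity of translations\<close>

text \<open>Formally, the space-time transform of \<open>|u|^2\<close> at
  \<open>(\<tau>, \<zeta>)\<close> integrates \<open>G \<xi> * cnj (G (\<xi> - \<zeta>))\<close>,
  with \<open>G\<close> the heat-damped \<open>g\<close>, over a hyperplane orthogonal to
  \<open>\<zeta>\<close>. Squaring and integrating over \<open>\<tau>\<close> leaves pairs of points
  of one hyperplane. Regroup the four values of \<open>G\<close> as a product at \<open>z\<close>
  times a conjugated product at \<open>z - \<rho> *\<^sub>R e\<close>, where
  \<open>e = (v, - v)\<close>: lying in one hyperplane then means that the second argument is
  \<open>R v z\<close>. The obstacle is the surface measure, since an element of L2 has no
  restriction to a hyperplane. A Gaussian factor in time smears the hyperplane out. When it is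
  removed, the time side converges monotonically and the other side converges because translations
  are continuous in L2. Monotone convergence presupposes no finiteness, so finiteness of the second
  term of \<open>Q t\<close> comes out as a result. Directions run over the unit ball instead of the
  sphere: \<open>R v\<close> depends only on the line through \<open>v\<close>, and a ball needs
  nothing beyond rescaling. The sphere's area is \<open>d\<close> times the ball's volume, which
  makes the \<open>|p|^2\<close> parts cancel.\<close>

lemma nn_integral_lborel_translation:
  fixes f :: "'a::euclidean_space \<Rightarrow> ennreal"
  assumes [measurable]: "f \<in> borel_measurable borel"
  shows "(\<integral>\<^sup>+x. f (c + x) \<partial>lborel) = (\<integral>\<^sup>+x. f x \<partial>lborel)"
  by (subst (2) lborel_distr_plus[of c, symmetric]) (simp add: nn_integral_distr)

lemma integral_lborel_translation:
  fixes f :: "'a::euclidean_space \<Rightarrow> 'b::{banach, second_countable_topology}"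
  assumes [measurable]: "f \<in> borel_measurable borel"
  shows "(LINT x|lborel. f (c + x)) = (LINT x|lborel. f x)"
  by (subst (2) lborel_distr_plus[of c, symmetric]) (simp add: integral_distr)

lemma integrable_lborel_translation:
  fixes f :: "'a::euclidean_space \<Rightarrow> 'b::{banach, second_countable_topology}"
  assumes "integrable lborel f"
  shows "integrable lborel (\<lambda>x. f (c + x))"
proof -
  have [measurable]: "f \<in> borel_measurable borel" using assms by auto
  show ?thesis
    using assms by (subst (asm) lborel_distr_plus[of c, symmetric]) (simp add: integrable_distr_eq)
qed

lemma nn_integral_lborel_scale:
  fixes f :: "'a::euclidean_space \<Rightarrow> ennreal"
  assumes [measurable]: "f \<in> borel_measurable borel" and "c \<noteq> 0"
  shows "(\<integral>\<^sup>+x. f x \<partial>lborel) = ennreal (\<bar>c\<bar> ^ DIM('a)) * (\<integral>\<^sup>+x. f (t + c *\<^sub>R x) \<partial>lborel)"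
  by (subst lborel_affine[OF \<open>c \<noteq> 0\<close>, of t])
    (simp add: nn_integral_density nn_integral_distr nn_integral_cmult)

lemma integral_lborel_scale:
  fixes f :: "'a::euclidean_space \<Rightarrow> 'b::{banach, second_countable_topology}"
  assumes [measurable]: "f \<in> borel_measurable borel" and "c \<noteq> 0"
  shows "(LINT x|lborel. f x) = (\<bar>c\<bar> ^ DIM('a)) *\<^sub>R (LINT x|lborel. f (t + c *\<^sub>R x))"
  by (subst lborel_affine[OF \<open>c \<noteq> 0\<close>, of t])
    (simp add: integral_density integral_distr)

lemma nn_integral_lborel_reflect:
  fixes f :: "'a::euclidean_space \<Rightarrow> ennreal"
  assumes "f \<in> borel_measurable borel"
  shows "(\<integral>\<^sup>+x. f (c - x) \<partial>lborel) = (\<integral>\<^sup>+x. f x \<partial>lborel)"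
  using nn_integral_lborel_scale[OF assms, of "-1" c] by simp

lemma integral_lborel_reflect:
  fixes f :: "'a::euclidean_space \<Rightarrow> 'b::{banach, second_countable_topology}"
  assumes "f \<in> borel_measurable borel"
  shows "(LINT x|lborel. f (c - x)) = (LINT x|lborel. f x)"
  using integral_lborel_scale[OF assms, of "-1" c] by simp

text \<open>Both sides are multiplied by the volume of the unit ball, whose indicator is invariant
  under \<open>T\<close>; after Fubini the left hand side is a translate of the right hand side.\<close>
lemma lborel_distr_isometric_involution:
  fixes T :: "'a::euclidean_space \<Rightarrow> 'a"
  assumes lin: "linear T" and inv: "\<And>x. T (T x) = x" and nrm: "\<And>x. norm (T x) = norm x"
  shows "distr lborel borel T = lborel"
proof (rule measure_eqI)
  have [measurable]: "T \<in> borel_measurable borel"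
    by (intro borel_measurable_continuous_onI linear_continuous_on linear_linear[THEN iffD2] lin)
  show "sets (distr lborel borel T) = sets lborel" by simp
  fix A assume "A \<in> sets (distr lborel borel T)"
  then have A[measurable]: "A \<in> sets borel" by simp
  define f :: "'a \<Rightarrow> ennreal" where "f = indicator A"
  define k :: "'a \<Rightarrow> ennreal" where "k = indicator (ball 0 1)"
  have [measurable]: "f \<in> borel_measurable borel" "k \<in> borel_measurable borel"
    unfolding f_def k_def by (auto intro: borel_measurable_indicator)
  have k: "k (y - T x) = k (T y - x)" for x y
    using nrm[of "T y - x"] by (simp add: k_def indicator_def linear_diff[OF lin] inv)
  define V where "V = emeasure lborel (ball (0::'a) 1)"
  have V: "V = (\<integral>\<^sup>+y. k y \<partial>lborel)" by (simp add: V_def k_def)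
  have V': "V \<noteq> 0" "V \<noteq> \<infinity>"
  proof -
    have "V = ennreal (unit_ball_vol (real DIM('a)))"
      using emeasure_ball[of 1 "0::'a"] by (simp add: V_def)
    then show "V \<noteq> 0" "V \<noteq> \<infinity>"
      using unit_ball_vol_pos[of "real DIM('a)"] by (auto simp: ennreal_eq_0_iff not_le)
  qed
  have tr: "(\<integral>\<^sup>+y. g (y - c) \<partial>lborel) = (\<integral>\<^sup>+y. g y \<partial>lborel)"
    if "g \<in> borel_measurable borel" for g :: "'a \<Rightarrow> ennreal" and c
    using nn_integral_lborel_translation[OF that, of "- c"] by simp
  have "(\<integral>\<^sup>+x. f (T x) \<partial>lborel) * V = (\<integral>\<^sup>+x. \<integral>\<^sup>+y. f (T x) * k y \<partial>lborel \<partial>lborel)"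
    by (simp add: V nn_integral_multc nn_integral_cmult)
  also have "\<dots> = (\<integral>\<^sup>+x. \<integral>\<^sup>+y. f (T x) * k (- T x + y) \<partial>lborel \<partial>lborel)"
    by (simp add: nn_integral_cmult tr)
  also have "\<dots> = (\<integral>\<^sup>+y. \<integral>\<^sup>+x. f (T x) * k (- T x + y) \<partial>lborel \<partial>lborel)"
    by (rule lborel_pair.Fubini') measurable
  also have "\<dots> = (\<integral>\<^sup>+y. \<integral>\<^sup>+x. f (T x) * k (T y - x) \<partial>lborel \<partial>lborel)"
    by (simp flip: k)
  also have "\<dots> = (\<integral>\<^sup>+y. \<integral>\<^sup>+x. f (T (T y - x)) * k (T y - (T y - x)) \<partial>lborel \<partial>lborel)"
    by (intro nn_integral_cong nn_integral_lborel_reflect[symmetric]) measurable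
  also have "\<dots> = (\<integral>\<^sup>+y. \<integral>\<^sup>+x. f (- T x + y) * k x \<partial>lborel \<partial>lborel)"
    by (simp add: linear_diff[OF lin] inv)
  also have "\<dots> = (\<integral>\<^sup>+x. \<integral>\<^sup>+y. f (- T x + y) * k x \<partial>lborel \<partial>lborel)"
    by (rule lborel_pair.Fubini'[symmetric]) measurable
  also have "\<dots> = (\<integral>\<^sup>+x. f x \<partial>lborel) * V"
    by (simp add: V nn_integral_multc nn_integral_cmult tr)
  finally have "(\<integral>\<^sup>+x. f (T x) \<partial>lborel) = (\<integral>\<^sup>+x. f x \<partial>lborel)"
    using V' by (auto simp: mult.commute[of _ V] ennreal_mult_cancel_left)
  moreover have "(\<integral>\<^sup>+x. f (T x) \<partial>lborel) = (\<integral>\<^sup>+x. f x \<partial>distr lborel borel T)"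
    by (simp add: nn_integral_distr)
  ultimately show "emeasure (distr lborel borel T) A = emeasure lborel A"
    by (simp add: f_def)
qed

text \<open>Transfers continuity of translations from L1 to L2: \<open>L2_modulus_tendsto\<close>
  applies it to \<open>k x * cmod (k x)\<close>, which is integrable when \<open>k\<close> is
  square-integrable. After squaring, the difference of the two sides is a sum of three nonnegative
  terms, two of which rest on \<open>\<bar>r\<bar> \<le> p * q\<close>.\<close>

lemma cmod_diff_square_le:
  fixes a b :: complex
  shows "(cmod (a - b))\<^sup>2 \<le> 2 * cmod (a * cmod a - b * cmod b)"
proof -
  define p q r where "p = cmod a" "q = cmod b" "r = Re (a * cnj b)"
  have r: "\<bar>r\<bar> \<le> p * q"
    using abs_Re_le_cmod[of "a * cnj b"] by (simp add: p_q_r_def norm_mult)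
  have sq: "(cmod (x - y))\<^sup>2 = (cmod x)\<^sup>2 + (cmod y)\<^sup>2 - 2 * Re (x * cnj y)" for x y
    unfolding cmod_power2 by (simp add: power2_eq_square algebra_simps)
  have e1: "(cmod (a - b))\<^sup>2 = p\<^sup>2 + q\<^sup>2 - 2 * r"
    by (simp add: sq p_q_r_def)
  have "Re (a * cmod a * cnj (b * cmod b)) = p * q * r"
    by (simp add: p_q_r_def algebra_simps)
  then have e2: "(cmod (a * cmod a - b * cmod b))\<^sup>2 = p^4 + q^4 - 2 * (p * q * r)"
    by (simp add: sq p_q_r_def norm_mult power_mult_distrib flip: power_add)
  have "0 \<le> (p * q - r) * (p * q + r)"
    using r by (intro mult_nonneg_nonneg) auto
  moreover have "0 \<le> (p - q)\<^sup>2 * (r + p * q)"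
    using r by (intro mult_nonneg_nonneg) auto
  moreover have "0 \<le> (p - q)\<^sup>2 * (3 * p\<^sup>2 + 3 * q\<^sup>2 + 2 * p * q)"
    by (simp add: p_q_r_def)
  moreover have "4 * (p^4 + q^4 - 2 * (p * q * r)) - (p\<^sup>2 + q\<^sup>2 - 2 * r)\<^sup>2 =
     4 * ((p * q - r) * (p * q + r)) + 4 * ((p - q)\<^sup>2 * (r + p * q))
     + (p - q)\<^sup>2 * (3 * p\<^sup>2 + 3 * q\<^sup>2 + 2 * p * q)"
    by algebra
  ultimately have "((cmod (a - b))\<^sup>2)\<^sup>2 \<le> (2 * cmod (a * cmod a - b * cmod b))\<^sup>2"
    unfolding power_mult_distrib e1 e2 by simp
  then show ?thesis by (rule power2_le_imp_le) simp
qed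

section \<open>Continuity of translations in L1\<close>

definition L1_modulus :: "('a::euclidean_space \<Rightarrow> complex) \<Rightarrow> 'a \<Rightarrow> real" where
  "L1_modulus f z = (LINT x|lborel. cmod (f (z + x) - f x))"

lemma L1_modulus_perturb:
  assumes f: "integrable lborel f" and g: "integrable lborel g"
  shows "L1_modulus f z \<le> L1_modulus g z + 2 * (LINT x|lborel. cmod (f x - g x))"
proof -
  note f' = integrable_lborel_translation[OF f, of z] and g' = integrable_lborel_translation[OF g, of z]
  have [measurable]: "f \<in> borel_measurable borel" "g \<in> borel_measurable borel" using f g by auto
  have "L1_modulus f z \<le> (LINT x|lborel. cmod (f (z + x) - g (z + x)) + cmod (g (z + x) - g x)
      + cmod (f x - g x))"
    unfolding L1_modulus_def
  proof (rule integral_mono)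
    show "cmod (f (z + x) - f x) \<le> cmod (f (z + x) - g (z + x)) + cmod (g (z + x) - g x) + cmod (f x - g x)" for x
      using norm_triangle_ineq[of "f (z + x) - g (z + x) + (g (z + x) - g x)" "g x - f x"]
        norm_triangle_ineq[of "f (z + x) - g (z + x)" "g (z + x) - g x"]
      by (simp add: norm_minus_commute)
  qed (use f g f' g' in auto)
  also have "\<dots> = (LINT x|lborel. cmod (f (z + x) - g (z + x))) + L1_modulus g z
      + (LINT x|lborel. cmod (f x - g x))"
    unfolding L1_modulus_def using f g f' g' by simp
  also have "(LINT x|lborel. cmod (f (z + x) - g (z + x))) = (LINT x|lborel. cmod (f x - g x))"
    by (rule integral_lborel_translation) measurable
  finally show ?thesis by simp
qed

lemma L1_modulus_nonneg: "L1_modulus f z \<ge> 0"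
  by (simp add: L1_modulus_def)

text \<open>The error made by replacing \<open>f\<close> with \<open>g\<close> is uniform in the
  translation, so the functions with vanishing modulus form an L1-closed set. The induction in
  \<open>L1_modulus_tendsto\<close> uses this for measurable sets and for limits.\<close>

lemma L1_modulus_tendsto_closure:
  assumes f: "integrable lborel f"
    and "\<And>e. e > 0 \<Longrightarrow> \<exists>g. integrable lborel g \<and> (L1_modulus g \<longlongrightarrow> 0) (at 0)
            \<and> (LINT x|lborel. cmod (f x - g x)) < e"
  shows "(L1_modulus f \<longlongrightarrow> 0) (at 0)"
proof (rule tendstoI)
  fix e :: real assume "e > 0"
  then obtain g where g: "integrable lborel g" "(L1_modulus g \<longlongrightarrow> 0) (at 0)"
     "(LINT x|lborel. cmod (f x - g x)) < e / 4"
    using assms(2)[of "e / 4"] by auto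
  from tendstoD[OF g(2), of "e / 2"] \<open>e > 0\<close>
  have "\<forall>\<^sub>F z in at 0. dist (L1_modulus g z) 0 < e / 2" by simp
  then show "\<forall>\<^sub>F z in at 0. dist (L1_modulus f z) 0 < e"
  proof eventually_elim
    case (elim z)
    then show ?case
      using L1_modulus_perturb[OF f g(1), of z] g(3) L1_modulus_nonneg[of f z] by simp
  qed
qed

lemma L1_modulus_add:
  assumes f: "integrable lborel f" and g: "integrable lborel g"
  shows "L1_modulus (\<lambda>x. f x + g x) z \<le> L1_modulus f z + L1_modulus g z"
proof -
  note f' = integrable_lborel_translation[OF f, of z] and g' = integrable_lborel_translation[OF g, of z]
  have "L1_modulus (\<lambda>x. f x + g x) z \<le> (LINT x|lborel. cmod (f (z + x) - f x) + cmod (g (z + x) - g x))"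
    unfolding L1_modulus_def
  proof (rule integral_mono)
    show "cmod (f (z + x) + g (z + x) - (f x + g x)) \<le> cmod (f (z + x) - f x) + cmod (g (z + x) - g x)" for x
      using norm_triangle_ineq[of "f (z + x) - f x" "g (z + x) - g x"] by (simp add: algebra_simps)
  qed (use f g f' g' in auto)
  also have "\<dots> = L1_modulus f z + L1_modulus g z"
    unfolding L1_modulus_def using f g f' g' by simp
  finally show ?thesis .
qed

text \<open>At a boundary point of \<open>U\<close> the translated indicators need not converge, and
  the boundary may have positive measure. The absolute difference is therefore written as the signed
  difference, whose integral vanishes by translation invariance, plus twice the positive part
  \<open>?P\<close>. The latter lives on \<open>U\<close>, is dominated by its indicator, and tends
  to 0 at each point of \<open>U\<close> because \<open>U\<close> is open.\<close>

lemma L1_modulus_open: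
  fixes U :: "'a::euclidean_space set"
  assumes U: "open U" "emeasure lborel U < \<infinity>"
  shows "(L1_modulus (\<lambda>x. indicator U x *\<^sub>R c) \<longlongrightarrow> 0) (at 0)"
proof -
  have [measurable]: "U \<in> sets borel" using U by auto
  have iU: "integrable lborel (indicator U :: 'a \<Rightarrow> real)"
    using U by (intro integrable_real_indicator) auto
  note iU' = integrable_lborel_translation[OF iU]
  let ?P = "\<lambda>z x. max 0 (indicator U x - indicator U (z + x)) :: real"
  have iP: "integrable lborel (?P z)" for z
    using iU iU' by auto
  have "L1_modulus (\<lambda>x. indicator U x *\<^sub>R c) z = cmod c * (2 * (LINT x|lborel. ?P z x))" for z
  proof -
  have "L1_modulus (\<lambda>x. indicator U x *\<^sub>R c) z = (LINT x|lborel. cmod c * \<bar>indicator U (z + x) - indicator U x\<bar>)"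
    unfolding L1_modulus_def
    by (intro Bochner_Integration.integral_cong) (auto simp: indicator_def)
  also have "(LINT x|lborel. cmod c * \<bar>indicator U (z + x) - indicator U x\<bar>) = (LINT x|lborel. cmod c * (indicator U (z + x) - indicator U x + 2 * ?P z x))"
    by (intro Bochner_Integration.integral_cong) (auto simp: indicator_def)
  also have "\<dots> = cmod c * ((LINT x|lborel. indicator U (z + x)) - (LINT x|lborel. indicator U x)
      + 2 * (LINT x|lborel. ?P z x))"
    using iU iU' iP by simp
  also have "(LINT x|lborel. indicator U (z + x)) = (LINT x|lborel. indicator U x :: real)"
    by (rule integral_lborel_translation) measurable
  finally show ?thesis by simp
  qed
  then have eq: "L1_modulus (\<lambda>x. indicator U x *\<^sub>R c) = (\<lambda>z. cmod c * (2 * (LINT x|lborel. ?P z x)))"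
    by (simp add: fun_eq_iff)
  have "((\<lambda>z. LINT x|lborel. ?P z x) \<longlongrightarrow> (LINT x::'a|lborel. 0::real)) (at 0)"
  proof (rule tendsto_at_iff_sequentially[THEN iffD2, rule_format], unfold o_def)
    fix X :: "nat \<Rightarrow> 'a" assume X: "\<And>i. X i \<in> UNIV - {0}" "X \<longlonglongrightarrow> 0"
    show "(\<lambda>i. LINT x|lborel. ?P (X i) x) \<longlonglongrightarrow> (LINT x::'a|lborel. 0)"
    proof (rule integral_dominated_convergence[where w = "indicator U"])
      show "AE x in lborel. (\<lambda>i. ?P (X i) x) \<longlonglongrightarrow> 0"
      proof (rule AE_I2)
        fix x :: 'a
        show "(\<lambda>i. ?P (X i) x) \<longlonglongrightarrow> 0"
        proof (cases "x \<in> U")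
          case True
          have "(\<lambda>i. X i + x) \<longlonglongrightarrow> x" using tendsto_add[OF X(2) tendsto_const[of x]] by simp
          then have "\<forall>\<^sub>F i in sequentially. X i + x \<in> U"
            using True U topological_tendstoD by blast
          then have "\<forall>\<^sub>F i in sequentially. ?P (X i) x = 0"
            by eventually_elim (use True in auto)
          then show ?thesis by (rule tendsto_eventually)
        qed (auto simp: indicator_def)
      qed
    qed (auto simp: iU indicator_def)
  qed
  then show ?thesis
    unfolding eq by (auto intro!: tendsto_mult_right_zero)
qed

text \<open>Outer regularity reduces the indicator of a measurable set to that of an open superset
  of nearly the same measure; sums follow from the triangle inequality and limits from
  L1-closedness.\<close>

lemma L1_modulus_tendsto:
  fixes f :: "'a::euclidean_space \<Rightarrow> complex"
  assumes "integrable lborel f"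
  shows "(L1_modulus f \<longlongrightarrow> 0) (at 0)"
  using assms
proof (induction rule: integrable_induct)
  case (base A c)
  then have [measurable]: "A \<in> sets borel" and iA: "integrable lborel (indicator A :: 'a \<Rightarrow> real)" by auto
  show ?case
  proof (rule L1_modulus_tendsto_closure)
    show "integrable lborel (\<lambda>x. indicator A x *\<^sub>R c)" using iA by simp
    fix e :: real assume "e > 0"
    \<comment> \<open>The summand 1 allows \<open>c = 0\<close> and makes the final error strictly
      smaller than \<open>e\<close>.\<close>
    then have e: "e / (1 + cmod c) > 0" by (simp add: add_pos_nonneg)
    obtain U where U: "open U" "A \<subseteq> U" "emeasure lborel (U - A) < e / (1 + cmod c)"
      using outer_regular_lborel[OF _ e, of A] by auto
    have [measurable]: "U \<in> sets borel" using U by auto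
    have UA: "emeasure lborel (U - A) < \<infinity>" using U(3) by (simp add: order_less_trans[OF _ ennreal_less_top])
    have "emeasure lborel U = emeasure lborel (U - A) + emeasure lborel A"
      using U by (subst plus_emeasure) (auto simp: Un_absorb2)
    then have fin: "emeasure lborel U < \<infinity>" using base UA by auto
    show "\<exists>g. integrable lborel g \<and> (L1_modulus g \<longlongrightarrow> 0) (at 0) \<and> (LINT x|lborel. cmod (indicator A x *\<^sub>R c - g x)) < e"
    proof (intro exI conjI)
      show "integrable lborel (\<lambda>x. indicator U x *\<^sub>R c)"
        using fin by (intro integrable_scaleR_left integrable_real_indicator impI) auto
      show "(L1_modulus (\<lambda>x. indicator U x *\<^sub>R c) \<longlongrightarrow> 0) (at 0)"
        using U fin by (intro L1_modulus_open) auto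
      have "(LINT x|lborel. cmod (indicator A x *\<^sub>R c - indicator U x *\<^sub>R c))
         = (LINT x|lborel. cmod c * indicator (U - A) x)"
        by (intro Bochner_Integration.integral_cong) (use U in \<open>auto simp: indicator_def\<close>)
      also have "\<dots> = cmod c * measure lborel (U - A)" by simp
      also have "\<dots> \<le> cmod c * (e / (1 + cmod c))"
      proof (rule mult_left_mono)
        have "ennreal (measure lborel (U - A)) < ennreal (e / (1 + cmod c))"
          using U(3) UA by (subst emeasure_eq_ennreal_measure[symmetric]) auto
        then show "measure lborel (U - A) \<le> e / (1 + cmod c)"
          using e by (simp add: ennreal_less_iff)
      qed simp
      also have "\<dots> < e" using \<open>e > 0\<close> by (simp add: field_simps add_pos_nonneg)
      finally show "(LINT x|lborel. cmod (indicator A x *\<^sub>R c - indicator U x *\<^sub>R c)) < e" .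
    qed
  qed
next
  case (add f g)
  show ?case
  proof (rule tendsto_sandwich[where f = "\<lambda>_. 0"])
    show "((\<lambda>z. L1_modulus f z + L1_modulus g z) \<longlongrightarrow> 0) (at 0)"
      using tendsto_add[OF add(3,4)] by simp
  qed (auto intro!: always_eventually L1_modulus_nonneg L1_modulus_add add)
next
  case (lim f s)
  show ?case
  proof (rule L1_modulus_tendsto_closure)
    fix e :: real assume "e > 0"
    have [measurable]: "f \<in> borel_measurable borel" "\<And>i. s i \<in> borel_measurable borel"
      using lim(1,4) by auto
    have "(\<lambda>i. LINT x|lborel. cmod (f x - s i x)) \<longlonglongrightarrow> (LINT x::'a|lborel. 0::real)"
    proof (rule integral_dominated_convergence[where w = "\<lambda>x. 3 * cmod (f x)"])
      show "AE x in lborel. (\<lambda>i. cmod (f x - s i x)) \<longlonglongrightarrow> 0"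
      proof (rule AE_I2)
        fix x :: 'a
        have "(\<lambda>i. cmod (f x - s i x)) \<longlonglongrightarrow> cmod (f x - f x)"
          by (intro tendsto_intros) (use lim in auto)
        then show "(\<lambda>i. cmod (f x - s i x)) \<longlonglongrightarrow> 0" by simp
      qed
      show "AE x in lborel. norm (cmod (f x - s i x)) \<le> 3 * cmod (f x)" for i
      proof (rule AE_I2)
        fix x :: 'a
        have "cmod (s i x) \<le> 2 * cmod (f x)" using lim by auto
        then show "norm (cmod (f x - s i x)) \<le> 3 * cmod (f x)"
          using norm_triangle_ineq4[of "f x" "s i x"] by simp
      qed
    qed (use lim in auto)
    then have "\<forall>\<^sub>F i in sequentially. (LINT x|lborel. cmod (f x - s i x)) < e"
      using \<open>e > 0\<close> order_tendstoD(2) by force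
    then obtain i where "(LINT x|lborel. cmod (f x - s i x)) < e"
      by (auto simp: eventually_sequentially)
    then show "\<exists>g. integrable lborel g \<and> (L1_modulus g \<longlongrightarrow> 0) (at 0) \<and> (LINT x|lborel. cmod (f x - g x)) < e"
      using lim by blast
  qed (use lim in auto)
qed

section \<open>Square-integrable functions and Gaussian kernels\<close>

text \<open>Borel measurability, in contrast to the Lebesgue measurability in \<open>is_L2\<close>,
  is stable under composition with Borel maps such as projections and reflections.
  \<open>is_L2_imp_borel_version\<close> passes from one notion to the other.\<close>

definition sq_integrable :: "('a::euclidean_space \<Rightarrow> complex) \<Rightarrow> bool" where
  "sq_integrable h \<longleftrightarrow> h \<in> borel_measurable borel \<and> integrable lborel (\<lambda>x. (cmod (h x))\<^sup>2)"

lemma sq_integrable_measurable [measurable_dest]: "sq_integrable h \<Longrightarrow> h \<in> borel_measurable borel"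
  by (simp add: sq_integrable_def)

lemma sq_integrableD: "sq_integrable h \<Longrightarrow> integrable lborel (\<lambda>x. (cmod (h x))\<^sup>2)"
  by (simp add: sq_integrable_def)

lemma borel_measurable_cnj [measurable]: "cnj \<in> borel_measurable borel"
  by (intro borel_measurable_continuous_onI continuous_intros)

lemma mult_le_half_sum_squares: "(a::real) * b \<le> (a\<^sup>2 + b\<^sup>2) / 2"
  using sum_squares_bound[of a b] by simp

lemma sq_integrable_mult:
  assumes h: "sq_integrable h" and k: "sq_integrable k"
  shows "integrable lborel (\<lambda>x. h x * k x)"
proof (rule Bochner_Integration.integrable_bound)
  show "integrable lborel (\<lambda>x. ((cmod (h x))\<^sup>2 + (cmod (k x))\<^sup>2) / 2)"
    using h k by (simp add: sq_integrable_def)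
  show "AE x in lborel. norm (h x * k x) \<le> norm (((cmod (h x))\<^sup>2 + (cmod (k x))\<^sup>2) / 2)"
    using mult_le_half_sum_squares[of "cmod (h x)" "cmod (k x)" for x] by (auto simp: norm_mult)
qed (use h k in measurable)

lemma sq_integrable_cnj: "sq_integrable h \<Longrightarrow> sq_integrable (\<lambda>x. cnj (h x))"
  unfolding sq_integrable_def by auto

lemma sq_integrable_translation: "sq_integrable h \<Longrightarrow> sq_integrable (\<lambda>x. h (c + x))"
  unfolding sq_integrable_def
  using integrable_lborel_translation[of "\<lambda>x. (cmod (h x))\<^sup>2"] by auto

lemma sq_integrable_bound:
  assumes "sq_integrable h" "k \<in> borel_measurable borel" "\<And>x. cmod (k x) \<le> cmod (h x)"
  shows "sq_integrable k"
  unfolding sq_integrable_def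
proof
  show "integrable lborel (\<lambda>x. (cmod (k x))\<^sup>2)"
    by (rule Bochner_Integration.integrable_bound[OF sq_integrableD[OF assms(1)]])
      (use assms in \<open>auto intro!: power_mono\<close>)
qed fact

lemma sq_integrable_diff:
  assumes h: "sq_integrable h" and k: "sq_integrable k"
  shows "sq_integrable (\<lambda>x. h x - k x)"
  unfolding sq_integrable_def
proof
  show "integrable lborel (\<lambda>x. (cmod (h x - k x))\<^sup>2)"
  proof (rule Bochner_Integration.integrable_bound)
    show "integrable lborel (\<lambda>x. 2 * (cmod (h x))\<^sup>2 + 2 * (cmod (k x))\<^sup>2)"
      using h k by (simp add: sq_integrable_def)
    show "AE x in lborel. norm ((cmod (h x - k x))\<^sup>2) \<le> norm (2 * (cmod (h x))\<^sup>2 + 2 * (cmod (k x))\<^sup>2)"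
    proof (rule AE_I2)
      fix x
      have "(cmod (h x - k x))\<^sup>2 \<le> (cmod (h x) + cmod (k x))\<^sup>2"
        by (intro power_mono norm_triangle_ineq4) auto
      also have "\<dots> \<le> 2 * (cmod (h x))\<^sup>2 + 2 * (cmod (k x))\<^sup>2"
        using sum_squares_bound[of "cmod (h x)" "cmod (k x)"] by (simp add: power2_sum)
      finally show "norm ((cmod (h x - k x))\<^sup>2) \<le> norm (2 * (cmod (h x))\<^sup>2 + 2 * (cmod (k x))\<^sup>2)"
        by simp
    qed
  qed (use h k in measurable)
qed (use h k in measurable)

section \<open>Correlations of square-integrable functions\<close>

definition correlation :: "('a::euclidean_space \<Rightarrow> complex) \<Rightarrow> ('a \<Rightarrow> complex) \<Rightarrow> 'a \<Rightarrow> complex" where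
  "correlation h k z = (LINT x|lborel. h x * cnj (k (z + x)))"

lemma correlation_measurable [measurable]:
  assumes [measurable]: "h \<in> borel_measurable borel" "k \<in> borel_measurable borel"
  shows "correlation h k \<in> borel_measurable borel"
  unfolding correlation_def by measurable

text \<open>The inequality between arithmetic and geometric mean plus translation invariance give a
  bound independent of \<open>z\<close>, which is what \<open>gauss_approximate_identity\<close>
  asks for.\<close>

lemma correlation_bound:
  assumes h: "sq_integrable h" and k: "sq_integrable k"
  shows "cmod (correlation h k z) \<le> ((LINT x|lborel. (cmod (h x))\<^sup>2) + (LINT x|lborel. (cmod (k x))\<^sup>2)) / 2"
proof -
  note k' = sq_integrable_translation[OF k, of z]
  have [measurable]: "k \<in> borel_measurable borel" using k by measurable
  have "cmod (correlation h k z) \<le> (LINT x|lborel. cmod (h x * cnj (k (z + x))))"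
    unfolding correlation_def by (rule integral_norm_bound)
  also have "\<dots> \<le> (LINT x|lborel. ((cmod (h x))\<^sup>2 + (cmod (k (z + x)))\<^sup>2) / 2)"
    by (intro integral_mono integrable_norm sq_integrable_mult sq_integrable_cnj h k')
      (use sq_integrableD[OF h] sq_integrableD[OF k'] mult_le_half_sum_squares[of "cmod (h x)" "cmod (k (z + x))" for x]
        in \<open>auto simp: norm_mult\<close>)
  also have "\<dots> = ((LINT x|lborel. (cmod (h x))\<^sup>2) + (LINT x|lborel. (cmod (k (z + x)))\<^sup>2)) / 2"
    using sq_integrableD[OF h] sq_integrableD[OF k'] by simp
  also have "(LINT x|lborel. (cmod (k (z + x)))\<^sup>2) = (LINT x|lborel. (cmod (k x))\<^sup>2)"
    by (rule integral_lborel_translation) measurable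
  finally show ?thesis .
qed

lemma L2_modulus_tendsto:
  fixes k :: "'a::euclidean_space \<Rightarrow> complex"
  assumes k: "sq_integrable k"
  shows "((\<lambda>z. LINT x|lborel. (cmod (k (z + x) - k x))\<^sup>2) \<longlongrightarrow> 0) (at 0)"
proof (rule tendsto_sandwich[where f = "\<lambda>_. 0"])
  let ?q = "\<lambda>x. k x * cmod (k x)"
  have [measurable]: "k \<in> borel_measurable borel" using k by measurable
  have iq: "integrable lborel ?q"
    by (rule Bochner_Integration.integrable_bound[OF sq_integrableD[OF k]])
      (auto simp: norm_mult power2_eq_square)
  show "((\<lambda>z. 2 * L1_modulus ?q z) \<longlongrightarrow> 0) (at 0)"
    using tendsto_mult_right_zero[OF L1_modulus_tendsto[OF iq]] .
  show "\<forall>\<^sub>F z in at 0. (LINT x|lborel. (cmod (k (z + x) - k x))\<^sup>2) \<le> 2 * L1_modulus ?q z"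
  proof (rule always_eventually, rule allI)
    fix z
    have "(LINT x|lborel. (cmod (k (z + x) - k x))\<^sup>2) \<le> (LINT x|lborel. 2 * cmod (?q (z + x) - ?q x))"
    proof (rule integral_mono)
      show "integrable lborel (\<lambda>x. (cmod (k (z + x) - k x))\<^sup>2)"
        using sq_integrable_diff[OF sq_integrable_translation[OF k, of z] k] by (rule sq_integrableD)
      show "integrable lborel (\<lambda>x. 2 * cmod (?q (z + x) - ?q x))"
        using iq integrable_lborel_translation[OF iq, of z] by auto
    qed (rule cmod_diff_square_le)
    then show "(LINT x|lborel. (cmod (k (z + x) - k x))\<^sup>2) \<le> 2 * L1_modulus ?q z"
      by (simp add: L1_modulus_def)
  qed
qed (auto)

lemma correlation_tendsto:
  assumes h: "sq_integrable h" and k: "sq_integrable k"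
  shows "(correlation h k \<longlongrightarrow> correlation h k 0) (at 0)"
proof (rule tendstoI)
  fix e :: real assume "e > 0"
  have [measurable]: "h \<in> borel_measurable borel" "k \<in> borel_measurable borel" using h k by measurable
  define H where "H = (LINT x|lborel. (cmod (h x))\<^sup>2)"
  have H: "H \<ge> 0" by (simp add: H_def)
  \<comment> \<open>Weight in Young's inequality
    \<open>a * b \<le> d * a\<^sup>2 / 2 + b\<^sup>2 / (2 * d)\<close>: the first part becomes at
    most \<open>e / 2\<close>, and the second is below \<open>e / 2\<close> once
    \<open>D z < d * e\<close>. The summand 1 covers \<open>H = 0\<close>.\<close>
  define d where "d = e / (H + 1)"
  have d: "d > 0" using H \<open>e > 0\<close> by (simp add: d_def)
  define D where "D z = (LINT x|lborel. (cmod (k (z + x) - k x))\<^sup>2)" for z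
  have "\<forall>\<^sub>F z in at 0. D z < d * e"
    using order_tendstoD(2)[OF L2_modulus_tendsto[OF k], of "d * e"] d \<open>e > 0\<close> by (simp add: D_def)
  then show "\<forall>\<^sub>F z in at 0. dist (correlation h k z) (correlation h k 0) < e"
  proof eventually_elim
    case (elim z)
    note k' = sq_integrable_translation[OF k, of z] and dk = sq_integrable_diff[OF sq_integrable_translation[OF k, of z] k]
    have "correlation h k z - correlation h k 0 = (LINT x|lborel. h x * cnj (k (z + x) - k x))"
      unfolding correlation_def
      using sq_integrable_mult[OF h sq_integrable_cnj[OF k']] sq_integrable_mult[OF h sq_integrable_cnj[OF k]]
      by (simp add: algebra_simps)
    then have "dist (correlation h k z) (correlation h k 0) \<le> (LINT x|lborel. cmod (h x * cnj (k (z + x) - k x)))"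
      by (simp add: dist_norm)
    also have "\<dots> \<le> (LINT x|lborel. d / 2 * (cmod (h x))\<^sup>2 + (cmod (k (z + x) - k x))\<^sup>2 / (2 * d))"
    proof (rule integral_mono)
      fix x
      have "sqrt d * cmod (h x) * (cmod (k (z + x) - k x) / sqrt d) \<le>
         ((sqrt d * cmod (h x))\<^sup>2 + (cmod (k (z + x) - k x) / sqrt d)\<^sup>2) / 2"
        by (rule mult_le_half_sum_squares)
      then show "cmod (h x * cnj (k (z + x) - k x)) \<le> d / 2 * (cmod (h x))\<^sup>2 + (cmod (k (z + x) - k x))\<^sup>2 / (2 * d)"
        using d by (simp add: norm_mult power_mult_distrib power_divide field_simps flip: complex_cnj_diff)
    next
      show "integrable lborel (\<lambda>x. cmod (h x * cnj (k (z + x) - k x)))"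
        by (rule integrable_norm, rule sq_integrable_mult[OF h sq_integrable_cnj[OF dk]])
    qed (use sq_integrableD[OF h] sq_integrableD[OF dk] in auto)
    also have "\<dots> = d / 2 * H + D z / (2 * d)"
      using sq_integrableD[OF h] sq_integrableD[OF dk] by (simp add: H_def D_def)
    also have "\<dots> < d / 2 * H + e / 2"
      using elim d by (simp add: field_simps)
    also have "\<dots> \<le> e"
      using H \<open>e > 0\<close> by (simp add: d_def field_simps)
    finally show ?case .
  qed
qed

text \<open>This is the Fourier transform of \<open>exp (- \<epsilon> * (norm s)\<^sup>2)\<close>.
  It is deliberately left unnormalized: its mass is \<open>(2 * pi) ^ DIM('a)\<close> for every
  \<open>\<epsilon>\<close>, so for small \<open>\<epsilon>\<close> it approximates that multiple of
  the delta measure at 0, and this is the constant in Plancherel's theorem.\<close>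

definition gauss :: "real \<Rightarrow> 'a::euclidean_space \<Rightarrow> real" where
  "gauss \<epsilon> y = (pi / \<epsilon>) powr (DIM('a) / 2) * exp (- (norm y)\<^sup>2 / (4 * \<epsilon>))"

lemma gauss_measurable [measurable]: "gauss \<epsilon> \<in> borel_measurable borel"
  unfolding gauss_def by measurable

lemma gauss_nonneg: "gauss \<epsilon> y \<ge> 0"
  by (simp add: gauss_def)

lemma gauss_bound: "\<epsilon> > 0 \<Longrightarrow> gauss \<epsilon> (y::'a::euclidean_space) \<le> (pi / \<epsilon>) powr (DIM('a) / 2)"
  unfolding gauss_def by (rule mult_left_le) auto

lemma gauss_minus: "gauss \<epsilon> (- y) = gauss \<epsilon> y"
  by (simp add: gauss_def)

lemma gaussian_ft_1d:
  assumes e: "\<epsilon> > 0"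
  shows "integrable lborel (\<lambda>s::real. exp (- \<epsilon> * s\<^sup>2) * exp (- \<i> * (s * y)))" (is "integrable _ ?f")
    and "(LINT s::real|lborel. exp (- \<epsilon> * s\<^sup>2) * exp (- \<i> * (s * y))) =
       complex_of_real ((pi / \<epsilon>) powr (1 / 2) * exp (- y\<^sup>2 / (4 * \<epsilon>)))"
proof -
  \<comment> \<open>Chosen so that \<open>\<epsilon> * c\<^sup>2 = 1 / 2\<close>: the substitution
    \<open>s = c * x\<close> produces the standard normal density, whose characteristic function is
    known.\<close>
  define c where "c = 1 / sqrt (2 * \<epsilon>)"
  have c: "c > 0" "c\<^sup>2 = 1 / (2 * \<epsilon>)" using e by (auto simp: c_def power_divide)
  define t where "t = - c * y"
  have eq: "?f (0 + c * x) = sqrt (2 * pi) * (std_normal_density x *\<^sub>R iexp (t * x))" for x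
  proof -
    have "- \<epsilon> * (c * x)\<^sup>2 = - x\<^sup>2 / 2" using e by (simp add: power_mult_distrib c)
    then have "exp (- \<epsilon> * (c * x)\<^sup>2) = sqrt (2 * pi) * std_normal_density x"
      by (simp add: std_normal_density_def)
    moreover have "exp (- \<i> * (c * x * y)) = iexp (t * x)" by (simp add: t_def algebra_simps)
    ultimately show ?thesis
      by (simp add: scaleR_conv_of_real)
  qed
  interpret prob_space std_normal_distribution by (rule real_dist_normal_dist[THEN real_distribution.axioms(1)])
  have "integrable std_normal_distribution (\<lambda>x. iexp (t * x))"
    by (rule integrable_const_bound[where B=1]) auto
  then have i1: "integrable lborel (\<lambda>x. std_normal_density x *\<^sub>R iexp (t * x))"
    by (subst (asm) integrable_density) auto
  have "char std_normal_distribution t = (LINT x|lborel. std_normal_density x *\<^sub>R iexp (t * x))"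
    unfolding char_def by (subst integral_density) auto
  then have i2: "(LINT x|lborel. std_normal_density x *\<^sub>R iexp (t * x)) = exp (- t\<^sup>2 / 2)"
    by (simp add: char_std_normal_distribution)
  show "integrable lborel ?f"
    using c i1 by (subst lborel_integrable_real_affine_iff[where c = c and t = 0, symmetric]) (auto simp only: eq intro!: integrable_mult_right)
  have "(LINT s::real|lborel. ?f s) = \<bar>c\<bar> *\<^sub>R (LINT x|lborel. ?f (0 + c * x))"
    using c by (intro lborel_integral_real_affine) auto
  also have "\<dots> = complex_of_real (c * sqrt (2 * pi) * exp (- t\<^sup>2 / 2))"
    unfolding eq using c i1 i2 by (simp add: scaleR_conv_of_real)
  also have "c * sqrt (2 * pi) = (pi / \<epsilon>) powr (1 / 2)"
    using e by (simp add: c_def powr_half_sqrt real_sqrt_divide real_sqrt_mult)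
  also have "- t\<^sup>2 / 2 = - y\<^sup>2 / (4 * \<epsilon>)"
    using e by (simp add: t_def power_mult_distrib c)
  finally show "(LINT s::real|lborel. ?f s) = complex_of_real ((pi / \<epsilon>) powr (1 / 2) * exp (- y\<^sup>2 / (4 * \<epsilon>)))" .
qed

lemma gaussian_ft:
  fixes y :: "'a::euclidean_space"
  assumes e: "\<epsilon> > 0"
  shows "integrable lborel (\<lambda>s::'a. exp (- \<epsilon> * (norm s)\<^sup>2) * exp (- \<i> * (s \<bullet> y)))" (is "integrable _ ?f")
    and "(LINT s::'a|lborel. exp (- \<epsilon> * (norm s)\<^sup>2) * exp (- \<i> * (s \<bullet> y))) = complex_of_real (gauss \<epsilon> y)"
proof -
  interpret product_sigma_finite "\<lambda>_::'a. lborel :: real measure" ..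
  define g where "g b r = exp (- \<epsilon> * r\<^sup>2) * exp (- \<i> * (r * (y \<bullet> b)))" for b :: 'a and r :: real
  have [measurable]: "?f \<in> borel_measurable borel" by measurable
  have f: "?f (\<Sum>b\<in>Basis. x b *\<^sub>R b) = (\<Prod>b\<in>Basis. g b (x b))" for x
  proof -
    let ?s = "\<Sum>b\<in>Basis. x b *\<^sub>R b"
    have sb: "?s \<bullet> b = x b" if "b \<in> Basis" for b using that by simp
    have "(norm ?s)\<^sup>2 = (\<Sum>b\<in>Basis. (x b)\<^sup>2)"
      unfolding power2_norm_eq_inner by (subst euclidean_inner) (simp add: sb power2_eq_square)
    then have "exp (- \<epsilon> * (norm ?s)\<^sup>2) = (\<Prod>b\<in>Basis. exp (- \<epsilon> * (x b)\<^sup>2))"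
      by (simp add: sum_distrib_left exp_sum flip: sum_negf)
    moreover have "?s \<bullet> y = (\<Sum>b\<in>Basis. x b * (y \<bullet> b))"
      by (subst euclidean_inner) (simp add: sb)
    then have "exp (- \<i> * (?s \<bullet> y)) = (\<Prod>b\<in>Basis. exp (- \<i> * (x b * (y \<bullet> b))))"
      by (simp add: sum_distrib_left exp_sum flip: sum_negf)
    ultimately show ?thesis
      by (simp add: g_def prod.distrib)
  qed
  have gi: "integrable lborel (g b)" and gv: "integral\<^sup>L lborel (g b) = ((pi / \<epsilon>) powr (1 / 2) * exp (- (y \<bullet> b)\<^sup>2 / (4 * \<epsilon>)))" for b
    unfolding g_def using gaussian_ft_1d[OF e] by auto
  show "integrable lborel ?f"
    by (subst lborel_eq, subst integrable_distr_eq) (simp_all only: f product_integrable_prod gi finite_Basis, measurable)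
  have "integral\<^sup>L lborel ?f = (LINT x|(\<Pi>\<^sub>M b\<in>Basis. lborel). (\<Prod>b\<in>Basis. g b (x b)))"
    by (subst lborel_eq, subst integral_distr) (simp_all only: f, measurable)
  also have "\<dots> = (\<Prod>b\<in>Basis. integral\<^sup>L lborel (g b))"
    by (rule product_integral_prod) (auto intro: gi)
  also have "\<dots> = complex_of_real ((\<Prod>b\<in>(Basis::'a set). (pi / \<epsilon>) powr (1 / 2)) * exp (- (\<Sum>b\<in>Basis. (y \<bullet> b)\<^sup>2) / (4 * \<epsilon>)))"
    unfolding gv by (simp only: of_real_prod[symmetric] prod.distrib exp_sum[symmetric] finite_Basis)
      (simp add: sum_negf sum_divide_distrib)
  also have "(\<Prod>b\<in>(Basis::'a set). (pi / \<epsilon>) powr (1 / 2)) = (pi / \<epsilon>) powr (DIM('a) / 2)"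
    using e by (simp add: powr_powr flip: powr_realpow)
  also have "(\<Sum>b\<in>Basis. (y \<bullet> b)\<^sup>2) = (norm y)\<^sup>2"
    unfolding power2_norm_eq_inner by (subst euclidean_inner[of y y]) (simp add: power2_eq_square)
  finally show "integral\<^sup>L lborel ?f = complex_of_real (gauss \<epsilon> y)"
    by (simp add: gauss_def)
qed

lemma integrable_gaussian:
  "\<epsilon> > 0 \<Longrightarrow> integrable lborel (\<lambda>s::'a::euclidean_space. exp (- \<epsilon> * (norm s)\<^sup>2))"
  using integrable_norm[OF gaussian_ft(1)[of \<epsilon> "0::'a"]] by (simp add: norm_mult)

text \<open>Up to a constant, \<open>gauss \<epsilon>\<close> is again a Gaussian, with parameter
  \<open>1 / (4 * \<epsilon>)\<close>, so its mass is read off from \<open>gaussian_ft\<close> at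
  frequency 0; the powers of \<open>\<epsilon>\<close> cancel.\<close>

lemma integral_gauss:
  assumes "\<epsilon> > 0"
  shows "integrable lborel (gauss \<epsilon> :: 'a::euclidean_space \<Rightarrow> real)"
    and "(LINT y::'a|lborel. gauss \<epsilon> y) = (2 * pi) ^ DIM('a)"
proof -
  have e': "1 / (4 * \<epsilon>) > 0" using assms by simp
  have eq: "- (norm y)\<^sup>2 / (4 * \<epsilon>) = - (1 / (4 * \<epsilon>)) * (norm y)\<^sup>2" for y :: 'a by simp
  show "integrable lborel (gauss \<epsilon> :: 'a \<Rightarrow> real)"
    using integrable_gaussian[OF e', where 'a='a] unfolding gauss_def eq by auto
  have "complex_of_real (LINT s::'a|lborel. exp (- (1 / (4 * \<epsilon>)) * (norm s)\<^sup>2)) = complex_of_real (gauss (1 / (4 * \<epsilon>)) (0::'a))"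
    unfolding integral_complex_of_real[symmetric] using gaussian_ft(2)[OF e', of "0::'a"] by simp
  then have "(LINT s::'a|lborel. exp (- (1 / (4 * \<epsilon>)) * (norm s)\<^sup>2)) = (pi * (4 * \<epsilon>)) powr (DIM('a) / 2)"
    unfolding of_real_eq_iff by (simp add: gauss_def)
  then have "(LINT y::'a|lborel. gauss \<epsilon> y) = (pi / \<epsilon>) powr (DIM('a) / 2) * (pi * (4 * \<epsilon>)) powr (DIM('a) / 2)"
    unfolding gauss_def eq by simp
  also have "\<dots> = ((2 * pi)\<^sup>2) powr (DIM('a) / 2)"
    using assms by (subst powr_mult[symmetric]) (auto simp: power2_eq_square mult_ac)
  also have "\<dots> = (2 * pi) ^ DIM('a)"
    by (subst powr_numeral[symmetric], simp, subst powr_powr) (simp add: powr_realpow)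
  finally show "(LINT y::'a|lborel. gauss \<epsilon> y) = (2 * pi) ^ DIM('a)" .
qed

lemma gauss_scale:
  assumes e: "\<epsilon> > 0"
  shows "sqrt \<epsilon> ^ DIM('a) * gauss \<epsilon> (sqrt \<epsilon> *\<^sub>R w) = gauss 1 (w :: 'a::euclidean_space)"
proof -
  have "sqrt \<epsilon> ^ DIM('a) = \<epsilon> powr (DIM('a) / 2)"
    using e by (simp add: powr_half_sqrt[symmetric] powr_powr flip: powr_realpow)
  moreover have "\<epsilon> powr (DIM('a) / 2) * (pi / \<epsilon>) powr (DIM('a) / 2) = pi powr (DIM('a) / 2)"
    using e by (subst powr_mult[symmetric]) auto
  ultimately show ?thesis
    using e unfolding gauss_def
    by (simp add: power_mult_distrib mult.assoc[symmetric])
qed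

text \<open>The substitution \<open>y = sqrt (1 / Suc n) *\<^sub>R w\<close> moves the dependence on
  \<open>n\<close> from the kernel into the argument of \<open>B\<close>. There continuity at 0
  gives the pointwise limit, and the bound \<open>M\<close> gives a dominating function.\<close>

lemma gauss_approximate_identity:
  fixes B :: "'a::euclidean_space \<Rightarrow> complex"
  assumes [measurable]: "B \<in> borel_measurable borel" and M: "\<And>y. cmod (B y) \<le> M"
    and B0: "(B \<longlongrightarrow> B 0) (at 0)"
  shows "(\<lambda>n. LINT y|lborel. gauss (1 / Suc n) y * B y) \<longlonglongrightarrow> (2 * pi) ^ DIM('a) * B 0"
proof -
  have "(LINT y|lborel. gauss (1 / Suc n) y * B y) = (LINT w|lborel. gauss 1 w * B (sqrt (1 / Suc n) *\<^sub>R w))" for n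
  proof -
    let ?c = "sqrt (1 / Suc n)"
    have "(LINT y|lborel. gauss (1 / Suc n) y * B y) =
      (\<bar>?c\<bar> ^ DIM('a)) *\<^sub>R (LINT w|lborel. gauss (1 / Suc n) (0 + ?c *\<^sub>R w) * B (0 + ?c *\<^sub>R w))"
      by (rule integral_lborel_scale) auto
    also have "\<dots> = (LINT w|lborel. (?c ^ DIM('a) * gauss (1 / Suc n) (?c *\<^sub>R w)) * B (?c *\<^sub>R w))"
      by (simp add: scaleR_conv_of_real mult.assoc del: of_real_power flip: of_real_power)
    finally show ?thesis
      by (subst (asm) gauss_scale) auto
  qed
  moreover have "(\<lambda>n. LINT w|lborel. gauss 1 w * B (sqrt (1 / Suc n) *\<^sub>R w)) \<longlonglongrightarrow> (LINT w::'a|lborel. gauss 1 w * B 0)"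
  proof (rule integral_dominated_convergence)
    show "integrable lborel (\<lambda>w::'a. gauss 1 w * M)" using integral_gauss(1)[of 1] by auto
    have "isCont B 0" using B0 by (simp add: isCont_def)
    show "AE w in lborel. (\<lambda>n. gauss 1 w * B (sqrt (1 / Suc n) *\<^sub>R w)) \<longlonglongrightarrow> gauss 1 w * B 0"
    proof (rule AE_I2)
      fix w :: 'a
      have "(\<lambda>n. sqrt (1 / Suc n) *\<^sub>R w) \<longlonglongrightarrow> sqrt 0 *\<^sub>R w"
        by (intro tendsto_intros LIMSEQ_Suc lim_1_over_n)
      then have "(\<lambda>n. sqrt (1 / Suc n) *\<^sub>R w) \<longlonglongrightarrow> 0" by simp
      from isCont_tendsto_compose[OF \<open>isCont B 0\<close> this]
      show "(\<lambda>n. gauss 1 w * B (sqrt (1 / Suc n) *\<^sub>R w)) \<longlonglongrightarrow> gauss 1 w * B 0"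
        by (intro tendsto_intros)
    qed
    show "AE w in lborel. norm (complex_of_real (gauss 1 w) * B (sqrt (1 / Suc n) *\<^sub>R w)) \<le> gauss 1 w * M" for n
      by (auto simp: norm_mult gauss_nonneg intro!: mult_left_mono M)
  qed auto
  moreover have "(LINT w::'a|lborel. gauss 1 w * B 0) = (2 * pi) ^ DIM('a) * B 0"
    by (simp add: integral_gauss(2))
  ultimately show ?thesis by (simp only:)
qed

section \<open>Plancherel's theorem\<close>

lemma borel_measurable_fst [measurable]:
  "fst \<in> (borel :: ('a::{second_countable_topology} \<times> 'b::{second_countable_topology}) measure) \<rightarrow>\<^sub>M borel"
  by (intro borel_measurable_continuous_onI continuous_intros)

lemma borel_measurable_snd [measurable]:
  "snd \<in> (borel :: ('a::{second_countable_topology} \<times> 'b::{second_countable_topology}) measure) \<rightarrow>\<^sub>M borel"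
  by (intro borel_measurable_continuous_onI continuous_intros)

lemma integrable_pair_mult:
  fixes u :: "'a::euclidean_space \<Rightarrow> complex" and v :: "'b::euclidean_space \<Rightarrow> complex"
  assumes u: "integrable lborel u" and v: "integrable lborel v"
  shows "integrable (lborel \<Otimes>\<^sub>M lborel) (\<lambda>(x, y). u x * v y)"
proof (rule lborel_pair.Fubini_integrable)
  have [measurable]: "u \<in> borel_measurable borel" "v \<in> borel_measurable borel" using u v by auto
  show "(\<lambda>(x, y). u x * v y) \<in> borel_measurable (lborel \<Otimes>\<^sub>M lborel)" by measurable
  show "integrable lborel (\<lambda>x. LINT y|lborel. norm (case (x, y) of (x, y) \<Rightarrow> u x * v y))"
    using u by (simp add: norm_mult)
  show "AE x in lborel. integrable lborel (\<lambda>y. case (x, y) of (x, y) \<Rightarrow> u x * v y)"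
    using v by simp
qed

text \<open>The Gaussian makes the double integral absolutely convergent, so Fubini lets the
  \<open>s\<close>-integral act on the phase alone. The phase is left general because two instances
  occur: a difference of two points in \<open>plancherel_regularized\<close>, and a real-valued
  difference of inner products in \<open>ambiguity_regularized\<close>.\<close>

lemma integral_oscillation_gaussian:
  fixes \<phi> :: "'a::euclidean_space \<Rightarrow> complex" and \<theta> :: "'a \<Rightarrow> 'b::euclidean_space"
  assumes \<phi>: "integrable lborel \<phi>" and [measurable]: "\<theta> \<in> borel_measurable borel" and e: "\<epsilon> > 0"
  shows "(LINT s|lborel. exp (- \<epsilon> * (norm s)\<^sup>2) * (LINT z|lborel. \<phi> z * exp (- \<i> * (s \<bullet> \<theta> z)))) =
     (LINT z|lborel. \<phi> z * gauss \<epsilon> (\<theta> z))"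
proof -
  have [measurable]: "\<phi> \<in> borel_measurable borel" using \<phi> by auto
  let ?f = "\<lambda>s z. exp (- \<epsilon> * (norm s)\<^sup>2) * (\<phi> z * exp (- \<i> * (s \<bullet> \<theta> z)))"
  have "integrable lborel (\<lambda>s::'b. complex_of_real (exp (- \<epsilon> * (norm s)\<^sup>2)))"
    using integrable_gaussian[OF e, where 'a='b] by (rule integrable_of_real)
  from integrable_pair_mult[OF this \<phi>]
  have "integrable (lborel \<Otimes>\<^sub>M lborel) (case_prod ?f)"
    by (rule Bochner_Integration.integrable_bound) (auto simp: norm_mult)
  from lborel_pair.Fubini_integral[OF this]
  have "(LINT s|lborel. LINT z|lborel. ?f s z) = (LINT z|lborel. LINT s|lborel. ?f s z)" by simp
  also have "\<dots> = (LINT z|lborel. \<phi> z * (LINT s|lborel. exp (- \<epsilon> * (norm s)\<^sup>2) * exp (- \<i> * (s \<bullet> \<theta> z))))"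
    by (subst integral_mult_right_zero[symmetric]) (simp add: mult_ac)
  also have "\<dots> = (LINT z|lborel. \<phi> z * gauss \<epsilon> (\<theta> z))"
    by (simp only: gaussian_ft(2)[OF e])
  finally show ?thesis by simp
qed

text \<open>Doubling of variables: it brings products of transforms into the form that
  \<open>integral_oscillation_gaussian\<close> accepts, a single integral whose phase is a
  difference.\<close>

lemma integral_oscillation_mult_cnj:
  fixes h k :: "'a::euclidean_space \<Rightarrow> complex" and \<alpha> :: "'a \<Rightarrow> real"
  assumes h: "integrable lborel h" and k: "integrable lborel k" and [measurable]: "\<alpha> \<in> borel_measurable borel"
  shows "(LINT x|lborel. h x * exp (- \<i> * \<alpha> x)) * cnj (LINT x|lborel. k x * exp (- \<i> * \<alpha> x)) =
    (LINT z|lborel. (h (fst z) * cnj (k (snd z))) * exp (- \<i> * (\<alpha> (fst z) - \<alpha> (snd z))))"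
proof -
  have [measurable]: "h \<in> borel_measurable borel" "k \<in> borel_measurable borel" using h k by auto
  let ?h = "\<lambda>x. h x * exp (- \<i> * \<alpha> x)" and ?k = "\<lambda>x. cnj (k x * exp (- \<i> * \<alpha> x))"
  have h': "integrable lborel ?h"
    by (rule Bochner_Integration.integrable_bound[OF h]) (auto simp: norm_mult)
  have k': "integrable lborel ?k"
    by (rule Bochner_Integration.integrable_bound[OF k]) (auto simp: norm_mult)
  have "integral\<^sup>L lborel ?h * cnj (LINT x|lborel. k x * exp (- \<i> * \<alpha> x)) = (LINT x|lborel. LINT y|lborel. ?h x * ?k y)"
    by (simp add: integral_cnj del: complex_cnj_mult)
  also have "\<dots> = (LINT z|(lborel \<Otimes>\<^sub>M lborel). (\<lambda>(x, y). ?h x * ?k y) z)"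
    by (rule lborel_pair.integral_fst) (rule integrable_pair_mult[OF h' k'])
  also have "\<dots> = (LINT z|lborel. (h (fst z) * cnj (k (snd z))) * exp (- \<i> * (\<alpha> (fst z) - \<alpha> (snd z))))"
    unfolding lborel_prod
    by (intro Bochner_Integration.integral_cong refl)
      (simp add: case_prod_unfold exp_cnj right_diff_distrib exp_diff exp_minus field_simps)
  finally show ?thesis .
qed

definition fourier :: "('a::euclidean_space \<Rightarrow> complex) \<Rightarrow> 'a \<Rightarrow> complex" where
  "fourier h \<xi> = (LINT x|lborel. h x * exp (- \<i> * complex_of_real (x \<bullet> \<xi>)))"

lemma fourier_measurable [measurable]:
  assumes [measurable]: "h \<in> borel_measurable borel"
  shows "fourier h \<in> borel_measurable borel"
  unfolding fourier_def by measurable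

text \<open>The weight replaces the integrability of the product of transforms, which is not yet
  known. Integrating out \<open>\<xi>\<close> leaves \<open>gauss\<close> of the difference of the
  two variables, and the shift \<open>y = z + x\<close> collects the rest into a
  correlation.\<close>

lemma plancherel_regularized:
  fixes h k :: "'a::euclidean_space \<Rightarrow> complex"
  assumes h: "integrable lborel h" and k: "integrable lborel k" and e: "\<epsilon> > 0"
  shows "(LINT \<xi>|lborel. exp (- \<epsilon> * (norm \<xi>)\<^sup>2) * (fourier h \<xi> * cnj (fourier k \<xi>))) =
    (LINT z|lborel. gauss \<epsilon> z * correlation h k z)"
proof -
  have [measurable]: "h \<in> borel_measurable borel" "k \<in> borel_measurable borel" using h k by auto
  have kc: "integrable lborel (\<lambda>x. cnj (k x))" using k by simp
  define \<phi> where "\<phi> z = h (fst z) * cnj (k (snd z))" for z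
  have \<phi>: "integrable (lborel \<Otimes>\<^sub>M lborel) \<phi>"
    using integrable_pair_mult[OF h kc] by (simp add: \<phi>_def[abs_def] case_prod_unfold)
  then have [measurable]: "\<phi> \<in> borel_measurable borel" unfolding lborel_prod by auto
  have prod_eq: "fourier h \<xi> * cnj (fourier k \<xi>) = (LINT z|lborel. \<phi> z * exp (- \<i> * (\<xi> \<bullet> (fst z - snd z))))" for \<xi>
    unfolding fourier_def \<phi>_def using integral_oscillation_mult_cnj[OF h k, of "\<lambda>x. x \<bullet> \<xi>"]
    by (simp add: inner_diff_right inner_commute)
  have "(LINT \<xi>|lborel. exp (- \<epsilon> * (norm \<xi>)\<^sup>2) * (fourier h \<xi> * cnj (fourier k \<xi>)))
     = (LINT z|lborel. \<phi> z * gauss \<epsilon> (fst z - snd z))"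
    unfolding prod_eq
    by (rule integral_oscillation_gaussian)
      (use \<phi> e in \<open>auto simp: lborel_prod intro!: borel_measurable_continuous_onI continuous_intros\<close>)
  also have "\<dots> = (LINT x|lborel. LINT y|lborel. h x * cnj (k y) * gauss \<epsilon> (x - y))"
  proof -
    have "integrable (lborel \<Otimes>\<^sub>M lborel) (\<lambda>z. \<phi> z * gauss \<epsilon> (fst z - snd z))"
    proof (rule Bochner_Integration.integrable_bound)
      show "integrable (lborel \<Otimes>\<^sub>M lborel) (\<lambda>z. \<phi> z * (pi / \<epsilon>) powr (DIM('a) / 2))" using \<phi> by simp
      show "AE z in lborel \<Otimes>\<^sub>M lborel. cmod (\<phi> z * gauss \<epsilon> (fst z - snd z)) \<le> cmod (\<phi> z * (pi / \<epsilon>) powr (DIM('a) / 2))"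
        using gauss_bound[OF e, where 'a='a] by (auto simp: norm_mult gauss_nonneg intro!: mult_left_mono)
      have "(\<lambda>z. \<phi> z * gauss \<epsilon> (fst z - snd z)) \<in> borel_measurable borel" by measurable
      then show "(\<lambda>z. \<phi> z * gauss \<epsilon> (fst z - snd z)) \<in> borel_measurable (lborel \<Otimes>\<^sub>M lborel)"
        by (simp add: lborel_prod)
    qed
    from lborel_pair.integral_fst'[OF this] show ?thesis
      by (simp add: lborel_prod \<phi>_def)
  qed
  also have "\<dots> = (LINT x|lborel. LINT z|lborel. h x * cnj (k (z + x)) * gauss \<epsilon> z)"
  proof (rule Bochner_Integration.integral_cong[OF refl])
    fix x :: 'a
    have "(LINT z|lborel. (\<lambda>y. h x * cnj (k y) * gauss \<epsilon> (x - y)) (x + z)) = (LINT y|lborel. h x * cnj (k y) * gauss \<epsilon> (x - y))"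
      by (rule integral_lborel_translation) measurable
    then show "(LINT y|lborel. h x * cnj (k y) * gauss \<epsilon> (x - y)) = (LINT z|lborel. h x * cnj (k (z + x)) * gauss \<epsilon> z)"
      by (simp add: gauss_minus add.commute)
  qed
  also have "\<dots> = (LINT z|lborel. LINT x|lborel. h x * cnj (k (z + x)) * gauss \<epsilon> z)"
  proof (rule lborel_pair.Fubini_integral, rule integrableI_bounded)
    let ?c = "(pi / \<epsilon>) powr (DIM('a) / 2)"
    show "(\<lambda>(z, x). h x * cnj (k (z + x)) * gauss \<epsilon> z) \<in> borel_measurable (lborel \<Otimes>\<^sub>M lborel)" by measurable
    have "(\<integral>\<^sup>+z. ennreal (norm (case z of (z, x) \<Rightarrow> h x * cnj (k (z + x)) * gauss \<epsilon> z)) \<partial>(lborel \<Otimes>\<^sub>M lborel))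
      \<le> (\<integral>\<^sup>+z. (case z of (z, x) \<Rightarrow> ennreal (cmod (h x)) * ennreal (cmod (k (x + z))) * ennreal ?c) \<partial>(lborel \<Otimes>\<^sub>M lborel))"
      using gauss_bound[OF e, where 'a='a]
      by (intro nn_integral_mono) (auto simp: norm_mult gauss_nonneg add.commute simp flip: ennreal_mult intro!: ennreal_leI mult_left_mono)
    also have "\<dots> = (\<integral>\<^sup>+x. \<integral>\<^sup>+z. ennreal (cmod (h x)) * ennreal (cmod (k (x + z))) * ennreal ?c \<partial>lborel \<partial>lborel)"
      by (subst lborel_pair.nn_integral_snd[symmetric]) auto
    also have "\<dots> = (\<integral>\<^sup>+x. ennreal (cmod (h x)) * (\<integral>\<^sup>+z. ennreal (cmod (k (x + z))) \<partial>lborel) * ennreal ?c \<partial>lborel)"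
      by (simp add: nn_integral_multc nn_integral_cmult)
    also have "\<dots> = (\<integral>\<^sup>+x. ennreal (cmod (h x)) \<partial>lborel) * (\<integral>\<^sup>+z. ennreal (cmod (k z)) \<partial>lborel) * ennreal ?c"
      by (subst nn_integral_lborel_translation[of "\<lambda>z. ennreal (cmod (k z))"]) (auto simp: nn_integral_multc)
    also have "\<dots> < \<infinity>"
      using h k by (simp add: integrable_iff_bounded ennreal_mult_less_top)
    finally show "(\<integral>\<^sup>+z. ennreal (norm (case z of (z, x) \<Rightarrow> h x * cnj (k (z + x)) * gauss \<epsilon> z)) \<partial>(lborel \<Otimes>\<^sub>M lborel)) < \<infinity>" .
  qed
  also have "\<dots> = (LINT z|lborel. gauss \<epsilon> z * correlation h k z)"
    by (simp add: correlation_def mult.commute)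
  finally show ?thesis .
qed

lemma plancherel_regularized_tendsto:
  fixes h k :: "'a::euclidean_space \<Rightarrow> complex"
  assumes h: "integrable lborel h" "sq_integrable h" and k: "integrable lborel k" "sq_integrable k"
  shows "(\<lambda>n. LINT \<xi>|lborel. exp (- (1 / Suc n) * (norm \<xi>)\<^sup>2) * (fourier h \<xi> * cnj (fourier k \<xi>)))
    \<longlonglongrightarrow> (2 * pi) ^ DIM('a) * (LINT x|lborel. h x * cnj (k x))"
proof -
  have [measurable]: "h \<in> borel_measurable borel" "k \<in> borel_measurable borel" using h k by auto
  have "(\<lambda>n. LINT z|lborel. gauss (1 / Suc n) z * correlation h k z) \<longlonglongrightarrow> (2 * pi) ^ DIM('a) * correlation h k 0"
    by (rule gauss_approximate_identity[OF _ correlation_bound[OF h(2) k(2)] correlation_tendsto[OF h(2) k(2)]])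
      measurable
  moreover have "correlation h k 0 = (LINT x|lborel. h x * cnj (k x))" by (simp add: correlation_def)
  moreover have "(LINT \<xi>|lborel. exp (- (1 / Suc n) * (norm \<xi>)\<^sup>2) * (fourier h \<xi> * cnj (fourier k \<xi>)))
     = (LINT z|lborel. gauss (1 / Suc n) z * correlation h k z)" for n
    by (rule plancherel_regularized[OF h(1) k(1)]) simp
  ultimately show ?thesis by (simp only:)
qed

lemma fourier_bound:
  assumes "integrable lborel h"
  shows "cmod (fourier h \<xi>) \<le> (LINT x|lborel. cmod (h x))"
proof -
  have "cmod (fourier h \<xi>) \<le> (LINT x|lborel. cmod (h x * exp (- \<i> * (x \<bullet> \<xi>))))"
    unfolding fourier_def by (rule integral_norm_bound)
  then show ?thesis by (simp add: norm_mult)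
qed

lemma exp_neg_over_Suc_tendsto: "(\<lambda>n. exp (- (1 / Suc n) * a) :: real) \<longlonglongrightarrow> 1"
proof -
  have "(\<lambda>n. exp (- (1 / Suc n) * a) :: real) \<longlonglongrightarrow> exp (- 0 * a)"
    by (intro tendsto_intros LIMSEQ_Suc lim_1_over_n)
  then show ?thesis by simp
qed

text \<open>For \<open>k = h\<close> the regularized integrands increase with \<open>n\<close> while
  their integrals converge, so monotone convergence delivers the integrability of the limit together
  with its value.\<close>

theorem plancherel_L1_L2:
  fixes h :: "'a::euclidean_space \<Rightarrow> complex"
  assumes h: "integrable lborel h" "sq_integrable h"
  shows "sq_integrable (fourier h)"
    and "(LINT \<xi>|lborel. (cmod (fourier h \<xi>))\<^sup>2) = (2 * pi) ^ DIM('a) * (LINT x|lborel. (cmod (h x))\<^sup>2)"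
proof -
  have [measurable]: "h \<in> borel_measurable borel" using h by auto
  let ?f = "\<lambda>n \<xi>. exp (- (1 / Suc n) * (norm \<xi>)\<^sup>2) * (cmod (fourier h \<xi>))\<^sup>2"
  have sq: "w * cnj w = complex_of_real ((cmod w)\<^sup>2)" for w
    using complex_norm_square[of w] by simp
  have lim: "(\<lambda>n. LINT \<xi>|lborel. ?f n \<xi>) \<longlonglongrightarrow> (2 * pi) ^ DIM('a) * (LINT x|lborel. (cmod (h x))\<^sup>2)"
  proof -
    have "(\<lambda>n. complex_of_real (LINT \<xi>|lborel. ?f n \<xi>)) \<longlonglongrightarrow> complex_of_real ((2 * pi) ^ DIM('a) * (LINT x|lborel. (cmod (h x))\<^sup>2))"
      using plancherel_regularized_tendsto[OF h h] unfolding sq of_real_mult[symmetric] integral_complex_of_real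
      by simp
    then show ?thesis by (simp only: tendsto_of_real_iff)
  qed
  have fi: "integrable lborel (?f n)" for n
  proof (rule Bochner_Integration.integrable_bound)
    show "integrable lborel (\<lambda>\<xi>::'a. exp (- (1 / Suc n) * (norm \<xi>)\<^sup>2) * (LINT x|lborel. cmod (h x))\<^sup>2)"
      by (intro integrable_mult_left integrable_gaussian) simp
    show "AE \<xi> in lborel. norm (?f n \<xi>) \<le> norm (exp (- (1 / Suc n) * (norm \<xi>)\<^sup>2) * (LINT x|lborel. cmod (h x))\<^sup>2)"
      using fourier_bound[OF h(1)] by (auto simp: abs_mult intro!: mult_left_mono power_mono)
  qed measurable
  have mono: "mono (\<lambda>n. ?f n \<xi>)" for \<xi>
    by (intro monoI mult_right_mono) (auto simp: field_simps intro!: mult_left_mono mult_right_mono)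
  have pw: "(\<lambda>n. ?f n \<xi>) \<longlonglongrightarrow> (cmod (fourier h \<xi>))\<^sup>2" for \<xi>
    using tendsto_mult_right[OF exp_neg_over_Suc_tendsto[of "(norm \<xi>)\<^sup>2"], of "(cmod (fourier h \<xi>))\<^sup>2"] by simp
  note mc = fi AE_I2[OF mono] AE_I2[OF pw] lim
  have "integrable lborel (\<lambda>\<xi>. (cmod (fourier h \<xi>))\<^sup>2)"
    by (rule integrable_monotone_convergence[OF mc]) measurable
  then show "sq_integrable (fourier h)"
    unfolding sq_integrable_def by auto
  show "(LINT \<xi>|lborel. (cmod (fourier h \<xi>))\<^sup>2) = (2 * pi) ^ DIM('a) * (LINT x|lborel. (cmod (h x))\<^sup>2)"
    by (rule integral_monotone_convergence[OF mc]) measurable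
qed

text \<open>The integrand has no sign here, but dominated convergence is available: by
  \<open>plancherel_L1_L2\<close> both transforms are square-integrable, so their product is
  integrable.\<close>

theorem parseval_L1_L2:
  fixes h k :: "'a::euclidean_space \<Rightarrow> complex"
  assumes h: "integrable lborel h" "sq_integrable h" and k: "integrable lborel k" "sq_integrable k"
  shows "(LINT \<xi>|lborel. fourier h \<xi> * cnj (fourier k \<xi>)) = (2 * pi) ^ DIM('a) * (LINT x|lborel. h x * cnj (k x))"
proof (rule LIMSEQ_unique[OF _ plancherel_regularized_tendsto[OF h k]])
  have [measurable]: "h \<in> borel_measurable borel" "k \<in> borel_measurable borel" using h k by auto
  show "(\<lambda>n. LINT \<xi>|lborel. exp (- (1 / Suc n) * (norm \<xi>)\<^sup>2) * (fourier h \<xi> * cnj (fourier k \<xi>)))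
    \<longlonglongrightarrow> (LINT \<xi>|lborel. fourier h \<xi> * cnj (fourier k \<xi>))"
  proof (rule integral_dominated_convergence)
    show "integrable lborel (\<lambda>\<xi>. cmod (fourier h \<xi> * cnj (fourier k \<xi>)))"
      by (intro integrable_norm sq_integrable_mult sq_integrable_cnj plancherel_L1_L2 h k)
    show "AE \<xi> in lborel. (\<lambda>n. exp (- (1 / Suc n) * (norm \<xi>)\<^sup>2) * (fourier h \<xi> * cnj (fourier k \<xi>))) \<longlonglongrightarrow> fourier h \<xi> * cnj (fourier k \<xi>)"
    proof (rule AE_I2)
      fix \<xi> :: 'a
      show "(\<lambda>n. exp (- (1 / Suc n) * (norm \<xi>)\<^sup>2) * (fourier h \<xi> * cnj (fourier k \<xi>))) \<longlonglongrightarrow> fourier h \<xi> * cnj (fourier k \<xi>)"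
        using tendsto_mult_right[OF tendsto_of_real[OF exp_neg_over_Suc_tendsto[of "(norm \<xi>)\<^sup>2"]], of "fourier h \<xi> * cnj (fourier k \<xi>)"] by simp
    qed
    show "AE \<xi> in lborel. cmod (exp (- (1 / Suc n) * (norm \<xi>)\<^sup>2) * (fourier h \<xi> * cnj (fourier k \<xi>))) \<le> cmod (fourier h \<xi> * cnj (fourier k \<xi>))" for n
      by (auto simp: norm_mult intro!: mult_left_le_one_le)
  qed measurable
qed

section \<open>The Fourier transform of square-integrable functions\<close>

lemma sq_integrable_indicator_ball: "sq_integrable (\<lambda>x::'a::euclidean_space. indicator (ball 0 R) x)"
  unfolding sq_integrable_def
proof
  have "integrable lborel (\<lambda>x::'a. indicator (ball 0 R) x :: real)"
    using emeasure_bounded_finite[of "ball (0::'a) R"] by (intro integrable_real_indicator) auto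
  then show "integrable lborel (\<lambda>x::'a. (cmod (indicator (ball 0 R) x))\<^sup>2)"
    by (rule Bochner_Integration.integrable_bound) (auto simp: indicator_def)
qed (auto intro: borel_measurable_indicator)

lemma truncation_integrable:
  assumes h: "sq_integrable (h :: 'a::euclidean_space \<Rightarrow> complex)"
  shows "integrable lborel (\<lambda>x. indicator (ball 0 R) x * h x)" "sq_integrable (\<lambda>x. indicator (ball 0 R) x * h x)"
proof -
  show "integrable lborel (\<lambda>x. indicator (ball 0 R) x * h x)"
    by (rule sq_integrable_mult[OF sq_integrable_indicator_ball h])
  then show "sq_integrable (\<lambda>x. indicator (ball 0 R) x * h x)"
    by (intro sq_integrable_bound[OF h]) (auto simp: indicator_def)
qed

lemma fourier_diff:
  assumes h: "integrable lborel h" and k: "integrable lborel k"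
  shows "fourier (\<lambda>x. h x - k x) \<xi> = fourier h \<xi> - fourier k \<xi>"
proof -
  have [measurable]: "h \<in> borel_measurable borel" "k \<in> borel_measurable borel" using h k by auto
  have "integrable lborel (\<lambda>x. h x * exp (- \<i> * (x \<bullet> \<xi>)))"
    by (rule Bochner_Integration.integrable_bound[OF h]) (auto simp: norm_mult)
  moreover have "integrable lborel (\<lambda>x. k x * exp (- \<i> * (x \<bullet> \<xi>)))"
    by (rule Bochner_Integration.integrable_bound[OF k]) (auto simp: norm_mult)
  ultimately show ?thesis unfolding fourier_def by (simp add: left_diff_distrib)
qed

text \<open>The weight \<open>2 ^ k\<close> forces increments of size at most
  \<open>sqrt M * (1 / sqrt 2) ^ k\<close>, which is a summable geometric sequence.\<close>

lemma convergent_of_weighted_bound: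
  fixes \<phi> :: "nat \<Rightarrow> complex"
  assumes "\<And>k. 2 ^ k * (cmod (\<phi> (Suc k) - \<phi> k))\<^sup>2 \<le> M"
  shows "convergent \<phi>"
proof -
  have "summable (\<lambda>k. \<phi> (Suc k) - \<phi> k)"
  proof (rule summable_comparison_test)
    have "cmod (\<phi> (Suc k) - \<phi> k) \<le> sqrt M * (1 / sqrt 2) ^ k" for k
    proof -
      have "(cmod (\<phi> (Suc k) - \<phi> k))\<^sup>2 \<le> M * (1 / 2) ^ k"
        using assms[of k] by (simp add: field_simps)
      then have "cmod (\<phi> (Suc k) - \<phi> k) \<le> sqrt (M * (1 / 2) ^ k)"
        by (rule real_le_rsqrt)
      then show ?thesis
        by (simp add: real_sqrt_mult real_sqrt_power real_sqrt_divide)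
    qed
    then show "\<exists>N. \<forall>k\<ge>N. cmod (\<phi> (Suc k) - \<phi> k) \<le> sqrt M * (1 / sqrt 2) ^ k" by blast
    show "summable (\<lambda>k. sqrt M * (1 / sqrt 2) ^ k)"
      by (intro summable_mult summable_geometric) simp
  qed
  then have "convergent (\<lambda>n. (\<Sum>k<n. \<phi> (Suc k) - \<phi> k) + \<phi> 0)"
    by (intro convergent_add convergent_const) (simp add: summable_iff_convergent)
  then show ?thesis by (simp add: sum_lessThan_telescope)
qed

text \<open>Riesz--Fischer argument: along radii whose tails decay like \<open>8\<^sup>-\<^sup>k\<close> the truncated
  transforms converge almost everywhere, and Fatou's lemma upgrades this to \<open>L\<^sup>2\<close>.\<close>
lemma fourier_truncations_converge:
  fixes h :: "'a::euclidean_space \<Rightarrow> complex"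
  assumes h: "sq_integrable h"
  obtains F where "sq_integrable F"
    "((\<lambda>R. LINT \<xi>|lborel. (cmod (F \<xi> - fourier (\<lambda>x. indicator (ball 0 R) x * h x) \<xi>))\<^sup>2) \<longlongrightarrow> 0) at_top"
proof -
  have [measurable]: "h \<in> borel_measurable borel" using h by measurable
  define t where "t R x = indicator (ball 0 R) x * h x" for R :: real and x
  define T where "T R = fourier (t R)" for R
  have t: "integrable lborel (t R)" "sq_integrable (t R)" for R
    unfolding t_def[abs_def] using truncation_integrable[OF h] by auto
  have [measurable]: "t R \<in> borel_measurable borel" for R using t(1)[of R] by auto
  have [measurable]: "T R \<in> borel_measurable borel" for R unfolding T_def by measurable
  define C where "C = (2 * pi) ^ DIM('a)"
  have C: "C > 0" by (simp add: C_def)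
  define tail where "tail R = (LINT x|lborel. indicator (- ball 0 R) x * (cmod (h x))\<^sup>2)" for R :: real
  have tail_int: "integrable lborel (\<lambda>x. indicator (- ball 0 R) x * (cmod (h x))\<^sup>2)" for R :: real
    by (rule Bochner_Integration.integrable_bound[OF sq_integrableD[OF h]])
      (auto simp: indicator_def)
  have tail_nonneg: "tail R \<ge> 0" for R unfolding tail_def by simp
  have tail_lim: "(tail \<longlongrightarrow> 0) at_top"
  proof -
    have "(tail \<longlongrightarrow> (LINT x::'a|lborel. (0::real))) at_top"
      unfolding tail_def
    proof (rule integral_dominated_convergence_at_top[OF _ _ sq_integrableD[OF h]])
      show "AE x in lborel. ((\<lambda>R. indicator (- ball 0 R) x * (cmod (h x))\<^sup>2) \<longlongrightarrow> 0) at_top"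
      proof (rule AE_I2)
        fix x :: 'a
        have "\<forall>\<^sub>F R in at_top. indicator (- ball 0 R) x * (cmod (h x))\<^sup>2 = 0"
          using eventually_gt_at_top[of "norm x"] by eventually_elim (auto simp: indicator_def)
        then show "((\<lambda>R. indicator (- ball 0 R) x * (cmod (h x))\<^sup>2) \<longlongrightarrow> 0) at_top"
          by (rule tendsto_eventually)
      qed
      show "\<forall>\<^sub>F R in at_top. AE x in lborel. norm (indicator (- ball 0 R) x * (cmod (h x))\<^sup>2) \<le> (cmod (h x))\<^sup>2"
        by (intro always_eventually allI AE_I2) (auto simp: indicator_def)
    qed auto
    then show ?thesis by simp
  qed
  have TT: "integrable lborel (\<lambda>\<xi>. (cmod (T S \<xi> - T R \<xi>))\<^sup>2)"
    "(LINT \<xi>|lborel. (cmod (T S \<xi> - T R \<xi>))\<^sup>2) \<le> C * tail R" if "R \<le> S" for R S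
  proof -
    let ?d = "\<lambda>x. t S x - t R x"
    have d: "integrable lborel ?d" "sq_integrable ?d"
      using t sq_integrable_diff[OF t(2) t(2)] by auto
    have eq: "fourier ?d = (\<lambda>\<xi>. T S \<xi> - T R \<xi>)" unfolding T_def by (intro ext fourier_diff t)
    show "integrable lborel (\<lambda>\<xi>. (cmod (T S \<xi> - T R \<xi>))\<^sup>2)"
      using plancherel_L1_L2(1)[OF d] unfolding eq by (rule sq_integrableD)
    have "(LINT x|lborel. (cmod (?d x))\<^sup>2) \<le> tail R"
      unfolding tail_def
      by (intro integral_mono sq_integrableD d tail_int) (use that in \<open>auto simp: t_def indicator_def\<close>)
    then show "(LINT \<xi>|lborel. (cmod (T S \<xi> - T R \<xi>))\<^sup>2) \<le> C * tail R"
      using plancherel_L1_L2(2)[OF d] C unfolding eq by (simp add: C_def)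
  qed
  then have TTn: "(\<integral>\<^sup>+\<xi>. ennreal ((cmod (T S \<xi> - T R \<xi>))\<^sup>2) \<partial>lborel) \<le> ennreal (C * tail R)" if "R \<le> S" for R S
    using that by (subst nn_integral_eq_integral) (auto intro!: ennreal_leI)
  have "\<exists>N. \<forall>R\<ge>N. tail R < (1 / 8) ^ k" for k
    using order_tendstoD(2)[OF tail_lim, of "(1 / 8) ^ k"] by (auto simp: eventually_at_top_linorder)
  then obtain N where N: "\<And>k R. R \<ge> N k \<Longrightarrow> tail R < (1 / 8) ^ k" by metis
  \<comment> \<open>A running sum instead of \<open>N k\<close> itself: the radii are then
    increasing, satisfy \<open>r k \<ge> N k\<close>, and tend to infinity.\<close>
  define r where "r k = (\<Sum>j\<le>k. \<bar>N j\<bar> + 1)" for k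
  have rN: "r k \<ge> N k" for k
  proof -
    have "\<bar>N k\<bar> + 1 \<le> r k" unfolding r_def by (rule member_le_sum) auto
    then show ?thesis by simp
  qed
  have r_mono: "r k \<le> r (Suc k)" for k by (simp add: r_def)
  have rk: "r k \<ge> real k" for k
  proof -
    have "(\<Sum>j\<le>k. (1::real)) \<le> r k" unfolding r_def by (rule sum_mono) simp
    then show ?thesis by simp
  qed
  define \<phi> where "\<phi> k = T (r k)" for k
  have [measurable]: "\<phi> k \<in> borel_measurable borel" for k by (simp add: \<phi>_def)
  \<comment> \<open>The tails leave room for the weight, as
    \<open>2 ^ k * (1 / 8) ^ k = (1 / 4) ^ k\<close> is still summable. Where the weighted series is
    finite, \<open>\<phi> k \<xi>\<close> converges by
    \<open>convergent_of_weighted_bound\<close>.\<close>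
  have "(\<integral>\<^sup>+\<xi>. (\<Sum>k. ennreal (2 ^ k * (cmod (\<phi> (Suc k) \<xi> - \<phi> k \<xi>))\<^sup>2)) \<partial>lborel)
     = (\<Sum>k. \<integral>\<^sup>+\<xi>. ennreal (2 ^ k * (cmod (\<phi> (Suc k) \<xi> - \<phi> k \<xi>))\<^sup>2) \<partial>lborel)"
    by (rule nn_integral_suminf) measurable
  also have "\<dots> \<le> (\<Sum>k. ennreal (C * (1 / 4) ^ k))"
  proof (intro suminf_le allI)
    fix k
    have "(\<integral>\<^sup>+\<xi>. ennreal (2 ^ k * (cmod (\<phi> (Suc k) \<xi> - \<phi> k \<xi>))\<^sup>2) \<partial>lborel) =
       ennreal (2 ^ k) * (\<integral>\<^sup>+\<xi>. ennreal ((cmod (\<phi> (Suc k) \<xi> - \<phi> k \<xi>))\<^sup>2) \<partial>lborel)"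
      by (simp add: ennreal_mult nn_integral_cmult)
    also have "\<dots> \<le> ennreal (2 ^ k) * ennreal (C * tail (r k))"
      unfolding \<phi>_def by (intro mult_left_mono TTn r_mono) simp
    also have "\<dots> \<le> ennreal (C * (1 / 4) ^ k)"
    proof -
      have "2 ^ k * (C * tail (r k)) \<le> 2 ^ k * (C * (1 / 8) ^ k)"
        using N[OF rN, of k] C by (intro mult_left_mono) auto
      also have "\<dots> = C * (2 * (1 / 8)) ^ k"
        unfolding power_mult_distrib by (simp only: mult_ac)
      also have "\<dots> = C * (1 / 4) ^ k" by simp
      finally show ?thesis using C by (simp add: tail_nonneg ennreal_leI flip: ennreal_mult)
    qed
    finally show "(\<integral>\<^sup>+\<xi>. ennreal (2 ^ k * (cmod (\<phi> (Suc k) \<xi> - \<phi> k \<xi>))\<^sup>2) \<partial>lborel) \<le> ennreal (C * (1 / 4) ^ k)" .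
  qed auto
  also have "\<dots> < \<infinity>"
  proof -
    have "summable (\<lambda>k. C * (1 / 4) ^ k)" by (intro summable_mult summable_geometric) simp
    then show ?thesis using C by (subst suminf_ennreal2) auto
  qed
  finally have fin: "(\<integral>\<^sup>+\<xi>. (\<Sum>k. ennreal (2 ^ k * (cmod (\<phi> (Suc k) \<xi> - \<phi> k \<xi>))\<^sup>2)) \<partial>lborel) \<noteq> \<infinity>"
    by (rule less_imp_neq)
  have conv: "convergent (\<lambda>k. \<phi> k \<xi>)"
    if "(\<Sum>k. ennreal (2 ^ k * (cmod (\<phi> (Suc k) \<xi> - \<phi> k \<xi>))\<^sup>2)) \<noteq> \<infinity>" for \<xi>
  proof -
    define s where "s = (\<Sum>k. ennreal (2 ^ k * (cmod (\<phi> (Suc k) \<xi> - \<phi> k \<xi>))\<^sup>2))"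
    have "2 ^ k * (cmod (\<phi> (Suc k) \<xi> - \<phi> k \<xi>))\<^sup>2 \<le> enn2real s" for k
    proof -
      have "ennreal (2 ^ k * (cmod (\<phi> (Suc k) \<xi> - \<phi> k \<xi>))\<^sup>2) \<le> s"
      proof -
        have "sum (\<lambda>k. ennreal (2 ^ k * (cmod (\<phi> (Suc k) \<xi> - \<phi> k \<xi>))\<^sup>2)) {k} \<le> s"
          unfolding s_def by (rule sum_le_suminf) (rule summableI, simp_all)
        then show ?thesis by (simp only: sum.insert finite.emptyI empty_iff not_False_eq_True sum.empty add_0_right)
      qed
      also have "s = ennreal (enn2real s)" using that by (simp add: s_def top.not_eq_extremum)
      finally show ?thesis by (simp add: ennreal_le_iff)
    qed
    then show ?thesis by (rule convergent_of_weighted_bound)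
  qed
  have "AE \<xi> in lborel. (\<Sum>k. ennreal (2 ^ k * (cmod (\<phi> (Suc k) \<xi> - \<phi> k \<xi>))\<^sup>2)) \<noteq> \<infinity>"
    by (rule nn_integral_PInf_AE[OF _ fin], rule borel_measurable_suminf_order) measurable
  then have AE_conv: "AE \<xi> in lborel. convergent (\<lambda>k. \<phi> k \<xi>)"
    by (rule AE_mp) (rule AE_I2, rule impI, rule conv)
  define F where "F \<xi> = lim (\<lambda>k. \<phi> k \<xi>)" for \<xi>
  have [measurable]: "F \<in> borel_measurable borel" unfolding F_def by measurable
  have Fn: "(\<integral>\<^sup>+\<xi>. ennreal ((cmod (F \<xi> - T R \<xi>))\<^sup>2) \<partial>lborel) \<le> ennreal (C * tail R)" for R
  proof -
    have "(\<integral>\<^sup>+\<xi>. ennreal ((cmod (F \<xi> - T R \<xi>))\<^sup>2) \<partial>lborel) = (\<integral>\<^sup>+\<xi>. liminf (\<lambda>k. ennreal ((cmod (\<phi> k \<xi> - T R \<xi>))\<^sup>2)) \<partial>lborel)"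
    proof (rule nn_integral_cong_AE)
      show "AE \<xi> in lborel. ennreal ((cmod (F \<xi> - T R \<xi>))\<^sup>2) = liminf (\<lambda>k. ennreal ((cmod (\<phi> k \<xi> - T R \<xi>))\<^sup>2))"
        using AE_conv
      proof eventually_elim
        case (elim \<xi>)
        then have "(\<lambda>k. \<phi> k \<xi>) \<longlonglongrightarrow> F \<xi>" by (simp add: F_def convergent_LIMSEQ_iff)
        then have "(\<lambda>k. ennreal ((cmod (\<phi> k \<xi> - T R \<xi>))\<^sup>2)) \<longlonglongrightarrow> ennreal ((cmod (F \<xi> - T R \<xi>))\<^sup>2)"
          by (intro tendsto_intros)
        from lim_imp_Liminf[OF _ this] show ?case by simp
      qed
    qed
    also have "\<dots> \<le> liminf (\<lambda>k. \<integral>\<^sup>+\<xi>. ennreal ((cmod (\<phi> k \<xi> - T R \<xi>))\<^sup>2) \<partial>lborel)"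
      by (rule nn_integral_liminf) measurable
    also have "\<dots> \<le> liminf (\<lambda>k::nat. ennreal (C * tail R))"
    proof (rule Liminf_mono)
      obtain n where n: "real n \<ge> R" using real_arch_simple by blast
      show "\<forall>\<^sub>F k in sequentially. (\<integral>\<^sup>+\<xi>. ennreal ((cmod (\<phi> k \<xi> - T R \<xi>))\<^sup>2) \<partial>lborel) \<le> ennreal (C * tail R)"
        using eventually_ge_at_top[of n]
      proof eventually_elim
        case (elim k)
        then have "R \<le> r k" using n rk[of k] by (meson of_nat_le_iff order_trans)
        then show ?case unfolding \<phi>_def by (rule TTn)
      qed
    qed
    also have "\<dots> = ennreal (C * tail R)" by (simp add: Liminf_const)
    finally show ?thesis .
  qed
  have FT: "integrable lborel (\<lambda>\<xi>. (cmod (F \<xi> - T R \<xi>))\<^sup>2)" for R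
    using order_le_less_trans[OF Fn[of R] ennreal_less_top] by (intro integrableI_bounded) auto
  have FTl: "(LINT \<xi>|lborel. (cmod (F \<xi> - T R \<xi>))\<^sup>2) \<le> C * tail R" for R
    using Fn[of R] FT[of R] C tail_nonneg[of R] by (subst (asm) nn_integral_eq_integral) (auto simp: ennreal_le_iff)
  show thesis
  proof (rule that)
    have "sq_integrable (\<lambda>\<xi>. F \<xi> - T 0 \<xi>)" unfolding sq_integrable_def using FT by auto
    moreover have "sq_integrable (\<lambda>\<xi>. - T 0 \<xi>)"
      using plancherel_L1_L2(1)[OF t, of 0] unfolding T_def sq_integrable_def by auto
    ultimately show "sq_integrable F" using sq_integrable_diff by fastforce
    show "((\<lambda>R. LINT \<xi>|lborel. (cmod (F \<xi> - fourier (\<lambda>x. indicator (ball 0 R) x * h x) \<xi>))\<^sup>2) \<longlongrightarrow> 0) at_top"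
    proof (rule tendsto_sandwich[where f = "\<lambda>_. 0"])
      show "((\<lambda>R. C * tail R) \<longlongrightarrow> 0) at_top" using tendsto_mult_right_zero[OF tail_lim] .
    qed (use FTl in \<open>auto simp: T_def t_def[abs_def]\<close>)
  qed
qed

section \<open>From Lebesgue measurable functions to Borel representatives\<close>

lemma AE_lborel_imp_lebesgue: "AE x in lborel. P x \<Longrightarrow> AE x in lebesgue. P x"
  by (rule AE_completion)

lemma is_L2_imp_borel_version:
  fixes f :: "real^'n \<Rightarrow> complex"
  assumes "is_L2 f"
  obtains g where "sq_integrable g" "AE x in lborel. f x = g x"
proof -
  have f: "f \<in> borel_measurable lebesgue" "integrable lebesgue (\<lambda>x. (cmod (f x))\<^sup>2)"
    using assms by (auto simp: is_L2_def)
  have "(\<lambda>x. Re (f x)) \<in> borel_measurable lebesgue" "(\<lambda>x. Im (f x)) \<in> borel_measurable lebesgue"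
    using f(1) by auto
  from this[THEN completion_ex_borel_measurable_real]
  obtain a b where ab: "a \<in> borel_measurable lborel" "AE x in lborel. Re (f x) = a x"
    "b \<in> borel_measurable lborel" "AE x in lborel. Im (f x) = b x"
    by (elim bexE) rule
  define g where "g x = Complex (a x) (b x)" for x
  have g: "g \<in> borel_measurable borel"
    unfolding g_def Complex_eq using ab by auto
  have ae: "AE x in lborel. f x = g x"
    using ab(2,4) by eventually_elim (simp add: g_def complex_eq_iff)
  have "integrable lebesgue (\<lambda>x. (cmod (g x))\<^sup>2)"
  proof (rule integrable_cong_AE_imp[OF f(2)])
    show "(\<lambda>x. (cmod (g x))\<^sup>2) \<in> borel_measurable lebesgue"
      using g by (intro measurable_completion) auto
    show "AE x in lebesgue. (cmod (f x))\<^sup>2 = (cmod (g x))\<^sup>2"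
      using AE_lborel_imp_lebesgue[OF ae] by eventually_elim simp
  qed
  then have "integrable lborel (\<lambda>x. (cmod (g x))\<^sup>2)"
    using g by (subst (asm) integrable_completion) auto
  then show thesis using g ae that by (auto simp: sq_integrable_def)
qed

lemma ft_eq_fourier:
  fixes f g :: "real^'n \<Rightarrow> complex"
  assumes f: "f \<in> borel_measurable lebesgue" and [measurable]: "g \<in> borel_measurable borel"
    and ae: "AE x in lborel. f x = g x"
  shows "ft f = fourier g"
proof
  fix \<xi> :: "real^'n"
  let ?e = "\<lambda>x. exp (- \<i> * complex_of_real (x \<bullet> \<xi>))"
  have [measurable]: "?e \<in> borel_measurable lebesgue" by (intro measurable_completion) auto
  have "ft f \<xi> = (LINT x|lebesgue. g x * ?e x)"
    unfolding ft_def
  proof (rule integral_cong_AE)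
    show "(\<lambda>x. f x * ?e x) \<in> borel_measurable lebesgue" using f by measurable
    show "(\<lambda>x. g x * ?e x) \<in> borel_measurable lebesgue" by (intro measurable_completion) auto
    show "AE x in lebesgue. f x * ?e x = g x * ?e x"
      using AE_lborel_imp_lebesgue[OF ae] by eventually_elim simp
  qed
  also have "\<dots> = fourier g \<xi>"
    unfolding fourier_def by (rule integral_completion) measurable
  finally show "ft f \<xi> = fourier g \<xi>" .
qed

text \<open>\<open>L2_ft\<close> is a choice, so some transform has to be exhibited before anything
  is known about the chosen one. The limit \<open>F\<close> of the truncated transforms of a Borel
  representative serves as the witness.\<close>

lemma is_L2_L2_ft:
  fixes f :: "real^'n \<Rightarrow> complex"
  assumes f: "is_L2 f"
  shows "is_L2 (L2_ft f)"
proof -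
  obtain g where g: "sq_integrable g" and ae: "AE x in lborel. f x = g x"
    using is_L2_imp_borel_version[OF f] .
  obtain F where F: "sq_integrable F"
    "((\<lambda>R. LINT \<xi>|lborel. (cmod (F \<xi> - fourier (\<lambda>x. indicator (ball 0 R) x * g x) \<xi>))\<^sup>2) \<longlongrightarrow> 0) at_top"
    using fourier_truncations_converge[OF g] .
  have [measurable]: "g \<in> borel_measurable borel" "F \<in> borel_measurable borel" using g F by measurable
  have ib: "(\<lambda>x::real^'n. indicator (ball 0 R) x :: complex) \<in> borel_measurable borel" for R
    by (auto intro: borel_measurable_indicator)
  have ig: "(\<lambda>x. indicator (ball 0 R) x * g x) \<in> borel_measurable borel" for R
    by (intro borel_measurable_times ib) measurable
  note [measurable] = fourier_measurable[OF ig]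
  have "is_L2_fourier f F"
    unfolding is_L2_fourier_def
  proof
    show "is_L2 F"
      unfolding is_L2_def using sq_integrableD[OF F(1)]
      by (auto intro: measurable_completion simp: integrable_completion)
    have "ft (\<lambda>x. indicator (ball 0 R) x * f x) = fourier (\<lambda>x. indicator (ball 0 R) x * g x)" for R
    proof (rule ft_eq_fourier)
      have "(\<lambda>x::real^'n. indicator (ball 0 R) x :: complex) \<in> borel_measurable lebesgue"
        using ib by (intro measurable_completion) simp
      then show "(\<lambda>x. indicator (ball 0 R) x * f x) \<in> borel_measurable lebesgue"
        using f unfolding is_L2_def by (intro borel_measurable_times) auto
      show "(\<lambda>x. indicator (ball 0 R) x * g x) \<in> borel_measurable borel"
        by (rule ig)
      show "AE x in lborel. indicator (ball 0 R) x * f x = indicator (ball 0 R) x * g x"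
        using ae by eventually_elim simp
    qed
    moreover have "(LINT \<xi>|lebesgue. (cmod (F \<xi> - fourier (\<lambda>x. indicator (ball 0 R) x * g x) \<xi>))\<^sup>2) =
      (LINT \<xi>|lborel. (cmod (F \<xi> - fourier (\<lambda>x. indicator (ball 0 R) x * g x) \<xi>))\<^sup>2)" for R
      by (intro integral_completion) measurable
    ultimately show "((\<lambda>R. LINT \<xi>|lebesgue. (cmod (F \<xi> - ft (\<lambda>x. indicator (ball 0 R) x * f x) \<xi>))\<^sup>2) \<longlongrightarrow> 0) at_top"
      using F(2) by simp
  qed
  then have "is_L2_fourier f (L2_ft f)" unfolding L2_ft_def by (rule someI[where P = "is_L2_fourier f"])
  then show ?thesis by (simp add: is_L2_fourier_def)
qed

section \<open>Shears and reflections\<close>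

text \<open>\<open>e\<close> is not normalized, so that the map depends measurably on
  \<open>e\<close> and only on the line spanned by it. For \<open>e = 0\<close> the formula gives
  the identity, hence the isometry lemmas hold for all \<open>e\<close>.\<close>

definition reflect :: "'a::euclidean_space \<Rightarrow> 'a \<Rightarrow> 'a" where
  "reflect e z = z - (2 * (z \<bullet> e) / (e \<bullet> e)) *\<^sub>R e"

lemma reflect_measurable [measurable]:
  assumes [measurable]: "f \<in> borel_measurable M" "g \<in> borel_measurable M"
  shows "(\<lambda>x. reflect (f x) (g x)) \<in> borel_measurable M"
  unfolding reflect_def by measurable

lemma reflect_reflect: "reflect e (reflect e z) = z"
  by (cases "e = 0") (simp_all add: reflect_def algebra_simps flip: scaleR_left_distrib)

lemma norm_reflect: "norm (reflect e z) = norm z"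
proof (cases "e = 0")
  case False
  have "(norm (reflect e z))\<^sup>2 = (norm z)\<^sup>2"
    unfolding power2_norm_eq_inner reflect_def using False
    by (simp add: inner_diff_left inner_diff_right inner_commute field_simps)
  then show ?thesis by simp
qed (simp add: reflect_def)

lemma linear_reflect: "linear (reflect e)"
  by (rule linearI) (simp_all add: reflect_def algebra_simps inner_add_left add_divide_distrib)

lemma lborel_distr_reflect: "distr lborel borel (reflect e) = lborel"
  by (rule lborel_distr_isometric_involution[OF linear_reflect reflect_reflect norm_reflect])

lemma nn_integral_reflect:
  assumes [measurable]: "f \<in> borel_measurable borel"
  shows "(\<integral>\<^sup>+z. f (reflect e z) \<partial>lborel) = (\<integral>\<^sup>+z. f z \<partial>lborel)"
  by (subst (2) lborel_distr_reflect[of e, symmetric]) (simp add: nn_integral_distr)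

lemma integral_reflect:
  fixes f :: "'a::euclidean_space \<Rightarrow> 'b::{banach, second_countable_topology}"
  assumes [measurable]: "f \<in> borel_measurable borel"
  shows "(LINT z|lborel. f (reflect e z)) = (LINT z|lborel. f z)"
  by (subst (2) lborel_distr_reflect[of e, symmetric]) (simp add: integral_distr)

lemma integrable_reflect:
  fixes f :: "'a::euclidean_space \<Rightarrow> 'b::{banach, second_countable_topology}"
  assumes f: "integrable lborel f"
  shows "integrable lborel (\<lambda>z. f (reflect e z))"
proof -
  have [measurable]: "f \<in> borel_measurable borel" using f by auto
  show ?thesis
    using f by (subst (asm) lborel_distr_reflect[of e, symmetric]) (simp add: integrable_distr_eq)
qed

lemma sq_integrable_reflect: "sq_integrable P \<Longrightarrow> sq_integrable (\<lambda>z. P (reflect e z))"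
  unfolding sq_integrable_def using integrable_reflect[of "\<lambda>z. (cmod (P z))\<^sup>2" e] by auto

text \<open>The product of the two values of \<open>P\<close> is at most the sum of their squares.
  Reflection and translation preserve the \<open>z\<close>-integral of either square, and the
  Gaussian is integrable in \<open>y\<close>.\<close>

lemma reflect_correlation_integrable:
  fixes P :: "'a::euclidean_space \<Rightarrow> complex"
  assumes P: "sq_integrable P" and e: "\<epsilon> > 0"
  shows "integrable (lborel \<Otimes>\<^sub>M lborel) (\<lambda>(y::real, z). P z * cnj (P (reflect e z + (y * c) *\<^sub>R e)) * gauss \<epsilon> y)"
    (is "integrable _ ?K")
proof (rule integrableI_bounded)
  have [measurable]: "P \<in> borel_measurable borel" using P by measurable
  show "?K \<in> borel_measurable (lborel \<Otimes>\<^sub>M lborel)" by measurable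
  let ?N = "\<integral>\<^sup>+z. ennreal ((cmod (P z))\<^sup>2) \<partial>lborel"
  have N: "?N < \<infinity>" using sq_integrableD[OF P] by (simp add: integrable_iff_bounded)
  have "(\<integral>\<^sup>+p. ennreal (norm (?K p)) \<partial>(lborel \<Otimes>\<^sub>M lborel)) = (\<integral>\<^sup>+y. \<integral>\<^sup>+z. ennreal (norm (?K (y, z))) \<partial>lborel \<partial>lborel)"
    by (rule lborel.nn_integral_fst[symmetric]) measurable
  also have "\<dots> \<le> (\<integral>\<^sup>+y. \<integral>\<^sup>+z. (ennreal ((cmod (P z))\<^sup>2) + ennreal ((cmod (P (reflect e z + (y * c) *\<^sub>R e)))\<^sup>2)) * ennreal (gauss \<epsilon> y) \<partial>lborel \<partial>lborel)"
  proof (intro nn_integral_mono)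
    fix y :: real and z :: 'a
    let ?a = "cmod (P z)" and ?b = "cmod (P (reflect e z + (y * c) *\<^sub>R e))"
    have "?a * ?b \<le> ?a\<^sup>2 + ?b\<^sup>2" by (rule order_trans[OF mult_le_half_sum_squares]) simp
    then have "?a * ?b * gauss \<epsilon> y \<le> (?a\<^sup>2 + ?b\<^sup>2) * gauss \<epsilon> y" by (intro mult_right_mono gauss_nonneg)
    then show "ennreal (norm (?K (y, z))) \<le> (ennreal (?a\<^sup>2) + ennreal (?b\<^sup>2)) * ennreal (gauss \<epsilon> y)"
      by (simp add: norm_mult gauss_nonneg ennreal_leI flip: ennreal_plus ennreal_mult)
  qed
  also have "\<dots> = (\<integral>\<^sup>+y. (?N + (\<integral>\<^sup>+z. ennreal ((cmod (P (reflect e z + (y * c) *\<^sub>R e)))\<^sup>2) \<partial>lborel)) * ennreal (gauss \<epsilon> y) \<partial>lborel)"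
    by (simp add: nn_integral_multc nn_integral_add)
  also have "\<dots> = (\<integral>\<^sup>+y. (?N + ?N) * ennreal (gauss \<epsilon> (y::real)) \<partial>lborel)"
  proof -
    have "(\<integral>\<^sup>+z. ennreal ((cmod (P (reflect e z + w)))\<^sup>2) \<partial>lborel) = ?N" for w
    proof -
      have "(\<integral>\<^sup>+z. ennreal ((cmod (P (reflect e z + w)))\<^sup>2) \<partial>lborel) = (\<integral>\<^sup>+z. ennreal ((cmod (P (w + z)))\<^sup>2) \<partial>lborel)"
        using nn_integral_reflect[of "\<lambda>z. ennreal ((cmod (P (w + z)))\<^sup>2)" e] by (simp add: add.commute)
      also have "\<dots> = ?N" by (rule nn_integral_lborel_translation) measurable
      finally show ?thesis .
    qed
    then show ?thesis by (simp only:)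
  qed
  also have "\<dots> = (?N + ?N) * (\<integral>\<^sup>+y. ennreal (gauss \<epsilon> (y::real)) \<partial>lborel)"
    by (simp add: nn_integral_cmult)
  also have "\<dots> < \<infinity>"
    using N integral_gauss(1)[OF e, where 'a=real]
    by (simp add: integrable_iff_bounded ennreal_mult_less_top gauss_nonneg abs_of_nonneg)
  finally show "(\<integral>\<^sup>+p. ennreal (norm (?K p)) \<partial>(lborel \<Otimes>\<^sub>M lborel)) < \<infinity>" .
qed

text \<open>Change of variables for \<open>shear_correlation\<close>: \<open>\<rho>\<close> is
  solved for so that the argument of the Gaussian becomes the new variable \<open>y\<close>. The
  sheared point then differs from the reflection of \<open>z\<close> by a multiple of
  \<open>y\<close>.\<close>

lemma shear_reflect:
  fixes e z :: "'a::euclidean_space"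
  assumes "e \<noteq> 0"
  defines "E \<equiv> e \<bullet> e"
  shows "z - (2 * (z \<bullet> e) / E + (- 1 / E) * y) *\<^sub>R e = reflect e z + (y * (1 / E)) *\<^sub>R e"
    and "2 * (z \<bullet> e) - (2 * (z \<bullet> e) / E + (- 1 / E) * y) * E = y"
  using assms by (simp_all add: reflect_def algebra_simps)

text \<open>As \<open>\<epsilon> \<rightarrow> 0\<close> the Gaussian forces \<open>\<rho> = 2 (z \<bullet> e) / (e \<bullet> e)\<close>, so that \<open>z - \<rho> e\<close> becomes the
  reflection of \<open>z\<close>.\<close>
lemma shear_correlation:
  fixes P :: "'a::euclidean_space \<Rightarrow> complex"
  assumes P: "sq_integrable P" and e: "e \<noteq> 0"
  defines "K \<equiv> \<lambda>n \<rho> z. P z * cnj (P (z - \<rho> *\<^sub>R e)) * gauss (1 / Suc n) (2 * (z \<bullet> e) - \<rho> * (e \<bullet> e))"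
  shows "integrable (lborel \<Otimes>\<^sub>M lborel) (\<lambda>(\<rho>, z). K n \<rho> z)"
    and "(\<lambda>n. LINT \<rho>|lborel. LINT z|lborel. K n \<rho> z) \<longlonglongrightarrow>
      2 * pi / (e \<bullet> e) * (LINT z|lborel. P z * cnj (P (reflect e z)))"
proof -
  have [measurable]: "P \<in> borel_measurable borel" using P by measurable
  have [measurable]: "(\<lambda>(\<rho>, z). K n \<rho> z) \<in> borel_measurable (lborel \<Otimes>\<^sub>M lborel)" for n
    unfolding K_def by measurable
  define E where "E = e \<bullet> e"
  have E: "E > 0" using e by (simp add: E_def)
  define K' where "K' n y z = P z * cnj (P (reflect e z + (y * (1 / E)) *\<^sub>R e)) * gauss (1 / Suc n) y" for n and y :: real and z
  have K': "integrable (lborel \<Otimes>\<^sub>M lborel) (\<lambda>(y, z). K' n y z)" for n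
    unfolding K'_def using reflect_correlation_integrable[OF P, of "1 / Suc n" e "1 / E"] by simp
  then have [measurable]: "(\<lambda>(y, z). K' n y z) \<in> borel_measurable (lborel \<Otimes>\<^sub>M lborel)" for n by auto
  have mK: "(\<lambda>p. ennreal (norm (case p of (\<rho>, z) \<Rightarrow> K n \<rho> z))) \<in> borel_measurable (lborel \<Otimes>\<^sub>M lborel)" for n
    unfolding K_def by measurable
  have mK': "(\<lambda>p. ennreal (norm (case p of (y, z) \<Rightarrow> K' n y z))) \<in> borel_measurable (lborel \<Otimes>\<^sub>M lborel)" for n
    unfolding K'_def by measurable
  have [measurable]: "(\<lambda>z. \<integral>\<^sup>+y. ennreal (norm (K' n y z)) \<partial>lborel) \<in> borel_measurable borel" for n
    unfolding K'_def by measurable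
  have KK': "K n (2 * (z \<bullet> e) / E + (- 1 / E) * y) z = K' n y z" for n y z
    using shear_reflect[OF e, folded E_def] unfolding K_def K'_def E_def[symmetric] by (simp only:)
  show K: "integrable (lborel \<Otimes>\<^sub>M lborel) (\<lambda>(\<rho>, z). K n \<rho> z)" for n
  proof (rule integrableI_bounded)
    have "(\<integral>\<^sup>+p. ennreal (norm (case p of (\<rho>, z) \<Rightarrow> K n \<rho> z)) \<partial>(lborel \<Otimes>\<^sub>M lborel)) = (\<integral>\<^sup>+z. \<integral>\<^sup>+\<rho>. ennreal (norm (K n \<rho> z)) \<partial>lborel \<partial>lborel)"
      using lborel_pair.nn_integral_snd[OF mK[of n]] by simp
    also have "\<dots> = (\<integral>\<^sup>+z. ennreal (1 / E) * (\<integral>\<^sup>+y. ennreal (norm (K' n y z)) \<partial>lborel) \<partial>lborel)"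
    proof (rule nn_integral_cong)
      fix z :: 'a
      have "(\<integral>\<^sup>+\<rho>. ennreal (norm (K n \<rho> z)) \<partial>lborel) = ennreal \<bar>- 1 / E\<bar> * (\<integral>\<^sup>+y. ennreal (norm (K n (2 * (z \<bullet> e) / E + (- 1 / E) * y) z)) \<partial>lborel)"
        by (rule nn_integral_real_affine) (use E in \<open>simp_all add: K_def\<close>)
      then show "(\<integral>\<^sup>+\<rho>. ennreal (norm (K n \<rho> z)) \<partial>lborel) = ennreal (1 / E) * (\<integral>\<^sup>+y. ennreal (norm (K' n y z)) \<partial>lborel)"
        using E by (simp only: KK') simp
    qed
    also have "\<dots> = ennreal (1 / E) * (\<integral>\<^sup>+p. ennreal (norm (case p of (y, z) \<Rightarrow> K' n y z)) \<partial>(lborel \<Otimes>\<^sub>M lborel))"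
      using lborel_pair.nn_integral_snd[OF mK'[of n]] by (simp add: nn_integral_cmult)
    also have "\<dots> < \<infinity>"
      using K'[of n] by (simp add: integrable_iff_bounded ennreal_mult_less_top)
    finally show "(\<integral>\<^sup>+p. ennreal (norm (case p of (\<rho>, z) \<Rightarrow> K n \<rho> z)) \<partial>(lborel \<Otimes>\<^sub>M lborel)) < \<infinity>" .
  qed measurable
  \<comment> \<open>Substituting \<open>reflect e w\<close> for \<open>z\<close> moves the
    reflection to the unconjugated factor, so what multiplies the Gaussian is a correlation along
    \<open>e\<close>, bounded and continuous at 0. The factor \<open>1 / E\<close> in
    \<open>eq\<close> is the Jacobian of the change from \<open>\<rho>\<close> to
    \<open>y\<close>.\<close>
  define B where "B y = correlation (\<lambda>w. P (reflect e w)) P ((y * (1 / E)) *\<^sub>R e)" for y :: real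
  note PT = sq_integrable_reflect[OF P, of e]
  have eq: "(LINT \<rho>|lborel. LINT z|lborel. K n \<rho> z) = (1 / E) * (LINT y|lborel. gauss (1 / Suc n) y * B y)" for n
  proof -
    have "(LINT \<rho>|lborel. LINT z|lborel. K n \<rho> z) = (LINT z|lborel. LINT \<rho>|lborel. K n \<rho> z)"
      using lborel_pair.Fubini_integral[OF K[of n]] by simp
    also have "\<dots> = (LINT z|lborel. (1 / E) * (LINT y|lborel. K' n y z))"
    proof (rule Bochner_Integration.integral_cong[OF refl])
      fix z :: 'a
      have "(LINT \<rho>|lborel. K n \<rho> z) = \<bar>- 1 / E\<bar> *\<^sub>R (LINT y|lborel. K n (2 * (z \<bullet> e) / E + (- 1 / E) * y) z)"
        by (rule lborel_integral_real_affine) (use E in simp)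
      then show "(LINT \<rho>|lborel. K n \<rho> z) = (1 / E) * (LINT y|lborel. K' n y z)"
        using E by (simp only: KK') (simp add: scaleR_conv_of_real)
    qed
    also have "\<dots> = (1 / E) * (LINT z|lborel. LINT y|lborel. K' n y z)" by simp
    also have "(LINT z|lborel. LINT y|lborel. K' n y z) = (LINT y|lborel. LINT z|lborel. K' n y z)"
      using lborel_pair.Fubini_integral[OF K'[of n]] by simp
    also have "\<dots> = (LINT y|lborel. gauss (1 / Suc n) y * B y)"
    proof (rule Bochner_Integration.integral_cong[OF refl])
      fix y :: real
      have "(LINT z|lborel. K' n y z) = (LINT w|lborel. K' n y (reflect e w))"
        by (rule integral_reflect[symmetric]) (simp add: K'_def)
      also have "\<dots> = gauss (1 / Suc n) y * B y"
        unfolding K'_def B_def correlation_def by (simp add: reflect_reflect add.commute mult.commute)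
      finally show "(LINT z|lborel. K' n y z) = gauss (1 / Suc n) y * B y" .
    qed
    finally show ?thesis .
  qed
  have "(\<lambda>n. LINT y|lborel. gauss (1 / Suc n) y * B y) \<longlonglongrightarrow> (2 * pi) ^ DIM(real) * B 0"
  proof (rule gauss_approximate_identity)
    show "B \<in> borel_measurable borel" unfolding B_def by measurable
    show "cmod (B y) \<le> ((LINT x|lborel. (cmod (P (reflect e x)))\<^sup>2) + (LINT x|lborel. (cmod (P x))\<^sup>2)) / 2" for y
      unfolding B_def by (rule correlation_bound[OF PT P])
    have "isCont (correlation (\<lambda>w. P (reflect e w)) P) 0"
      using correlation_tendsto[OF PT P] by (simp add: isCont_def)
    moreover have "((\<lambda>y::real. (y * (1 / E)) *\<^sub>R e) \<longlongrightarrow> (0 * (1 / E)) *\<^sub>R e) (at 0)"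
      by (intro tendsto_intros)
    then have "((\<lambda>y::real. (y * (1 / E)) *\<^sub>R e) \<longlongrightarrow> 0) (at 0)" by simp
    ultimately have "((\<lambda>y. correlation (\<lambda>w. P (reflect e w)) P ((y * (1 / E)) *\<^sub>R e)) \<longlongrightarrow> correlation (\<lambda>w. P (reflect e w)) P 0) (at 0)"
      by (rule isCont_tendsto_compose)
    then show "(B \<longlongrightarrow> B 0) (at 0)" by (simp add: B_def[abs_def])
  qed
  from tendsto_mult_left[OF this, of "1 / E"]
  have "(\<lambda>n. LINT \<rho>|lborel. LINT z|lborel. K n \<rho> z) \<longlonglongrightarrow> (1 / E) * ((2 * pi) ^ DIM(real) * B 0)"
    unfolding eq .
  moreover have "B 0 = (LINT z|lborel. P z * cnj (P (reflect e z)))"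
    using integral_reflect[of "\<lambda>z. P z * cnj (P (reflect e z))" e]
    by (simp add: B_def correlation_def reflect_reflect)
  ultimately show "(\<lambda>n. LINT \<rho>|lborel. LINT z|lborel. K n \<rho> z) \<longlonglongrightarrow>
      2 * pi / (e \<bullet> e) * (LINT z|lborel. P z * cnj (P (reflect e z)))"
    by (simp add: E_def)
qed

section \<open>The ambiguity function\<close>

lemma sq_integrable_tensor:
  fixes G :: "'a::euclidean_space \<Rightarrow> complex"
  assumes G: "sq_integrable G"
  shows "sq_integrable (\<lambda>z. G (fst z) * G (snd z))"
    and "(LINT z|lborel. (cmod (G (fst z) * G (snd z)))\<^sup>2) = (LINT x|lborel. (cmod (G x))\<^sup>2)\<^sup>2"
proof -
  have [measurable]: "G \<in> borel_measurable borel" using G by measurable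
  have i: "integrable lborel (\<lambda>x. complex_of_real ((cmod (G x))\<^sup>2))"
    using sq_integrableD[OF G] by (rule integrable_of_real)
  note ip = integrable_pair_mult[OF i i]
  have eq: "(case z of (x, y) \<Rightarrow> complex_of_real ((cmod (G x))\<^sup>2) * complex_of_real ((cmod (G y))\<^sup>2)) =
     complex_of_real ((cmod (G (fst z) * G (snd z)))\<^sup>2)" for z
    by (simp add: case_prod_unfold norm_mult power_mult_distrib)
  have "integrable lborel (\<lambda>z. complex_of_real ((cmod (G (fst z) * G (snd z)))\<^sup>2))"
    using ip unfolding lborel_prod eq .
  then show "sq_integrable (\<lambda>z. G (fst z) * G (snd z))"
    unfolding sq_integrable_def by (simp only: complex_of_real_integrable_eq) measurable
  have "complex_of_real (LINT z|lborel. (cmod (G (fst z) * G (snd z)))\<^sup>2) =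
     (LINT x|lborel. LINT y|lborel. complex_of_real ((cmod (G x))\<^sup>2) * complex_of_real ((cmod (G y))\<^sup>2))"
    using lborel_pair.integral_fst[OF ip] unfolding lborel_prod eq integral_complex_of_real by simp
  also have "\<dots> = complex_of_real ((LINT x|lborel. (cmod (G x))\<^sup>2)\<^sup>2)"
    unfolding integral_mult_right_zero integral_mult_left_zero integral_complex_of_real
    by (simp only: power2_eq_square of_real_mult)
  finally show "(LINT z|lborel. (cmod (G (fst z) * G (snd z)))\<^sup>2) = (LINT x|lborel. (cmod (G x))\<^sup>2)\<^sup>2"
    by (simp only: of_real_eq_iff)
qed

text \<open>For \<open>\<rho> = 1\<close> and \<open>v = \<zeta>\<close> this is, up to a factor of
  modulus one, the correlation of the evolved data at times \<open>s\<close>: the phase is what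
  remains of \<open>|\<xi>|^2 - |\<xi> - \<zeta>|^2 = 2 (\<xi> \<bullet> \<zeta>) -
  |\<zeta>|^2\<close> without the constant. The length \<open>\<rho>\<close> has its own argument
  and does not enter the phase, so that for \<open>\<zeta> = \<rho> v\<close> it can be absorbed by
  rescaling \<open>s\<close>.\<close>

definition ambiguity :: "('a::euclidean_space \<Rightarrow> complex) \<Rightarrow> 'a \<Rightarrow> real \<Rightarrow> real \<Rightarrow> complex" where
  "ambiguity G v \<rho> s = (LINT \<xi>|lborel. G \<xi> * cnj (G (\<xi> - \<rho> *\<^sub>R v)) * exp (- \<i> * complex_of_real (s * (2 * (\<xi> \<bullet> v)))))"

lemma ambiguity_measurable [measurable]:
  assumes [measurable]: "G \<in> borel_measurable borel" "f \<in> borel_measurable M" "g \<in> borel_measurable M" "h \<in> borel_measurable M"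
  shows "(\<lambda>x. ambiguity G (f x) (g x) (h x)) \<in> borel_measurable M"
  unfolding ambiguity_def by measurable

lemma ambiguity_shear_integrable:
  assumes "sq_integrable G"
  shows "integrable lborel (\<lambda>\<xi>. G \<xi> * cnj (G (\<xi> - w)))"
  using sq_integrable_mult[OF assms sq_integrable_cnj[OF sq_integrable_translation[OF assms, of "- w"]]] by simp

text \<open>Squaring doubles the variable, and the \<open>s\<close>-integral turns the phase into
  \<open>gauss\<close> of the difference of \<open>2 * (\<xi> \<bullet> v)\<close> at the two
  points. This is a smeared version of the condition that both lie in one hyperplane orthogonal to
  \<open>v\<close>.\<close>

lemma ambiguity_regularized:
  fixes G :: "'a::euclidean_space \<Rightarrow> complex" and v :: 'a and \<rho> :: real
  assumes G: "sq_integrable G" and \<epsilon>: "\<epsilon> > 0"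
  defines "P \<equiv> \<lambda>z. G (fst z) * G (snd z)" and "e \<equiv> (v, - v)"
  shows "integrable lborel (\<lambda>s. exp (- \<epsilon> * s\<^sup>2) * (cmod (ambiguity G v \<rho> s))\<^sup>2)"
    and "complex_of_real (LINT s|lborel. exp (- \<epsilon> * s\<^sup>2) * (cmod (ambiguity G v \<rho> s))\<^sup>2) =
      (LINT z|lborel. P z * cnj (P (z - \<rho> *\<^sub>R e)) * gauss \<epsilon> (2 * (z \<bullet> e) - \<rho> * (e \<bullet> e)))"
proof -
  have [measurable]: "G \<in> borel_measurable borel" using G by measurable
  define h where "h \<xi> = G \<xi> * cnj (G (\<xi> - \<rho> *\<^sub>R v))" for \<xi>
  have h: "integrable lborel h"
    unfolding h_def[abs_def] by (rule ambiguity_shear_integrable[OF G])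
  have [measurable]: "h \<in> borel_measurable borel" using h by auto
  have bound: "cmod (ambiguity G v \<rho> s) \<le> (LINT \<xi>|lborel. cmod (h \<xi>))" for s
  proof -
    have "cmod (ambiguity G v \<rho> s) \<le> (LINT \<xi>|lborel. cmod (h \<xi> * exp (- \<i> * complex_of_real (s * (2 * (\<xi> \<bullet> v))))))"
      unfolding ambiguity_def h_def by (rule integral_norm_bound)
    then show ?thesis by (simp add: norm_mult)
  qed
  show "integrable lborel (\<lambda>s. exp (- \<epsilon> * s\<^sup>2) * (cmod (ambiguity G v \<rho> s))\<^sup>2)"
  proof (rule Bochner_Integration.integrable_bound)
    show "integrable lborel (\<lambda>s::real. exp (- \<epsilon> * (norm s)\<^sup>2) * (LINT \<xi>|lborel. cmod (h \<xi>))\<^sup>2)"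
      by (intro integrable_mult_left integrable_gaussian[OF \<epsilon>])
    show "AE s in lborel. norm (exp (- \<epsilon> * s\<^sup>2) * (cmod (ambiguity G v \<rho> s))\<^sup>2) \<le> norm (exp (- \<epsilon> * (norm s)\<^sup>2) * (LINT \<xi>|lborel. cmod (h \<xi>))\<^sup>2)"
      using bound by (intro AE_I2) (auto simp: abs_mult intro!: mult_left_mono power_mono)
  qed measurable
  define \<phi> where "\<phi> z = h (fst z) * cnj (h (snd z))" for z
  have \<phi>: "integrable lborel \<phi>"
    using integrable_pair_mult[OF h, of "\<lambda>x. cnj (h x)"] h unfolding lborel_prod
    by (simp add: \<phi>_def[abs_def] case_prod_unfold)
  have [measurable]: "\<phi> \<in> borel_measurable borel" using \<phi> by auto
  define \<theta> where "\<theta> z = 2 * (fst z \<bullet> v) - 2 * (snd z \<bullet> v)" for z :: "'a \<times> 'a"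
  have [measurable]: "\<theta> \<in> borel_measurable borel" unfolding \<theta>_def by measurable
  have sq: "complex_of_real ((cmod (ambiguity G v \<rho> s))\<^sup>2) = (LINT z|lborel. \<phi> z * exp (- \<i> * (s \<bullet> \<theta> z)))" for s
  proof -
    have "complex_of_real ((cmod (ambiguity G v \<rho> s))\<^sup>2) = ambiguity G v \<rho> s * cnj (ambiguity G v \<rho> s)"
      by (rule complex_norm_square[unfolded of_real_power[symmetric]])
    also have "\<dots> = (LINT z|lborel. \<phi> z * exp (- \<i> * complex_of_real (s * (2 * (fst z \<bullet> v)) - s * (2 * (snd z \<bullet> v)))))"
      unfolding ambiguity_def h_def[symmetric] \<phi>_def
      by (rule integral_oscillation_mult_cnj[OF h h]) measurable
    finally show ?thesis
      by (simp only: \<theta>_def inner_real_def right_diff_distrib)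
  qed
  have "complex_of_real (LINT s|lborel. exp (- \<epsilon> * s\<^sup>2) * (cmod (ambiguity G v \<rho> s))\<^sup>2) =
     (LINT s|lborel. exp (- \<epsilon> * (norm s)\<^sup>2) * (LINT z|lborel. \<phi> z * exp (- \<i> * (s \<bullet> \<theta> z))))"
    unfolding integral_complex_of_real[symmetric] of_real_mult sq by simp
  also have "\<dots> = (LINT z|lborel. \<phi> z * gauss \<epsilon> (\<theta> z))"
    by (rule integral_oscillation_gaussian[OF \<phi> _ \<epsilon>]) measurable
  \<comment> \<open>Shifting the second variable by \<open>\<rho> *\<^sub>R v\<close> regroups the
    four values of \<open>G\<close>: for \<open>z = (a, b)\<close> the unconjugated ones sit at
    \<open>a\<close> and \<open>b\<close>, the conjugated ones at
    \<open>a - \<rho> *\<^sub>R v\<close> and \<open>b + \<rho> *\<^sub>R v\<close>, that is at the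
    components of \<open>z - \<rho> *\<^sub>R e\<close>.\<close>
  also have "\<dots> = (LINT z|lborel. \<phi> ((0, \<rho> *\<^sub>R v) + z) * gauss \<epsilon> (\<theta> ((0, \<rho> *\<^sub>R v) + z)))"
    by (rule integral_lborel_translation[symmetric]) measurable
  also have "\<dots> = (LINT z|lborel. P z * cnj (P (z - \<rho> *\<^sub>R e)) * gauss \<epsilon> (2 * (z \<bullet> e) - \<rho> * (e \<bullet> e)))"
  proof (rule Bochner_Integration.integral_cong[OF refl])
    fix z :: "'a \<times> 'a"
    obtain a b where z: "z = (a, b)" by (cases z)
    have "\<theta> ((0, \<rho> *\<^sub>R v) + z) = 2 * (z \<bullet> e) - \<rho> * (e \<bullet> e)"
      by (simp add: z \<theta>_def e_def inner_add_left algebra_simps)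
    moreover have "\<phi> ((0, \<rho> *\<^sub>R v) + z) = P z * cnj (P (z - \<rho> *\<^sub>R e))"
      by (simp add: z \<phi>_def h_def P_def e_def add.commute mult_ac)
    ultimately show "\<phi> ((0, \<rho> *\<^sub>R v) + z) * gauss \<epsilon> (\<theta> ((0, \<rho> *\<^sub>R v) + z)) = P z * cnj (P (z - \<rho> *\<^sub>R e)) * gauss \<epsilon> (2 * (z \<bullet> e) - \<rho> * (e \<bullet> e))"
      by (simp only:)
  qed
  finally show "complex_of_real (LINT s|lborel. exp (- \<epsilon> * s\<^sup>2) * (cmod (ambiguity G v \<rho> s))\<^sup>2) =
      (LINT z|lborel. P z * cnj (P (z - \<rho> *\<^sub>R e)) * gauss \<epsilon> (2 * (z \<bullet> e) - \<rho> * (e \<bullet> e)))" .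
qed

text \<open>The regularized integrals have two descriptions of their limit: monotone convergence
  yields the left-hand side, possibly infinite beforehand, and \<open>shear_correlation\<close>
  yields the right-hand side. The coefficient is \<open>2 * pi / (e \<bullet> e)\<close> with
  \<open>e \<bullet> e = 2 * (v \<bullet> v)\<close>. \<open>J\<close> is nonnegative since it is a
  positive multiple of a limit of nonnegative numbers.\<close>

lemma nn_integral_ambiguity:
  fixes G :: "'a::euclidean_space \<Rightarrow> complex" and v :: 'a
  assumes G: "sq_integrable G" and v: "v \<noteq> 0"
  defines "P \<equiv> \<lambda>z. G (fst z) * G (snd z)" and "e \<equiv> (v, - v)"
  defines "J \<equiv> Re (LINT z|lborel. P z * cnj (P (reflect e z)))"
  shows "(\<integral>\<^sup>+\<rho>. \<integral>\<^sup>+s. ennreal ((cmod (ambiguity G v \<rho> s))\<^sup>2) \<partial>lborel \<partial>lborel) = ennreal (pi / (v \<bullet> v) * J)"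
    and "J \<ge> 0"
proof -
  have [measurable]: "G \<in> borel_measurable borel" using G by measurable
  have e: "e \<noteq> 0" using v by (simp add: e_def zero_prod_def)
  have ee: "e \<bullet> e = 2 * (v \<bullet> v)" by (simp add: e_def)
  have P: "sq_integrable P" unfolding P_def by (rule sq_integrable_tensor[OF G])
  define f where "f n \<rho> s = exp (- (1 / Suc n) * s\<^sup>2) * (cmod (ambiguity G v \<rho> s))\<^sup>2" for n \<rho> s
  have f_nonneg: "f n \<rho> s \<ge> 0" for n \<rho> s by (simp add: f_def)
  have [measurable]: "(\<lambda>(\<rho>, s). f n \<rho> s) \<in> borel_measurable (lborel \<Otimes>\<^sub>M lborel)" for n
    unfolding f_def by measurable
  define K where "K n \<rho> z = P z * cnj (P (z - \<rho> *\<^sub>R e)) * gauss (1 / Suc n) (2 * (z \<bullet> e) - \<rho> * (e \<bullet> e))" for n \<rho> z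
  note Ki = shear_correlation(1)[OF P e, folded K_def]
  note Kl = shear_correlation(2)[OF P e, folded K_def]
  define Y where "Y n \<rho> = (LINT s|lborel. f n \<rho> s)" for n \<rho>
  have fi: "integrable lborel (f n \<rho>)" for n \<rho>
    unfolding f_def[abs_def] by (rule ambiguity_regularized(1)[OF G]) simp
  have Y: "complex_of_real (Y n \<rho>) = (LINT z|lborel. K n \<rho> z)" for n \<rho>
    unfolding Y_def f_def K_def P_def e_def by (rule ambiguity_regularized(2)[OF G]) simp
  have Y_nonneg: "Y n \<rho> \<ge> 0" for n \<rho> unfolding Y_def using f_nonneg by simp
  have "integrable lborel (\<lambda>\<rho>. complex_of_real (Y n \<rho>))" for n
    unfolding Y using lborel_pair.integrable_fst[OF Ki[of n]] .
  then have Yi: "integrable lborel (Y n)" for n by (simp only: complex_of_real_integrable_eq)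
  have nnY: "(\<integral>\<^sup>+p. ennreal (case p of (\<rho>, s) \<Rightarrow> f n \<rho> s) \<partial>(lborel \<Otimes>\<^sub>M lborel)) = ennreal (LINT \<rho>|lborel. Y n \<rho>)" for n
  proof -
    have "(\<integral>\<^sup>+p. ennreal (case p of (\<rho>, s) \<Rightarrow> f n \<rho> s) \<partial>(lborel \<Otimes>\<^sub>M lborel)) = (\<integral>\<^sup>+\<rho>. \<integral>\<^sup>+s. ennreal (f n \<rho> s) \<partial>lborel \<partial>lborel)"
      by (subst lborel.nn_integral_fst[symmetric]) simp_all
    also have "\<dots> = (\<integral>\<^sup>+\<rho>. ennreal (Y n \<rho>) \<partial>lborel)"
      unfolding Y_def by (intro nn_integral_cong nn_integral_eq_integral fi AE_I2 f_nonneg)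
    also have "\<dots> = ennreal (LINT \<rho>|lborel. Y n \<rho>)"
      by (intro nn_integral_eq_integral Yi AE_I2 Y_nonneg)
    finally show ?thesis .
  qed
  have "(\<lambda>n. complex_of_real (LINT \<rho>|lborel. Y n \<rho>)) \<longlonglongrightarrow> 2 * pi / (e \<bullet> e) * (LINT z|lborel. P z * cnj (P (reflect e z)))"
    using Kl unfolding Y[symmetric] integral_complex_of_real .
  from tendsto_Re[OF this] have Ylim: "(\<lambda>n. LINT \<rho>|lborel. Y n \<rho>) \<longlonglongrightarrow> pi / (v \<bullet> v) * J"
    unfolding ee J_def by simp
  have "(\<lambda>n. \<integral>\<^sup>+p. ennreal (case p of (\<rho>, s) \<Rightarrow> f n \<rho> s) \<partial>(lborel \<Otimes>\<^sub>M lborel)) \<longlonglongrightarrow>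
     (\<integral>\<^sup>+p. ennreal (case p of (\<rho>, s) \<Rightarrow> (cmod (ambiguity G v \<rho> s))\<^sup>2) \<partial>(lborel \<Otimes>\<^sub>M lborel))"
  proof (rule nn_integral_LIMSEQ)
    show "incseq (\<lambda>n p. ennreal (case p of (\<rho>, s) \<Rightarrow> f n \<rho> s))"
    proof (intro monoI le_funI ennreal_leI)
      fix m n :: nat and p :: "real \<times> real" assume "m \<le> n"
      then have "1 / real (Suc n) \<le> 1 / real (Suc m)" by (simp add: field_simps)
      then have "1 / real (Suc n) * (snd p)\<^sup>2 \<le> 1 / real (Suc m) * (snd p)\<^sup>2" by (intro mult_right_mono) simp_all
      then show "(case p of (\<rho>, s) \<Rightarrow> f m \<rho> s) \<le> (case p of (\<rho>, s) \<Rightarrow> f n \<rho> s)"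
        unfolding f_def case_prod_unfold by (intro mult_right_mono) simp_all
    qed
    show "(\<lambda>n. ennreal (case p of (\<rho>, s) \<Rightarrow> f n \<rho> s)) \<longlonglongrightarrow> ennreal (case p of (\<rho>, s) \<Rightarrow> (cmod (ambiguity G v \<rho> s))\<^sup>2)" for p
    proof (intro tendsto_ennrealI)
      show "(\<lambda>n. case p of (\<rho>, s) \<Rightarrow> f n \<rho> s) \<longlonglongrightarrow> (case p of (\<rho>, s) \<Rightarrow> (cmod (ambiguity G v \<rho> s))\<^sup>2)"
        unfolding f_def case_prod_unfold
        using tendsto_mult_right[OF exp_neg_over_Suc_tendsto[of "(snd p)\<^sup>2"], of "(cmod (ambiguity G v (fst p) (snd p)))\<^sup>2"]
        by simp
    qed
  qed measurable
  moreover have "(\<lambda>n. \<integral>\<^sup>+p. ennreal (case p of (\<rho>, s) \<Rightarrow> f n \<rho> s) \<partial>(lborel \<Otimes>\<^sub>M lborel)) \<longlonglongrightarrow> ennreal (pi / (v \<bullet> v) * J)"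
    unfolding nnY by (rule tendsto_ennrealI[OF Ylim])
  ultimately have "(\<integral>\<^sup>+p. ennreal (case p of (\<rho>, s) \<Rightarrow> (cmod (ambiguity G v \<rho> s))\<^sup>2) \<partial>(lborel \<Otimes>\<^sub>M lborel)) = ennreal (pi / (v \<bullet> v) * J)"
    by (rule LIMSEQ_unique)
  then show "(\<integral>\<^sup>+\<rho>. \<integral>\<^sup>+s. ennreal ((cmod (ambiguity G v \<rho> s))\<^sup>2) \<partial>lborel \<partial>lborel) = ennreal (pi / (v \<bullet> v) * J)"
    by (subst (asm) lborel.nn_integral_fst[symmetric]) simp_all
  have "0 \<le> pi / (v \<bullet> v) * J"
    by (rule LIMSEQ_le_const[OF Ylim]) (use Y_nonneg in simp)
  moreover have "0 < pi / (v \<bullet> v)" using v by simp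
  ultimately show "J \<ge> 0" by (metis mult_less_0_iff not_le order_less_imp_le mult_pos_neg)
qed

section \<open>Radial decomposition of the Riesz weight\<close>

lemma inverse_power_two_sided_nn_integral:
  fixes r :: real
  assumes r: "r > 0" and d: "d \<ge> 1"
  shows "(\<integral>\<^sup>+\<rho>. ennreal (indicator {r..} \<bar>\<rho>\<bar> / \<bar>\<rho>\<bar> ^ (d + 1)) \<partial>lborel) = ennreal (2 / (d * r ^ d))"
proof -
  let ?g = "\<lambda>\<rho>. ennreal (1 / \<rho> ^ (d + 1)) * indicator {r..} \<rho>"
  have g: "(\<integral>\<^sup>+\<rho>. ?g \<rho> \<partial>lborel) = ennreal (0 - (- 1 / (d * r ^ d)))"
  proof (rule nn_integral_FTC_atLeast)
    fix x assume "r \<le> x"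
    then have x: "x > 0" using r by simp
    have "((\<lambda>x. (- 1 / d) * inverse (x ^ d)) has_real_derivative
        (- 1 / d) * - (inverse (x ^ d) * (d * x ^ (d - Suc 0)) * inverse (x ^ d))) (at x)"
      using x by (intro DERIV_cmult DERIV_inverse' DERIV_pow) simp
    moreover have "(- 1 / d) * - (inverse (x ^ d) * (d * x ^ (d - Suc 0)) * inverse (x ^ d)) = 1 / x ^ (d + 1)"
      using x d by (cases d) (simp_all add: field_simps del: of_nat_Suc)
    moreover have "(\<lambda>x::real. (- 1 / d) * inverse (x ^ d)) = (\<lambda>x. - 1 / (real d * x ^ d))"
      by (simp add: fun_eq_iff field_simps)
    ultimately show "((\<lambda>x. - 1 / (d * x ^ d)) has_real_derivative 1 / x ^ (d + 1)) (at x)"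
      by (simp only:)
    show "0 \<le> 1 / x ^ (d + 1)" using x by simp
  next
    have "filterlim (\<lambda>x::real. d * x ^ d) at_top at_top"
      using d by (intro filterlim_tendsto_pos_mult_at_top[OF tendsto_const] filterlim_pow_at_top filterlim_ident) auto
    then show "((\<lambda>x::real. - 1 / (d * x ^ d)) \<longlongrightarrow> 0) at_top"
      by (intro real_tendsto_divide_at_top[OF tendsto_const])
  qed measurable
  have "(\<integral>\<^sup>+\<rho>. ennreal (indicator {r..} \<bar>\<rho>\<bar> / \<bar>\<rho>\<bar> ^ (d + 1)) \<partial>lborel) = (\<integral>\<^sup>+\<rho>. ?g \<rho> + ?g (0 + (- 1) * \<rho>) \<partial>lborel)"
    by (intro nn_integral_cong) (use r in \<open>auto simp: indicator_def\<close>)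
  also have "\<dots> = (\<integral>\<^sup>+\<rho>. ?g \<rho> \<partial>lborel) + (\<integral>\<^sup>+\<rho>. ?g (0 + (- 1) * \<rho>) \<partial>lborel)"
    by (rule nn_integral_add) measurable
  also have "(\<integral>\<^sup>+\<rho>. ?g (0 + (- 1) * \<rho>) \<partial>lborel) = (\<integral>\<^sup>+\<rho>. ?g \<rho> \<partial>lborel)"
    by (subst (2) nn_integral_real_affine[where c = "- 1" and t = 0]) simp_all
  also have "(\<integral>\<^sup>+\<rho>. ?g \<rho> \<partial>lborel) + (\<integral>\<^sup>+\<rho>. ?g \<rho> \<partial>lborel) = ennreal (2 / (d * r ^ d))"
    unfolding g using r by (simp flip: ennreal_plus)
  finally show ?thesis .
qed

text \<open>A substitute for polar coordinates: insert
  \<open>1 = (d / 2) \<integral> |\<zeta>|\<^sup>d |\<rho>|\<^bsup>-d-1\<^esup> 1[|\<zeta>| \<le> |\<rho>|] d\<rho>\<close> and rescale \<open>\<zeta> = \<rho> v\<close>.\<close>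
lemma nn_integral_riesz_weight:
  fixes F :: "'a::euclidean_space \<Rightarrow> ennreal"
  assumes [measurable]: "F \<in> borel_measurable borel"
  shows "(\<integral>\<^sup>+\<zeta>. F \<zeta> * ennreal (norm \<zeta> powr (2 - real DIM('a))) \<partial>lborel) =
    ennreal (DIM('a) / 2) * (\<integral>\<^sup>+v. indicator (cball 0 1) v * ennreal ((norm v)\<^sup>2) *
      (\<integral>\<^sup>+\<rho>. ennreal \<bar>\<rho>\<bar> * F (\<rho> *\<^sub>R v) \<partial>lborel) \<partial>lborel)"
proof -
  let ?d = "DIM('a)"
  let ?w = "\<lambda>\<zeta> \<rho>. ennreal ((norm \<zeta>)\<^sup>2) * (ennreal (?d / 2) * ennreal (indicator {norm \<zeta>..} \<bar>\<rho>\<bar> / \<bar>\<rho>\<bar> ^ (?d + 1)))"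
  have [measurable]: "(\<lambda>(\<zeta>::'a, \<rho>::real). indicator {norm \<zeta>..} \<bar>\<rho>\<bar> :: real) \<in> borel_measurable (borel \<Otimes>\<^sub>M borel)"
    unfolding indicator_def atLeast_iff by measurable
  have [measurable]: "cball (0::'a) 1 \<in> sets borel" by simp
  have w: "ennreal (norm \<zeta> powr (2 - real ?d)) = (\<integral>\<^sup>+\<rho>. ?w \<zeta> \<rho> \<partial>lborel)" if "\<zeta> \<noteq> 0" for \<zeta> :: 'a
  proof -
    have "(\<integral>\<^sup>+\<rho>. ?w \<zeta> \<rho> \<partial>lborel) = ennreal ((norm \<zeta>)\<^sup>2) * (ennreal (?d / 2) * ennreal (2 / (?d * norm \<zeta> ^ ?d)))"
      using inverse_power_two_sided_nn_integral[of "norm \<zeta>" ?d] that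
      by (simp add: nn_integral_cmult)
    also have "\<dots> = ennreal ((norm \<zeta>)\<^sup>2 * (?d / 2 * (2 / (?d * norm \<zeta> ^ ?d))))"
      by (simp only: ennreal_mult'[symmetric] zero_le_power2 divide_nonneg_nonneg of_nat_0_le_iff zero_le_numeral mult_nonneg_nonneg norm_ge_zero zero_le_power)
    also have "(norm \<zeta>)\<^sup>2 * (?d / 2 * (2 / (?d * norm \<zeta> ^ ?d))) = (norm \<zeta>)\<^sup>2 / norm \<zeta> ^ ?d"
      by (simp add: field_simps)
    also have "\<dots> = norm \<zeta> powr (2 - real ?d)"
      using that by (simp add: powr_diff powr_realpow)
    finally show ?thesis by simp
  qed
  have "(\<integral>\<^sup>+\<zeta>. F \<zeta> * ennreal (norm \<zeta> powr (2 - real ?d)) \<partial>lborel) = (\<integral>\<^sup>+\<zeta>. F \<zeta> * (\<integral>\<^sup>+\<rho>. ?w \<zeta> \<rho> \<partial>lborel) \<partial>lborel)"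
  proof (rule nn_integral_cong_AE)
    have "AE \<zeta> in lborel. \<zeta> \<noteq> (0::'a)" by (rule AE_lborel_singleton)
    then show "AE \<zeta> in lborel. F \<zeta> * ennreal (norm \<zeta> powr (2 - real ?d)) = F \<zeta> * (\<integral>\<^sup>+\<rho>. ?w \<zeta> \<rho> \<partial>lborel)"
    proof (rule AE_mp, intro AE_I2 impI)
      fix \<zeta> :: 'a assume "\<zeta> \<noteq> 0"
      from w[OF this] show "F \<zeta> * ennreal (norm \<zeta> powr (2 - real ?d)) = F \<zeta> * (\<integral>\<^sup>+\<rho>. ?w \<zeta> \<rho> \<partial>lborel)"
        by (rule arg_cong)
    qed
  qed
  also have "\<dots> = (\<integral>\<^sup>+\<zeta>. \<integral>\<^sup>+\<rho>. F \<zeta> * ?w \<zeta> \<rho> \<partial>lborel \<partial>lborel)"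
    by (intro nn_integral_cong nn_integral_cmult[symmetric]) measurable
  also have "\<dots> = (\<integral>\<^sup>+\<rho>. \<integral>\<^sup>+\<zeta>. F \<zeta> * ?w \<zeta> \<rho> \<partial>lborel \<partial>lborel)"
    by (rule lborel_pair.Fubini'[symmetric]) measurable
  also have "\<dots> = (\<integral>\<^sup>+\<rho>. \<integral>\<^sup>+v. ennreal (?d / 2) * (indicator (cball 0 1) v * ennreal ((norm v)\<^sup>2) * (ennreal \<bar>\<rho>\<bar> * F (\<rho> *\<^sub>R v))) \<partial>lborel \<partial>lborel)"
  proof (rule nn_integral_cong_AE)
    have "AE \<rho> in lborel. \<rho> \<noteq> (0::real)" by (rule AE_lborel_singleton)
    then show "AE \<rho> in lborel. (\<integral>\<^sup>+\<zeta>. F \<zeta> * ?w \<zeta> \<rho> \<partial>lborel) = (\<integral>\<^sup>+v. ennreal (?d / 2) * (indicator (cball 0 1) v * ennreal ((norm v)\<^sup>2) * (ennreal \<bar>\<rho>\<bar> * F (\<rho> *\<^sub>R v))) \<partial>lborel)"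
    proof (rule AE_mp, intro AE_I2 impI)
      fix \<rho> :: real assume \<rho>: "\<rho> \<noteq> 0"
      have "(\<integral>\<^sup>+\<zeta>. F \<zeta> * ?w \<zeta> \<rho> \<partial>lborel) = ennreal (\<bar>\<rho>\<bar> ^ ?d) * (\<integral>\<^sup>+v. F (0 + \<rho> *\<^sub>R v) * ?w (0 + \<rho> *\<^sub>R v) \<rho> \<partial>lborel)"
        by (rule nn_integral_lborel_scale[OF _ \<rho>]) measurable
      also have "\<dots> = (\<integral>\<^sup>+v. ennreal (\<bar>\<rho>\<bar> ^ ?d) * (F (0 + \<rho> *\<^sub>R v) * ?w (0 + \<rho> *\<^sub>R v) \<rho>) \<partial>lborel)"
        by (rule nn_integral_cmult[symmetric]) measurable
      also have "\<dots> = (\<integral>\<^sup>+v. ennreal (?d / 2) * (indicator (cball 0 1) v * ennreal ((norm v)\<^sup>2) * (ennreal \<bar>\<rho>\<bar> * F (\<rho> *\<^sub>R v))) \<partial>lborel)"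
      proof (rule nn_integral_cong)
        fix v :: 'a
        have ind: "indicator {norm (\<rho> *\<^sub>R v)..} \<bar>\<rho>\<bar> = (indicator (cball 0 1) v :: real)"
          using \<rho> by (simp add: indicator_def)
        \<comment> \<open>Count of powers of \<open>\<bar>\<rho>\<bar>\<close>: \<open>d\<close>
          from the Jacobian, 2 from the squared norm and \<open>- d - 1\<close> from the inserted
          kernel leave exactly one, whatever \<open>d\<close> is. The cutoff
          \<open>norm \<zeta> \<le> \<bar>\<rho>\<bar>\<close> has become the unit ball in
          \<open>v\<close>.\<close>
        have "\<bar>\<rho>\<bar> ^ ?d * ((norm (\<rho> *\<^sub>R v))\<^sup>2 * (?d / 2 * (indicator {norm (\<rho> *\<^sub>R v)..} \<bar>\<rho>\<bar> / \<bar>\<rho>\<bar> ^ (?d + 1))))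
          = ?d / 2 * (indicator (cball 0 1) v * (norm v)\<^sup>2 * \<bar>\<rho>\<bar>)"
          unfolding ind using \<rho> by (simp add: power_mult_distrib field_simps power2_eq_square)
        then have eq: "ennreal (\<bar>\<rho>\<bar> ^ ?d) * ?w (\<rho> *\<^sub>R v) \<rho> = ennreal (?d / 2) * (indicator (cball 0 1) v * ennreal ((norm v)\<^sup>2) * ennreal \<bar>\<rho>\<bar>)"
          by (simp only: ennreal_indicator[symmetric] ennreal_mult'[symmetric] zero_le_power abs_ge_zero zero_le_power2
              indicator_pos_le mult_nonneg_nonneg divide_nonneg_nonneg of_nat_0_le_iff zero_le_numeral)
        have "ennreal (\<bar>\<rho>\<bar> ^ ?d) * (F (0 + \<rho> *\<^sub>R v) * ?w (0 + \<rho> *\<^sub>R v) \<rho>) =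
            (ennreal (\<bar>\<rho>\<bar> ^ ?d) * ?w (\<rho> *\<^sub>R v) \<rho>) * F (\<rho> *\<^sub>R v)"
          unfolding add_0 by (simp only: mult_ac)
        also have "\<dots> = ennreal (?d / 2) * (indicator (cball 0 1) v * ennreal ((norm v)\<^sup>2) * (ennreal \<bar>\<rho>\<bar> * F (\<rho> *\<^sub>R v)))"
          unfolding eq by (simp only: mult_ac)
        finally show "ennreal (\<bar>\<rho>\<bar> ^ ?d) * (F (0 + \<rho> *\<^sub>R v) * ?w (0 + \<rho> *\<^sub>R v) \<rho>) =
           ennreal (?d / 2) * (indicator (cball 0 1) v * ennreal ((norm v)\<^sup>2) * (ennreal \<bar>\<rho>\<bar> * F (\<rho> *\<^sub>R v)))" .
      qed
      finally show "(\<integral>\<^sup>+\<zeta>. F \<zeta> * ?w \<zeta> \<rho> \<partial>lborel) = (\<integral>\<^sup>+v. ennreal (?d / 2) * (indicator (cball 0 1) v * ennreal ((norm v)\<^sup>2) * (ennreal \<bar>\<rho>\<bar> * F (\<rho> *\<^sub>R v))) \<partial>lborel)" .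
    qed
  qed
  also have "\<dots> = (\<integral>\<^sup>+v. \<integral>\<^sup>+\<rho>. ennreal (?d / 2) * (indicator (cball 0 1) v * ennreal ((norm v)\<^sup>2) * (ennreal \<bar>\<rho>\<bar> * F (\<rho> *\<^sub>R v))) \<partial>lborel \<partial>lborel)"
    by (rule lborel_pair.Fubini') measurable
  also have "\<dots> = ennreal (?d / 2) * (\<integral>\<^sup>+v. indicator (cball 0 1) v * ennreal ((norm v)\<^sup>2) *
      (\<integral>\<^sup>+\<rho>. ennreal \<bar>\<rho>\<bar> * F (\<rho> *\<^sub>R v) \<partial>lborel) \<partial>lborel)"
    by (simp add: nn_integral_cmult)
  finally show ?thesis .
qed

section \<open>Laplace transforms\<close>

text \<open>A single term of the exponential series at \<open>t * x\<close> is at most the whole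
  sum. This dominates every moment in the Laplace transforms below.\<close>

lemma power_mult_exp_le:
  fixes t x :: real
  assumes t: "t > 0" and x: "x \<ge> 0"
  shows "x ^ k * exp (- t * x) \<le> fact k / t ^ k"
proof -
  have "(t * x) ^ k / fact k \<le> exp (t * x)"
  proof (cases "k = 0")
    case False
    have "(t * x) ^ k / fact k \<le> (\<Sum>j\<le>k. (t * x) ^ j / fact j)"
      using t x by (intro member_le_sum) auto
    also have "\<dots> \<le> exp (t * x)"
      using t x unfolding exp_def
      by (auto simp: scaleR_conv_of_real divide_inverse mult.commute intro!: sum_le_suminf summable_exp)
    finally show ?thesis .
  qed (use t x in auto)
  then have "(t * x) ^ k * exp (- (t * x)) \<le> fact k"
    by (simp add: exp_minus field_simps)
  then show ?thesis
    using t by (simp add: power_mult_distrib field_simps)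
qed

context
  fixes M :: "'a measure" and w \<mu> :: "'a \<Rightarrow> real"
  assumes w: "integrable M w" and \<mu> [measurable]: "\<mu> \<in> borel_measurable M" and \<mu>_nonneg: "\<And>x. \<mu> x \<ge> 0"
begin

lemma laplace_integrable:
  assumes t: "t > 0"
  shows "integrable M (\<lambda>x. (- \<mu> x) ^ k * exp (- t * \<mu> x) * w x)"
proof (rule Bochner_Integration.integrable_bound)
  show "integrable M (\<lambda>x. fact k / t ^ k * w x)" using w by simp
  have "\<mu> x ^ k * exp (- (t * \<mu> x)) * \<bar>w x\<bar> \<le> fact k / t ^ k * \<bar>w x\<bar>" for x
    using power_mult_exp_le[OF t \<mu>_nonneg, of x k] by (intro mult_right_mono) auto
  then show "AE x in M. norm ((- \<mu> x) ^ k * exp (- t * \<mu> x) * w x) \<le> norm (fact k / t ^ k * w x)"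
    using t \<mu>_nonneg by (intro AE_I2) (simp add: abs_mult power_abs)
qed (use w in measurable)

text \<open>Differentiation under the integral sign. For \<open>\<bar>h\<bar> < t / 2\<close> all
  times between \<open>t\<close> and \<open>t + h\<close> stay above \<open>t / 2\<close>, so the
  mean value inequality bounds the difference quotient by the next moment at time
  \<open>t / 2\<close>, which is integrable.\<close>

lemma laplace_has_derivative:
  assumes t: "t > 0"
  shows "((\<lambda>t. LINT x|M. (- \<mu> x) ^ k * exp (- t * \<mu> x) * w x) has_real_derivative
     (LINT x|M. (- \<mu> x) ^ Suc k * exp (- t * \<mu> x) * w x)) (at t)"
proof -
  have [measurable]: "w \<in> borel_measurable M" using w by auto
  let ?f = "\<lambda>t x. (- \<mu> x) ^ k * exp (- t * \<mu> x) * w x"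
  let ?B = "\<lambda>x. \<bar>(- \<mu> x) ^ Suc k * exp (- (t / 2) * \<mu> x) * w x\<bar>"
  let ?q = "\<lambda>h x. (?f (t + h) x - ?f t x) / h"
  have der: "((\<lambda>t. ?f t x) has_real_derivative (- \<mu> x) ^ Suc k * exp (- r * \<mu> x) * w x) (at r)" for r x
    by (auto intro!: derivative_eq_intros)
  have bound: "\<bar>?q h x\<bar> \<le> ?B x" if h: "h \<noteq> 0" "\<bar>h\<bar> < t / 2" for h x
  proof -
    have "norm (?f (t + h) x - ?f t x) \<le> ?B x * norm (t + h - t)"
    proof (rule field_differentiable_bound[of "{t / 2..}"])
      fix r assume r: "r \<in> {t / 2..}"
      show "((\<lambda>t. ?f t x) has_real_derivative (- \<mu> x) ^ Suc k * exp (- r * \<mu> x) * w x) (at r within {t / 2..})"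
        by (rule has_field_derivative_at_within[OF der])
      have "exp (- r * \<mu> x) \<le> exp (- (t / 2) * \<mu> x)"
        using mult_right_mono[of "t / 2" r "\<mu> x"] r \<mu>_nonneg[of x] by simp
      then show "norm ((- \<mu> x) ^ Suc k * exp (- r * \<mu> x) * w x) \<le> ?B x"
        unfolding real_norm_def abs_mult abs_exp_cancel by (intro mult_right_mono mult_left_mono) auto
    qed (use h t in auto)
    then show ?thesis using h by (simp add: field_simps)
  qed
  have "((\<lambda>h. LINT x|M. ?q h x) \<longlongrightarrow> (LINT x|M. (- \<mu> x) ^ Suc k * exp (- t * \<mu> x) * w x)) (at 0)"
  proof (rule tendsto_at_iff_sequentially[THEN iffD2, rule_format], unfold o_def)
    fix X :: "nat \<Rightarrow> real" assume X: "\<And>i. X i \<in> UNIV - {0}" "X \<longlonglongrightarrow> 0"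
    have "\<forall>\<^sub>F i in sequentially. \<bar>X i\<bar> < t / 2"
      using tendstoD[OF X(2), of "t / 2"] t by simp
    then obtain N where N: "\<And>i. i \<ge> N \<Longrightarrow> \<bar>X i\<bar> < t / 2" by (auto simp: eventually_sequentially)
    show "(\<lambda>i. LINT x|M. ?q (X i) x) \<longlonglongrightarrow> (LINT x|M. (- \<mu> x) ^ Suc k * exp (- t * \<mu> x) * w x)"
    proof (rule LIMSEQ_offset[where k = N], rule integral_dominated_convergence)
      show "integrable M ?B" by (intro integrable_abs laplace_integrable) (use t in simp)
      show "AE x in M. norm (?q (X (i + N)) x) \<le> ?B x" for i
        using bound[of "X (i + N)"] X(1) N[of "i + N"] by (intro AE_I2) auto
      show "AE x in M. (\<lambda>i. ?q (X (i + N)) x) \<longlonglongrightarrow> (- \<mu> x) ^ Suc k * exp (- t * \<mu> x) * w x"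
      proof (rule AE_I2)
        fix x
        have "((\<lambda>h. ?q h x) \<longlongrightarrow> (- \<mu> x) ^ Suc k * exp (- t * \<mu> x) * w x) (at 0)"
          using der[of x t] unfolding DERIV_def .
        then have "(\<lambda>i. ?q (X i) x) \<longlonglongrightarrow> (- \<mu> x) ^ Suc k * exp (- t * \<mu> x) * w x"
          unfolding tendsto_at_iff_sequentially o_def using X by blast
        then show "(\<lambda>i. ?q (X (i + N)) x) \<longlonglongrightarrow> (- \<mu> x) ^ Suc k * exp (- t * \<mu> x) * w x"
          by (rule LIMSEQ_ignore_initial_segment)
      qed
    qed measurable
  qed
  \<comment> \<open>The integral of the quotient splits only when both integrals converge, that is
    when \<open>t + h\<close> is positive.\<close>
  moreover have "(LINT x|M. ?q h x) = ((LINT x|M. ?f (t + h) x) - (LINT x|M. ?f t x)) / h" if "\<bar>h\<bar> < t" for h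
    using laplace_integrable[of "t + h" k] laplace_integrable[OF t, of k] that by simp
  then have "\<forall>\<^sub>F h in at 0. (LINT x|M. ?q h x) = ((LINT x|M. ?f (t + h) x) - (LINT x|M. ?f t x)) / h"
    using t by (auto simp: eventually_at dist_real_def intro!: exI[of _ t])
  ultimately show ?thesis
    unfolding DERIV_def by (rule Lim_transform_eventually)
qed

lemma laplace_completely_monotone:
  assumes w_nonneg: "\<And>x. w x \<ge> 0" and c: "c \<ge> 0"
    and Q: "\<And>t. t > 0 \<Longrightarrow> Q t = c * (LINT x|M. exp (- t * \<mu> x) * w x)"
  shows "completely_monotone Q"
proof -
  let ?L = "\<lambda>k t. LINT x|M. (- \<mu> x) ^ k * exp (- t * \<mu> x) * w x"
  \<comment> \<open>\<open>Q\<close> is prescribed for positive times only. They form an open set,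
    so a formula for the \<open>k\<close>-th derivative there may be differentiated; the formula is
    a premise because the induction below supplies it one order at a time.\<close>
  have der: "((deriv ^^ k) Q has_real_derivative c * ?L (Suc k) t) (at t)"
    if eq: "\<And>t. t > 0 \<Longrightarrow> (deriv ^^ k) Q t = c * ?L k t" and "t > 0" for k t
  proof (rule has_field_derivative_transform_within_open[where S = "{0<..}"])
    show "((\<lambda>t. c * ?L k t) has_real_derivative c * ?L (Suc k) t) (at t)"
      by (intro DERIV_cmult laplace_has_derivative that)
  qed (use that in auto)
  have eq: "(deriv ^^ k) Q t = c * ?L k t" if "t > 0" for k t
    using that
  proof (induction k arbitrary: t)
    case (Suc k)
    show ?case using DERIV_imp_deriv[OF der[OF Suc.IH Suc.prems]] by simp
  qed (simp add: Q)
  have sign: "(- 1) ^ k * (deriv ^^ k) Q t \<ge> 0" if "t > 0" for k t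
  proof -
    have "(- 1) ^ k * (deriv ^^ k) Q t = c * (LINT x|M. (- 1) ^ k * ((- \<mu> x) ^ k * exp (- t * \<mu> x) * w x))"
      unfolding eq[OF that] by simp
    also have "\<dots> = c * (LINT x|M. \<mu> x ^ k * exp (- t * \<mu> x) * w x)"
      by (simp add: mult.assoc[symmetric] power_mult_distrib[symmetric])
    also have "\<dots> \<ge> 0"
      using w_nonneg \<mu>_nonneg c by (intro mult_nonneg_nonneg integral_nonneg_AE AE_I2) auto
    finally show ?thesis .
  qed
  show ?thesis
    unfolding completely_monotone_def
    using der[OF eq] sign real_differentiable_def by blast
qed

end

section \<open>Schroedinger evolution of the heat flow\<close>

definition heat_mult :: "('a::euclidean_space \<Rightarrow> complex) \<Rightarrow> real \<Rightarrow> real \<Rightarrow> 'a \<Rightarrow> complex" where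
  "heat_mult g t s \<xi> = exp (- (complex_of_real t + \<i> * complex_of_real s) * complex_of_real ((norm \<xi>)\<^sup>2)) * g \<xi>"

lemma heat_mult_measurable [measurable]:
  assumes [measurable]: "g \<in> borel_measurable borel" "f \<in> borel_measurable M" "h \<in> borel_measurable M" "k \<in> borel_measurable M"
  shows "(\<lambda>x. heat_mult g (f x) (h x) (k x)) \<in> borel_measurable M"
  unfolding heat_mult_def by measurable

lemma cmod_heat_mult: "cmod (heat_mult g t s \<xi>) = exp (- t * (norm \<xi>)\<^sup>2) * cmod (g \<xi>)"
  by (simp add: heat_mult_def norm_mult)

lemma heat_mult_zero: "heat_mult g t 0 \<xi> = complex_of_real (exp (- t * (norm \<xi>)\<^sup>2)) * g \<xi>"
  by (simp add: heat_mult_def flip: exp_of_real)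

text \<open>For positive \<open>t\<close> the multiplier is itself square-integrable, so its product
  with \<open>g\<close> is integrable; being bounded by 1 in modulus, it also keeps \<open>g\<close>
  in L2. Plancherel and Parseval thus apply to the evolved data.\<close>

lemma heat_mult_integrable:
  fixes g :: "'a::euclidean_space \<Rightarrow> complex"
  assumes g: "sq_integrable g" and t: "t > 0"
  shows "integrable lborel (heat_mult g t s)" and "sq_integrable (heat_mult g t s)"
proof -
  have [measurable]: "g \<in> borel_measurable borel" using g by measurable
  have "sq_integrable (\<lambda>\<xi>::'a. complex_of_real (exp (- t * (norm \<xi>)\<^sup>2)))"
    unfolding sq_integrable_def
  proof
    have "integrable lborel (\<lambda>\<xi>::'a. exp (- (2 * t) * (norm \<xi>)\<^sup>2))"
      using t by (intro integrable_gaussian) simp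
    then show "integrable lborel (\<lambda>\<xi>::'a. (cmod (complex_of_real (exp (- t * (norm \<xi>)\<^sup>2))))\<^sup>2)"
      by (simp add: mult_ac flip: exp_double)
  qed measurable
  from sq_integrable_mult[OF this g] show "integrable lborel (heat_mult g t s)"
    by (rule Bochner_Integration.integrable_bound) (auto simp: cmod_heat_mult norm_mult)
  show "sq_integrable (heat_mult g t s)"
    using t by (intro sq_integrable_bound[OF g]) (auto simp: cmod_heat_mult intro!: mult_left_le_one_le)
qed

lemma fourier_translate:
  fixes H :: "'a::euclidean_space \<Rightarrow> complex"
  assumes [measurable]: "H \<in> borel_measurable borel"
  shows "fourier (\<lambda>\<xi>. H (\<xi> - \<zeta>)) x = exp (- \<i> * (\<zeta> \<bullet> x)) * fourier H x"
proof -
  have "fourier (\<lambda>\<xi>. H (\<xi> - \<zeta>)) x = (LINT \<xi>|lborel. H ((\<zeta> + \<xi>) - \<zeta>) * exp (- \<i> * complex_of_real ((\<zeta> + \<xi>) \<bullet> x)))"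
    unfolding fourier_def by (rule integral_lborel_translation[symmetric]) measurable
  also have "\<dots> = (LINT \<xi>|lborel. exp (- \<i> * (\<zeta> \<bullet> x)) * (H \<xi> * exp (- \<i> * complex_of_real (\<xi> \<bullet> x))))"
    by (simp add: inner_add_left distrib_left exp_diff exp_minus field_simps exp_add)
  finally show ?thesis unfolding fourier_def by simp
qed

text \<open>Translating \<open>H\<close> modulates its transform, so the character at
  \<open>\<zeta>\<close> is absorbed into one of the two factors of the squared modulus and Parseval
  applies. The argument \<open>- x\<close> appears because inversion is the transform at the
  reflected point.\<close>

lemma fourier_of_intensity:
  fixes H :: "'a::euclidean_space \<Rightarrow> complex"
  assumes H: "integrable lborel H" "sq_integrable H"
  shows "fourier (\<lambda>x. complex_of_real ((cmod (fourier H (- x)))\<^sup>2)) \<zeta> =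
    (2 * pi) ^ DIM('a) * (LINT \<xi>|lborel. H \<xi> * cnj (H (\<xi> - \<zeta>)))"
proof -
  have [measurable]: "H \<in> borel_measurable borel" using H by auto
  have H': "integrable lborel (\<lambda>\<xi>. H (\<xi> - \<zeta>))" "sq_integrable (\<lambda>\<xi>. H (\<xi> - \<zeta>))"
    using integrable_lborel_translation[OF H(1), of "- \<zeta>"] sq_integrable_translation[OF H(2), of "- \<zeta>"] by simp_all
  have "fourier (\<lambda>x. complex_of_real ((cmod (fourier H (- x)))\<^sup>2)) \<zeta> =
     (LINT x|lborel. complex_of_real ((cmod (fourier H (- (0 - x))))\<^sup>2) * exp (- \<i> * complex_of_real ((0 - x) \<bullet> \<zeta>)))"
    unfolding fourier_def[where h = "\<lambda>x. complex_of_real ((cmod (fourier H (- x)))\<^sup>2)"]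
    by (rule integral_lborel_reflect[symmetric]) measurable
  also have "\<dots> = (LINT x|lborel. fourier H x * cnj (fourier (\<lambda>\<xi>. H (\<xi> - \<zeta>)) x))"
  proof (rule Bochner_Integration.integral_cong[OF refl])
    fix x :: 'a
    have "complex_of_real ((cmod (fourier H x))\<^sup>2) = fourier H x * cnj (fourier H x)"
      by (rule complex_norm_square[unfolded of_real_power[symmetric]])
    then show "complex_of_real ((cmod (fourier H (- (0 - x))))\<^sup>2) * exp (- \<i> * complex_of_real ((0 - x) \<bullet> \<zeta>)) =
       fourier H x * cnj (fourier (\<lambda>\<xi>. H (\<xi> - \<zeta>)) x)"
      by (simp add: fourier_translate exp_cnj inner_commute mult_ac)
  qed
  also have "\<dots> = (2 * pi) ^ DIM('a) * (LINT \<xi>|lborel. H \<xi> * cnj (H (\<xi> - \<zeta>)))"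
    by (rule parseval_L1_L2[OF H H'])
  finally show ?thesis .
qed

lemma cmod_heat_mult_correlation:
  fixes g :: "'a::euclidean_space \<Rightarrow> complex"
  shows "cmod (LINT \<xi>|lborel. heat_mult g t s \<xi> * cnj (heat_mult g t s (\<xi> - \<zeta>))) =
    cmod (ambiguity (heat_mult g t 0) \<zeta> 1 s)"
proof -
  have eq: "heat_mult g t s \<xi> = exp (- \<i> * complex_of_real (s * (norm \<xi>)\<^sup>2)) * heat_mult g t 0 \<xi>" for \<xi>
    by (simp add: heat_mult_def algebra_simps flip: exp_add)
  have "heat_mult g t s \<xi> * cnj (heat_mult g t s (\<xi> - \<zeta>)) = exp (\<i> * complex_of_real (s * (norm \<zeta>)\<^sup>2)) *
      (heat_mult g t 0 \<xi> * cnj (heat_mult g t 0 (\<xi> - 1 *\<^sub>R \<zeta>)) * exp (- \<i> * complex_of_real (s * (2 * (\<xi> \<bullet> \<zeta>)))))" for \<xi>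
  proof -
    have "(norm (\<xi> - \<zeta>))\<^sup>2 = (norm \<xi>)\<^sup>2 - 2 * (\<xi> \<bullet> \<zeta>) + (norm \<zeta>)\<^sup>2"
      by (simp add: power2_norm_eq_inner inner_diff_left inner_diff_right inner_commute)
    then have ph: "s * (norm (\<xi> - \<zeta>))\<^sup>2 - s * (norm \<xi>)\<^sup>2 = s * (norm \<zeta>)\<^sup>2 - s * (2 * (\<xi> \<bullet> \<zeta>))"
      by (simp only:) (simp add: algebra_simps)
    have "exp (- \<i> * complex_of_real a) * cnj (exp (- \<i> * complex_of_real b)) = exp (\<i> * complex_of_real (b - a))"
      and "exp (\<i> * complex_of_real a) * exp (- \<i> * complex_of_real b) = exp (\<i> * complex_of_real (a - b))" for a b
      by (simp_all add: exp_cnj right_diff_distrib exp_diff exp_minus field_simps)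
    then have "exp (- \<i> * complex_of_real (s * (norm \<xi>)\<^sup>2)) * cnj (exp (- \<i> * complex_of_real (s * (norm (\<xi> - \<zeta>))\<^sup>2))) =
      exp (\<i> * complex_of_real (s * (norm \<zeta>)\<^sup>2)) * exp (- \<i> * complex_of_real (s * (2 * (\<xi> \<bullet> \<zeta>))))"
      by (simp only: ph)
    then show ?thesis
      unfolding eq[of \<xi>] eq[of "\<xi> - \<zeta>"] complex_cnj_mult by (simp add: mult_ac)
  qed
  then have "(LINT \<xi>|lborel. heat_mult g t s \<xi> * cnj (heat_mult g t s (\<xi> - \<zeta>))) =
     exp (\<i> * complex_of_real (s * (norm \<zeta>)\<^sup>2)) * ambiguity (heat_mult g t 0) \<zeta> 1 s"
    unfolding ambiguity_def by (simp only: integral_mult_right_zero)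
  then show ?thesis by (simp add: norm_mult)
qed

text \<open>In the expansion of \<open>|P z - P (reflect e z)|^2\<close> both squares have the same
  integral, since reflections preserve measure. This is the source of the nonnegative
  density.\<close>

lemma Re_correlation_reflect:
  fixes P :: "'a::euclidean_space \<Rightarrow> complex"
  assumes P: "sq_integrable P"
  shows "Re (LINT z|lborel. P z * cnj (P (reflect e z))) =
    (LINT z|lborel. (cmod (P z))\<^sup>2) - (LINT z|lborel. (cmod (P z - P (reflect e z)))\<^sup>2) / 2"
proof -
  have [measurable]: "P \<in> borel_measurable borel" using P by measurable
  note R = sq_integrable_reflect[OF P, of e]
  note i = sq_integrable_mult[OF P sq_integrable_cnj[OF R]]
  define r where "r z = Re (P z * cnj (P (reflect e z)))" for z
  have ri: "integrable lborel r" unfolding r_def[abs_def] using i by (rule integrable_Re)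
  have "(LINT z|lborel. (cmod (P z - P (reflect e z)))\<^sup>2) =
     (LINT z|lborel. (cmod (P z))\<^sup>2 + (cmod (P (reflect e z)))\<^sup>2 - 2 * r z)"
    unfolding r_def
    by (rule Bochner_Integration.integral_cong[OF refl], unfold cmod_power2)
      (simp add: power2_eq_square algebra_simps)
  also have "\<dots> = (LINT z|lborel. (cmod (P z))\<^sup>2) + (LINT z|lborel. (cmod (P (reflect e z)))\<^sup>2)
      - 2 * (LINT z|lborel. r z)"
    using sq_integrableD[OF P] sq_integrableD[OF R] ri by simp
  also have "(LINT z|lborel. r z) = Re (LINT z|lborel. P z * cnj (P (reflect e z)))"
    unfolding r_def using i by (rule integral_Re)
  also have "(LINT z|lborel. (cmod (P (reflect e z)))\<^sup>2) = (LINT z|lborel. (cmod (P z))\<^sup>2)"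
    by (rule integral_reflect) measurable
  finally show ?thesis by (simp add: field_simps)
qed

text \<open>A density on pairs of a direction \<open>v\<close> and a pair of velocities
  \<open>z\<close>. The reflection depends on \<open>v\<close> only through its line, so integrating
  over the unit ball averages over directions uniformly.\<close>

definition collision_defect :: "('a::euclidean_space \<times> 'a \<Rightarrow> complex) \<Rightarrow> 'a \<times> ('a \<times> 'a) \<Rightarrow> real" where
  "collision_defect P = (\<lambda>(v, z). indicator (cball 0 1) v * (cmod (P z - P (reflect (v, - v) z)))\<^sup>2)"

lemma collision_defect_nonneg: "collision_defect P x \<ge> 0"
  by (simp add: collision_defect_def case_prod_unfold)

lemma emeasure_unit_cball_less_top: "emeasure lborel (cball (0::'a::euclidean_space) 1) < \<infinity>"
  by (rule emeasure_compact_finite) simp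

text \<open>For each \<open>v\<close> the integral over \<open>z\<close> is at most four times that
  of \<open>|P|^2\<close>, and \<open>v\<close> is confined to a set of finite measure.\<close>

lemma collision_defect_integrable:
  fixes P :: "'a::euclidean_space \<times> 'a \<Rightarrow> complex"
  assumes P: "sq_integrable P"
  shows "integrable (lborel \<Otimes>\<^sub>M lborel) (collision_defect P)"
proof (rule integrableI_bounded)
  have [measurable]: "P \<in> borel_measurable borel" using P by measurable
  have [measurable]: "cball (0::'a) 1 \<in> sets borel" by simp
  have [measurable]: "(\<lambda>x. reflect (fst x, - fst x) (snd x)) \<in> borel_measurable (borel \<Otimes>\<^sub>M borel :: ('a \<times> ('a \<times> 'a)) measure)"
    unfolding reflect_def borel_prod inner_prod_def by measurable
  show [measurable]: "collision_defect P \<in> borel_measurable (lborel \<Otimes>\<^sub>M lborel)"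
    unfolding collision_defect_def case_prod_unfold by measurable
  define A where "A = (LINT z|lborel. (cmod (P z))\<^sup>2)"
  have "(\<integral>\<^sup>+z. ennreal ((cmod (P z - P (reflect e z)))\<^sup>2) \<partial>lborel) \<le> ennreal (4 * A)" for e
  proof -
    note R = sq_integrable_reflect[OF P, of e]
    note D = sq_integrable_diff[OF P R]
    have "(LINT z|lborel. (cmod (P z - P (reflect e z)))\<^sup>2) \<le> (LINT z|lborel. 2 * (cmod (P z))\<^sup>2 + 2 * (cmod (P (reflect e z)))\<^sup>2)"
    proof (rule integral_mono[OF sq_integrableD[OF D]])
      show "(cmod (P z - P (reflect e z)))\<^sup>2 \<le> 2 * (cmod (P z))\<^sup>2 + 2 * (cmod (P (reflect e z)))\<^sup>2" for z
        using power_mono[OF norm_triangle_ineq4[of "P z" "P (reflect e z)"], of 2]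
          sum_squares_bound[of "cmod (P z)" "cmod (P (reflect e z))"] by (simp add: power2_sum)
    qed (use sq_integrableD[OF P] sq_integrableD[OF R] in simp)
    also have "\<dots> = 2 * A + 2 * (LINT z|lborel. (cmod (P (reflect e z)))\<^sup>2)"
      using sq_integrableD[OF P] sq_integrableD[OF R] by (simp add: A_def)
    also have "(LINT z|lborel. (cmod (P (reflect e z)))\<^sup>2) = A"
      unfolding A_def by (rule integral_reflect) measurable
    finally show ?thesis
      using sq_integrableD[OF D] by (subst nn_integral_eq_integral) (auto intro!: ennreal_leI)
  qed note bnd = this
  have "(\<integral>\<^sup>+x. ennreal (norm (collision_defect P x)) \<partial>(lborel \<Otimes>\<^sub>M lborel)) =
     (\<integral>\<^sup>+v. \<integral>\<^sup>+z. ennreal (norm (collision_defect P (v, z))) \<partial>lborel \<partial>lborel)"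
    by (rule lborel.nn_integral_fst[symmetric]) measurable
  also have "\<dots> \<le> (\<integral>\<^sup>+v. ennreal (4 * A) * indicator (cball (0::'a) 1) v \<partial>lborel)"
  proof (rule nn_integral_mono)
    fix v :: 'a
    show "(\<integral>\<^sup>+z. ennreal (norm (collision_defect P (v, z))) \<partial>lborel) \<le> ennreal (4 * A) * indicator (cball 0 1) v"
      using bnd[of "(v, - v)"] by (cases "v \<in> cball 0 1") (simp_all add: collision_defect_def)
  qed
  also have "\<dots> = ennreal (4 * A) * emeasure lborel (cball (0::'a) 1)"
    by (rule nn_integral_cmult_indicator) simp
  also have "\<dots> < \<infinity>"
    using emeasure_unit_cball_less_top[where 'a='a] by (simp add: ennreal_mult_less_top)
  finally show "(\<integral>\<^sup>+x. ennreal (norm (collision_defect P x)) \<partial>(lborel \<Otimes>\<^sub>M lborel)) < \<infinity>" .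
qed

lemma ambiguity_scaleR: "ambiguity G (\<rho> *\<^sub>R v) 1 s = ambiguity G v \<rho> (\<rho> * s)"
  unfolding ambiguity_def by (simp add: mult_ac)

text \<open>With \<open>\<zeta> = \<rho> v\<close> the weight turns into
  \<open>\<bar>\<rho>\<bar> * (norm v)\<^sup>2\<close> on the unit ball. Rescaling time by
  \<open>\<rho>\<close> uses up \<open>\<bar>\<rho>\<bar>\<close>, and
  \<open>(norm v)\<^sup>2\<close> cancels the \<open>1 / (v \<bullet> v)\<close> of
  \<open>nn_integral_ambiguity\<close>. What remains is the unweighted integral of \<open>J\<close>
  over the ball: the ball's volume times the full \<open>|P|^2\<close> integral, minus half the
  defect.\<close>

lemma nn_integral_riesz_ambiguity:
  fixes G :: "'a::euclidean_space \<Rightarrow> complex"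
  assumes G: "sq_integrable G"
  defines "P \<equiv> \<lambda>z. G (fst z) * G (snd z)"
  shows "(\<integral>\<^sup>+s. \<integral>\<^sup>+\<zeta>. ennreal (norm \<zeta> powr (2 - real DIM('a)) * (cmod (ambiguity G \<zeta> 1 s))\<^sup>2) \<partial>lborel \<partial>lborel) =
    ennreal (DIM('a) * pi / 2 * (unit_ball_vol DIM('a) * (LINT \<xi>|lborel. (cmod (G \<xi>))\<^sup>2)\<^sup>2 -
      (LINT x|(lborel \<Otimes>\<^sub>M lborel). collision_defect P x) / 2))" (is ?thesis1)
    and "unit_ball_vol DIM('a) * (LINT \<xi>|lborel. (cmod (G \<xi>))\<^sup>2)\<^sup>2 -
      (LINT x|(lborel \<Otimes>\<^sub>M lborel). collision_defect P x) / 2 \<ge> 0" (is ?thesis2)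
proof -
  have [measurable]: "G \<in> borel_measurable borel" using G by measurable
  have [measurable]: "cball (0::'a) 1 \<in> sets borel" by simp
  let ?d = "DIM('a)"
  let ?B = "\<lambda>v::'a. indicator (cball 0 1) v :: real"
  define A where "A = (LINT \<xi>|lborel. (cmod (G \<xi>))\<^sup>2)"
  have P: "sq_integrable P" and PA: "(LINT z|lborel. (cmod (P z))\<^sup>2) = A\<^sup>2"
    unfolding P_def A_def using sq_integrable_tensor[OF G] by auto
  define J where "J v = Re (LINT z|lborel. P z * cnj (P (reflect (v, - v) z)))" for v
  have J: "?B v * J v = ?B v * A\<^sup>2 - (LINT z|lborel. collision_defect P (v, z)) / 2" for v
    unfolding J_def Re_correlation_reflect[OF P] PA by (simp add: collision_defect_def algebra_simps)
  have BJ: "integrable lborel (\<lambda>v. ?B v * J v)"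
    "(LINT v|lborel. ?B v * J v) = unit_ball_vol ?d * A\<^sup>2 - (LINT x|(lborel \<Otimes>\<^sub>M lborel). collision_defect P x) / 2"
  proof -
    note D = lborel_pair.integrable_fst'[OF collision_defect_integrable[OF P]]
      lborel_pair.integral_fst'[OF collision_defect_integrable[OF P]]
    have B: "integrable lborel ?B"
      using emeasure_unit_cball_less_top[where 'a='a] by (intro integrable_real_indicator) auto
    have "(LINT v|lborel. ?B v) = unit_ball_vol ?d"
      using content_cball[of 1 "0::'a"] by simp
    then show "integrable lborel (\<lambda>v. ?B v * J v)"
      "(LINT v|lborel. ?B v * J v) = unit_ball_vol ?d * A\<^sup>2 - (LINT x|(lborel \<Otimes>\<^sub>M lborel). collision_defect P x) / 2"
      unfolding J using D B by simp_all
  qed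
  have BJ_nonneg: "AE v in lborel. 0 \<le> ?B v * J v"
  proof (rule AE_mp[OF AE_lborel_singleton], intro AE_I2 impI)
    fix v :: 'a assume "v \<noteq> 0"
    then have "0 \<le> J v" unfolding J_def P_def by (rule nn_integral_ambiguity(2)[OF G])
    then show "0 \<le> ?B v * J v" by simp
  qed
  define F where "F \<zeta> = (\<integral>\<^sup>+s. ennreal ((cmod (ambiguity G \<zeta> 1 s))\<^sup>2) \<partial>lborel)" for \<zeta>
  have [measurable]: "F \<in> borel_measurable borel" unfolding F_def by measurable
  have "(\<integral>\<^sup>+s. \<integral>\<^sup>+\<zeta>. ennreal (norm \<zeta> powr (2 - real ?d) * (cmod (ambiguity G \<zeta> 1 s))\<^sup>2) \<partial>lborel \<partial>lborel) =
     (\<integral>\<^sup>+\<zeta>. \<integral>\<^sup>+s. ennreal (norm \<zeta> powr (2 - real ?d) * (cmod (ambiguity G \<zeta> 1 s))\<^sup>2) \<partial>lborel \<partial>lborel)"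
    by (rule lborel_pair.Fubini') measurable
  also have "\<dots> = (\<integral>\<^sup>+\<zeta>. F \<zeta> * ennreal (norm \<zeta> powr (2 - real ?d)) \<partial>lborel)"
  proof (rule nn_integral_cong)
    fix \<zeta> :: 'a
    show "(\<integral>\<^sup>+s. ennreal (norm \<zeta> powr (2 - real ?d) * (cmod (ambiguity G \<zeta> 1 s))\<^sup>2) \<partial>lborel) = F \<zeta> * ennreal (norm \<zeta> powr (2 - real ?d))"
      unfolding F_def by (subst mult.commute) (simp add: ennreal_mult nn_integral_multc)
  qed
  also have "\<dots> = ennreal (?d / 2) * (\<integral>\<^sup>+v. indicator (cball 0 1) v * ennreal ((norm v)\<^sup>2) *
      (\<integral>\<^sup>+\<rho>. ennreal \<bar>\<rho>\<bar> * F (\<rho> *\<^sub>R v) \<partial>lborel) \<partial>lborel)"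
    by (rule nn_integral_riesz_weight) measurable
  also have "\<dots> = ennreal (?d / 2) * (\<integral>\<^sup>+v. ennreal (pi * (?B v * J v)) \<partial>lborel)"
  proof (rule arg_cong[where f = "\<lambda>x. ennreal (?d / 2) * x"], rule nn_integral_cong_AE)
    have "AE v in lborel. v \<noteq> (0::'a)" by (rule AE_lborel_singleton)
    then show "AE v in lborel. indicator (cball 0 1) v * ennreal ((norm v)\<^sup>2) * (\<integral>\<^sup>+\<rho>. ennreal \<bar>\<rho>\<bar> * F (\<rho> *\<^sub>R v) \<partial>lborel)
       = ennreal (pi * (?B v * J v))"
    proof (rule AE_mp, intro AE_I2 impI)
      fix v :: 'a assume v: "v \<noteq> 0"
      have "(\<integral>\<^sup>+\<rho>. ennreal \<bar>\<rho>\<bar> * F (\<rho> *\<^sub>R v) \<partial>lborel) = (\<integral>\<^sup>+\<rho>. \<integral>\<^sup>+s. ennreal ((cmod (ambiguity G v \<rho> s))\<^sup>2) \<partial>lborel \<partial>lborel)"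
      proof (rule nn_integral_cong_AE)
        have "AE \<rho> in lborel. \<rho> \<noteq> (0::real)" by (rule AE_lborel_singleton)
        then show "AE \<rho> in lborel. ennreal \<bar>\<rho>\<bar> * F (\<rho> *\<^sub>R v) = (\<integral>\<^sup>+s. ennreal ((cmod (ambiguity G v \<rho> s))\<^sup>2) \<partial>lborel)"
        proof (rule AE_mp, intro AE_I2 impI)
          fix \<rho> :: real assume "\<rho> \<noteq> 0"
          then have "(\<integral>\<^sup>+s. ennreal ((cmod (ambiguity G v \<rho> s))\<^sup>2) \<partial>lborel) = ennreal \<bar>\<rho>\<bar> * (\<integral>\<^sup>+s. ennreal ((cmod (ambiguity G v \<rho> (0 + \<rho> * s)))\<^sup>2) \<partial>lborel)"
            by (intro nn_integral_real_affine) measurable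
          then show "ennreal \<bar>\<rho>\<bar> * F (\<rho> *\<^sub>R v) = (\<integral>\<^sup>+s. ennreal ((cmod (ambiguity G v \<rho> s))\<^sup>2) \<partial>lborel)"
            by (simp add: F_def ambiguity_scaleR)
        qed
      qed
      also have "\<dots> = ennreal (pi / (v \<bullet> v) * J v)"
        unfolding J_def P_def by (rule nn_integral_ambiguity(1)[OF G v])
      finally have eq: "(\<integral>\<^sup>+\<rho>. ennreal \<bar>\<rho>\<bar> * F (\<rho> *\<^sub>R v) \<partial>lborel) = ennreal (pi / (v \<bullet> v) * J v)" .
      have "pi * (?B v * J v) = (?B v * (norm v)\<^sup>2) * (pi / (v \<bullet> v) * J v)"
        using v by (simp add: power2_norm_eq_inner)
      then show "indicator (cball 0 1) v * ennreal ((norm v)\<^sup>2) * (\<integral>\<^sup>+\<rho>. ennreal \<bar>\<rho>\<bar> * F (\<rho> *\<^sub>R v) \<partial>lborel) = ennreal (pi * (?B v * J v))"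
        unfolding eq by (simp only: ennreal_indicator[symmetric] ennreal_mult'[symmetric] indicator_pos_le zero_le_power2 mult_nonneg_nonneg)
    qed
  qed
  also have "(\<integral>\<^sup>+v. ennreal (pi * (?B v * J v)) \<partial>lborel) = ennreal (LINT v|lborel. pi * (?B v * J v))"
  proof (rule nn_integral_eq_integral)
    show "integrable lborel (\<lambda>v. pi * (?B v * J v))" using BJ(1) by simp
    show "AE v in lborel. 0 \<le> pi * (?B v * J v)"
      using BJ_nonneg by (rule eventually_mono) (rule mult_nonneg_nonneg[OF pi_ge_zero])
  qed
  also have "(LINT v|lborel. pi * (?B v * J v)) = pi * (unit_ball_vol ?d * A\<^sup>2 - (LINT x|(lborel \<Otimes>\<^sub>M lborel). collision_defect P x) / 2)"
    using BJ by simp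
  finally show ?thesis1
    unfolding A_def[symmetric] by (simp add: mult.assoc flip: ennreal_mult')
  have "0 \<le> (LINT v|lborel. ?B v * J v)"
    using BJ_nonneg by (rule integral_nonneg_AE)
  then show ?thesis2
    unfolding A_def[symmetric] BJ .
qed

text \<open>Conservation of energy: \<open>z\<close> and its reflection have the same norm, so both
  values of the product carry the same heat factor. It comes out of the difference and is squared,
  whence the exponent \<open>2 * (norm z)\<^sup>2\<close>.\<close>

lemma collision_defect_heat_mult:
  "collision_defect (\<lambda>z. heat_mult g t 0 (fst z) * heat_mult g t 0 (snd z)) x =
   exp (- t * (2 * (norm (snd x))\<^sup>2)) * collision_defect (\<lambda>z. g (fst z) * g (snd z)) x"
proof -
  obtain v z where x: "x = (v, z)" by (cases x)
  have P: "heat_mult g t 0 (fst z) * heat_mult g t 0 (snd z) = complex_of_real (exp (- t * (norm z)\<^sup>2)) * (g (fst z) * g (snd z))" for z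
  proof -
    have "exp (- t * (norm z)\<^sup>2) = exp (- t * (norm (fst z))\<^sup>2) * exp (- t * (norm (snd z))\<^sup>2)"
      by (cases z) (simp add: norm_Pair distrib_left flip: exp_add)
    then show ?thesis by (simp only: heat_mult_zero of_real_mult mult_ac)
  qed
  have "exp (- t * (2 * (norm z)\<^sup>2)) = (exp (- t * (norm z)\<^sup>2))\<^sup>2"
    by (simp add: mult_ac flip: exp_double)
  then show ?thesis
    unfolding x collision_defect_def P norm_reflect
    by (simp add: norm_mult power_mult_distrib flip: right_diff_distrib)
qed

section \<open>Identification of both terms of \<open>Qfun\<close>\<close>

context
  fixes f g :: "real^'n \<Rightarrow> complex"
  assumes g: "sq_integrable g" and F: "L2_ft f \<in> borel_measurable lebesgue" and ae: "AE \<xi> in lborel. L2_ft f \<xi> = g \<xi>"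
begin

lemma schrod_heat_eq_fourier:
  "schrod_heat f t s x = complex_of_real ((2 * pi) powr (- real CARD('n))) * fourier (heat_mult g t s) (- x)"
proof -
  have [measurable]: "g \<in> borel_measurable borel" using g by measurable
  let ?e = "\<lambda>\<xi>. exp (\<i> * complex_of_real (x \<bullet> \<xi>)) * exp (- (complex_of_real t + \<i> * complex_of_real s) * complex_of_real ((norm \<xi>)\<^sup>2))"
  have m: "?e \<in> borel_measurable lebesgue" by (intro measurable_completion) measurable
  have "(LINT \<xi>|lebesgue. ?e \<xi> * L2_ft f \<xi>) = (LINT \<xi>|lebesgue. ?e \<xi> * g \<xi>)"
  proof (rule integral_cong_AE)
    show "(\<lambda>\<xi>. ?e \<xi> * L2_ft f \<xi>) \<in> borel_measurable lebesgue" by (intro borel_measurable_times m F)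
    show "(\<lambda>\<xi>. ?e \<xi> * g \<xi>) \<in> borel_measurable lebesgue" by (intro measurable_completion) measurable
    show "AE \<xi> in lebesgue. ?e \<xi> * L2_ft f \<xi> = ?e \<xi> * g \<xi>"
      using AE_lborel_imp_lebesgue[OF ae] by (rule AE_mp) (intro AE_I2 impI, simp)
  qed
  also have "\<dots> = (LINT \<xi>|lborel. ?e \<xi> * g \<xi>)"
    by (rule integral_completion) measurable
  also have "\<dots> = fourier (heat_mult g t s) (- x)"
    unfolding fourier_def heat_mult_def by (simp add: inner_commute mult_ac)
  finally show ?thesis by (simp add: schrod_heat_def)
qed

lemma ft_schrod_heat_intensity:
  assumes t: "t > 0"
  shows "cmod (ft (\<lambda>x. complex_of_real ((cmod (schrod_heat f t s x))\<^sup>2)) \<zeta>) =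
    (2 * pi) powr (- real CARD('n)) * cmod (ambiguity (heat_mult g t 0) \<zeta> 1 s)"
proof -
  have [measurable]: "g \<in> borel_measurable borel" using g by measurable
  let ?c = "(2 * pi) powr (- real CARD('n))"
  note H = heat_mult_integrable[OF g t, of s]
  let ?u = "\<lambda>x. complex_of_real ((cmod (fourier (heat_mult g t s) (- x)))\<^sup>2)"
  have c: "?c * (2 * pi) ^ CARD('n) = 1"
    by (simp add: powr_minus powr_realpow field_simps)
  have eq: "complex_of_real ((cmod (schrod_heat f t s x))\<^sup>2) = complex_of_real (?c\<^sup>2) * ?u x" for x
    by (simp add: schrod_heat_eq_fourier norm_mult power_mult_distrib)
  have "ft (\<lambda>x. complex_of_real ((cmod (schrod_heat f t s x))\<^sup>2)) = fourier (\<lambda>x. complex_of_real (?c\<^sup>2) * ?u x)"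
    unfolding eq
  proof (rule ft_eq_fourier)
    show m: "(\<lambda>x. complex_of_real (?c\<^sup>2) * ?u x) \<in> borel_measurable borel" by measurable
    then show "(\<lambda>x. complex_of_real (?c\<^sup>2) * ?u x) \<in> borel_measurable lebesgue" by (intro measurable_completion) simp
  qed simp
  then have "ft (\<lambda>x. complex_of_real ((cmod (schrod_heat f t s x))\<^sup>2)) \<zeta> = complex_of_real (?c\<^sup>2) * fourier ?u \<zeta>"
    unfolding fourier_def[of "\<lambda>x. complex_of_real (?c\<^sup>2) * ?u x"] fourier_def[of ?u] by (simp add: mult.assoc)
  also have "\<dots> = complex_of_real (?c\<^sup>2) * ((2 * pi) ^ CARD('n) * (LINT \<xi>|lborel. heat_mult g t s \<xi> * cnj (heat_mult g t s (\<xi> - \<zeta>))))"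
    using fourier_of_intensity[OF H, of \<zeta>] by simp
  finally have "cmod (ft (\<lambda>x. complex_of_real ((cmod (schrod_heat f t s x))\<^sup>2)) \<zeta>) =
     ?c\<^sup>2 * (2 * pi) ^ CARD('n) * cmod (ambiguity (heat_mult g t 0) \<zeta> 1 s)"
    by (simp add: norm_mult norm_power cmod_heat_mult_correlation)
  \<comment> \<open>The inversion constant enters squared through the intensity, and Parseval gives
    back one factor \<open>(2 * pi) ^ CARD('n)\<close>.\<close>
  also have "?c\<^sup>2 * (2 * pi) ^ CARD('n) = ?c"
    using c by (simp add: power2_eq_square mult.assoc)
  finally show ?thesis .
qed

lemma L2_norm_schrod_heat:
  assumes t: "t > 0"
  shows "(LINT x|lebesgue. (cmod (schrod_heat f t 0 x))\<^sup>2) =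
    (2 * pi) powr (- real CARD('n)) * (LINT \<xi>|lborel. (cmod (heat_mult g t 0 \<xi>))\<^sup>2)"
proof -
  have [measurable]: "g \<in> borel_measurable borel" using g by measurable
  let ?c = "(2 * pi) powr (- real CARD('n))"
  let ?U = "fourier (heat_mult g t 0)"
  have c: "?c * (2 * pi) ^ CARD('n) = 1"
    by (simp add: powr_minus powr_realpow field_simps)
  have "(LINT x|lebesgue. (cmod (schrod_heat f t 0 x))\<^sup>2) = (LINT x|lebesgue. ?c\<^sup>2 * (cmod (?U (- x)))\<^sup>2)"
    by (simp add: schrod_heat_eq_fourier norm_mult power_mult_distrib)
  also have "\<dots> = (LINT x|lborel. ?c\<^sup>2 * (cmod (?U (- x)))\<^sup>2)"
    by (rule integral_completion) measurable
  also have "\<dots> = ?c\<^sup>2 * (LINT x|lborel. (cmod (?U (0 - x)))\<^sup>2)" by simp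
  also have "(LINT x|lborel. (cmod (?U (0 - x)))\<^sup>2) = (LINT x|lborel. (cmod (?U x))\<^sup>2)"
    by (rule integral_lborel_reflect) measurable
  also have "\<dots> = (2 * pi) ^ CARD('n) * (LINT \<xi>|lborel. (cmod (heat_mult g t 0 \<xi>))\<^sup>2)"
    using plancherel_L1_L2(2)[OF heat_mult_integrable[OF g t, of 0]] by simp
  finally show ?thesis
    using c by (simp add: power2_eq_square mult_ac)
qed

lemma riesz_sq_eq:
  assumes t: "t > 0"
  defines "P \<equiv> \<lambda>z. heat_mult g t 0 (fst z) * heat_mult g t 0 (snd z)"
  shows "riesz_sq f t = ennreal (((2 * pi) powr (- real CARD('n))) ^ 3 * (CARD('n) * pi / 2 *
     (unit_ball_vol CARD('n) * (LINT \<xi>|lborel. (cmod (heat_mult g t 0 \<xi>))\<^sup>2)\<^sup>2 -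
      (LINT x|(lborel \<Otimes>\<^sub>M lborel). collision_defect P x) / 2)))"
proof -
  have [measurable]: "g \<in> borel_measurable borel" using g by measurable
  let ?c = "(2 * pi) powr (- real CARD('n))"
  let ?G = "heat_mult g t 0"
  let ?h = "\<lambda>s \<zeta>. ennreal (norm \<zeta> powr (2 - real CARD('n)) * (cmod (ambiguity ?G \<zeta> 1 s))\<^sup>2)"
  \<comment> \<open>One factor \<open>?c\<close> is the Plancherel constant in
    \<open>riesz_sq\<close>; the other two come from squaring the modulus of the transformed
    intensity.\<close>
  have "ennreal (?c * norm \<zeta> powr (2 - real CARD('n)) * (cmod (ft (\<lambda>x. complex_of_real ((cmod (schrod_heat f t s x))\<^sup>2)) \<zeta>))\<^sup>2) =
     ennreal (?c ^ 3) * ?h s \<zeta>" for s \<zeta>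
    unfolding ft_schrod_heat_intensity[OF t]
    by (subst ennreal_mult[symmetric]) (simp_all add: power_mult_distrib power2_eq_square power3_eq_cube mult_ac)
  then have "riesz_sq f t = (\<integral>\<^sup>+s. \<integral>\<^sup>+\<zeta>. ennreal (?c ^ 3) * ?h s \<zeta> \<partial>lebesgue \<partial>lborel)"
    unfolding riesz_sq_def by (simp only:)
  also have "\<dots> = ennreal (?c ^ 3) * (\<integral>\<^sup>+s. \<integral>\<^sup>+\<zeta>. ?h s \<zeta> \<partial>lborel \<partial>lborel)"
    unfolding nn_integral_completion by (simp add: nn_integral_cmult)
  also have "(\<integral>\<^sup>+s. \<integral>\<^sup>+\<zeta>. ?h s \<zeta> \<partial>lborel \<partial>lborel) = ennreal (CARD('n) * pi / 2 *
     (unit_ball_vol CARD('n) * (LINT \<xi>|lborel. (cmod (heat_mult g t 0 \<xi>))\<^sup>2)\<^sup>2 -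
      (LINT x|(lborel \<Otimes>\<^sub>M lborel). collision_defect P x) / 2))"
    using nn_integral_riesz_ambiguity(1)[OF heat_mult_integrable(2)[OF g t, of 0]] by (simp add: P_def)
  finally show ?thesis
    by (subst ennreal_mult') simp_all
qed

text \<open>The sphere's area is \<open>d\<close> times the ball's volume, so the first term of
  \<open>Qfun\<close> coincides with the part of \<open>riesz_sq\<close> that contains
  \<open>A\<^sup>2\<close>. What survives is the half defect, which is why \<open>pi / 2\<close>
  becomes \<open>pi / 4\<close>.\<close>

lemma Qfun_eq_laplace:
  assumes t: "t > 0"
  shows "Qfun f t = ((2 * pi) powr (- real CARD('n))) ^ 3 * (CARD('n) * pi / 4) *
    (LINT x|(lborel \<Otimes>\<^sub>M lborel). exp (- t * (2 * (norm (snd x))\<^sup>2)) * collision_defect (\<lambda>z. g (fst z) * g (snd z)) x)"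
proof -
  let ?d = "CARD('n)"
  define c where "c = (2 * pi) powr (- real ?d)"
  define A where "A = (LINT \<xi>|lborel. (cmod (heat_mult g t 0 \<xi>))\<^sup>2)"
  define D where "D = (LINT x|(lborel \<Otimes>\<^sub>M lborel). exp (- t * (2 * (norm (snd x))\<^sup>2)) * collision_defect (\<lambda>z. g (fst z) * g (snd z)) x)"
  define X where "X = unit_ball_vol ?d * A\<^sup>2 - D / 2"
  have "X \<ge> 0" and r: "riesz_sq f t = ennreal (c ^ 3 * (?d * pi / 2 * X))"
    using nn_integral_riesz_ambiguity(2)[OF heat_mult_integrable(2)[OF g t, of 0]] riesz_sq_eq[OF t]
    by (simp_all only: X_def A_def D_def c_def collision_defect_heat_mult DIM_cart DIM_real mult_1_right)
  \<comment> \<open>\<open>ennreal\<close> sends negative numbers to 0, so the real value can be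
    recovered because \<open>X \<ge> 0\<close>.\<close>
  then have r': "enn2real (riesz_sq f t) = c ^ 3 * (?d * pi / 2 * X)"
    unfolding r by (intro enn2real_ennreal mult_nonneg_nonneg) (simp_all add: c_def)
  have "real ?d / 2 > 0" by simp
  then have Gamma: "Gamma (real ?d / 2 + 1) = real ?d / 2 * Gamma (real ?d / 2)"
    by (intro Gamma_plus1) (auto dest: nonpos_Ints_nonpos)
  have sa: "sphere_area ?d = ?d * unit_ball_vol ?d"
    unfolding sphere_area_def unit_ball_vol_def Gamma by simp
  have cd: "1 / (2 * pi) ^ (?d - 1) = 2 * pi * c"
  proof -
    have "(2 * pi) ^ ?d = 2 * pi * (2 * pi) ^ (?d - 1)"
      by (subst power_eq_if) simp
    moreover have "c = 1 / (2 * pi) ^ ?d"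
      unfolding c_def by (simp add: powr_minus powr_realpow divide_inverse del: power_mult_distrib)
    ultimately show ?thesis by simp
  qed
  have "sphere_area ?d / (4 * (2 * pi) ^ (?d - 1)) = ?d * unit_ball_vol ?d / 4 * (1 / (2 * pi) ^ (?d - 1))"
    by (simp add: sa)
  also have "\<dots> = ?d * unit_ball_vol ?d * pi * c / 2"
    unfolding cd by simp
  finally have const: "sphere_area ?d / (4 * (2 * pi) ^ (?d - 1)) = ?d * unit_ball_vol ?d * pi * c / 2" .
  have "Qfun f t = ?d * unit_ball_vol ?d * pi * c / 2 * (c * A)\<^sup>2 - c ^ 3 * (?d * pi / 2 * X)"
    unfolding Qfun_def r' L2_norm_schrod_heat[OF t] A_def[symmetric] c_def[symmetric] const ..
  also have "\<dots> = c ^ 3 * (?d * pi / 4) * D"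
    by (simp add: X_def power2_eq_square power3_eq_cube algebra_simps)
  finally show ?thesis unfolding c_def D_def .
qed

end

theorem theorem2p3:
  fixes f :: "real^'n \<Rightarrow> complex"
  assumes "CARD('n) \<ge> 2"
    and "is_L2 f"
  shows "(\<forall>t>0. riesz_sq f t < \<infinity>) \<and> completely_monotone (Qfun f)"
proof
  have F: "is_L2 (L2_ft f)" by (rule is_L2_L2_ft[OF assms(2)])
  then have Fm: "L2_ft f \<in> borel_measurable lebesgue" by (simp add: is_L2_def)
  obtain g where g: "sq_integrable g" and ae: "AE \<xi> in lborel. L2_ft f \<xi> = g \<xi>"
    using is_L2_imp_borel_version[OF F] .
  \<comment> \<open>The value is \<open>ennreal\<close> of a real number. Finiteness ensures that
    \<open>enn2real\<close> in \<open>Qfun\<close> does not turn an infinite norm into 0.\<close>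
  show "\<forall>t>0. riesz_sq f t < \<infinity>"
    using riesz_sq_eq[OF g Fm ae] by simp
  let ?p = "\<lambda>z. g (fst z) * g (snd z)"
  have p: "sq_integrable ?p" by (rule sq_integrable_tensor[OF g])
  show "completely_monotone (Qfun f)"
  \<comment> \<open>The Laplace transform lives on pairs \<open>(v, z)\<close>: its exponent is
    \<open>2 * (norm z)\<^sup>2\<close>, and its density is the defect of the undamped product,
    which does not depend on \<open>t\<close>.\<close>
  proof (rule laplace_completely_monotone)
    show "integrable (lborel \<Otimes>\<^sub>M lborel) (collision_defect ?p)"
      by (rule collision_defect_integrable[OF p])
    show "(\<lambda>x. 2 * (norm (snd x))\<^sup>2) \<in> borel_measurable (lborel \<Otimes>\<^sub>M (lborel :: ((real^'n) \<times> (real^'n)) measure))"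
      by measurable
    show "collision_defect ?p x \<ge> 0" for x by (rule collision_defect_nonneg)
    show "Qfun f t = ((2 * pi) powr (- real CARD('n))) ^ 3 * (CARD('n) * pi / 4) *
      (LINT x|(lborel \<Otimes>\<^sub>M lborel). exp (- t * (2 * (norm (snd x))\<^sup>2)) * collision_defect ?p x)" if "t > 0" for t
      by (rule Qfun_eq_laplace[OF g Fm ae that])
  qed simp_all
qed

end
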